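(* Assume that $(X,d,T)$ has the $g$-almost product property and the uniform separation property. Let $f_1,g_1,\dots,f_m,g_m:X\to\mathbb{R}$ be continuous functions with $g_i(x)\ne0$ for all $x\in X$, $i=1,\dots,m$, and $\int g_i\,d\mu\ne0$ for all $\mu\in M(X,T)$, $i=1,\dots,m$. If $C\subseteq\mathbb{R}^m$ is closed and convex and $\psi\in C(X,\mathbb{R})$, then $$P\left(\left\{x\in X: A\left(\left(\frac{\sum_{k=0}^{n-1}f_{j}(T^{k}x)}{\sum_{k=0}^{n-1}g_{j}(T^{k}x)}\right)_{j\in\{1,\dots,m\}}\right)\subseteq C\right\},\psi\right)=\sup\left\{h(T,\mu)+\int\psi\,d\mu:\ \mu\in M(X,T),\ \left(\frac{\int f_i\,d\mu}{\int g_i\,d\mu}\right)_{i\in\{1,\dots,m\}}\in C\right\}.$$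
   Context: Setting. $(X,d)$ is a compact metric space and $T:X\to X$ is continuous. $M(X)$ is the set of Borel probability measures on $X$ with the weak* topology, $M(X,T)$ the subset of $T$-invariant ones, and $h(T,\mu)$ the metric (measure-theoretic) entropy. Fix a countable dense subset $\{\theta_1,\theta_2,\dots\}$ of $C(X,[0,1])$ and metrize $M(X)$ by $\rho(\mu,\nu)=\sum_{k\ge1}2^{-k}|\int \theta_k\,d\mu-\int \theta_k\,d\nu|$; the metric on $X$ is taken to be $d(x,y)=\rho(\delta_x,\delta_y)$ (equivalent to the original one). The $n$-th empirical measure is $L_nx=\frac1n\sum_{k=0}^{n-1}\delta_{T^kx}$. $A(x_n)$ denotes the set of accumulation points (limits of subsequences) of a sequence $(x_n)$; for the sequence of ratios in the claim, this is the set of accumulation points in $\mathbb{R}^m$ as $n\to\infty$ of the terms with nonzero denominators (i.e. of the sequence considered for large $n$). Conventions: $\sup\emptyset=-\infty$; the definition of pressure below gives $P(\emptyset,\psi)=-\infty$. $g$-almost product property: A blow-up function is a nondecreasing unbounded map $g:\mathbb{N}\to\mathbb{N}$ with $g(n)<n$ (for $n\ge1$; the value $0$ is allowed) and $g(n)/n\to0$. Let $\Lambda_n=\{0,\dots,n-1\}$ and $B_n(g;x,\epsilon)=\{y\in X:\exists\Lambda\subset\Lambda_n,\ \#(\Lambda_n\setminus\Lambda)\le g(n),\ \max\{d(T^jx,T^jy):j\in\Lambda\}\le\epsilon\}$. $(X,d,T)$ has the $g$-almost product property (with blow-up function $g$, unrelated to the functions $g_i$) if there is a nonincreasing $\mathbf{m}:\mathbb{R}^+\to\mathbb{N}$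 such that for all $k\ge1$, $x_1,\dots,x_k\in X$, $\epsilon_1,\dots,\epsilon_k>0$ and integers $n_j\ge \mathbf{m}(\epsilon_j)$ ($n_j\geq 1$), $\bigcap_{j=1}^kT^{-M_{j-1}}B_{n_j}(g;x_j,\epsilon_j)\ne\emptyset$, where $M_0=0$, $M_i=n_1+\cdots+n_i$. Uniform separation property: Points $x,y$ are $(\delta,n,\epsilon)$-separated if $\#\{0\le j\le n-1:d(T^jx,T^jy)>\epsilon\}\ge\delta n$; a set is $(\delta,n,\epsilon)$-separated if any two distinct points of it are. For $F\subset M(X)$, $X_{n,F}=\{x:L_nx\in F\}$ and $N(F;\delta,n,\epsilon)$ is the maximal cardinality of a $(\delta,n,\epsilon)$-separated subset of $X_{n,F}$. The property holds if for every $\eta>0$ there are $\delta^*>0,\epsilon^*>0$ such that for every ergodic $\mu\in M(X,T)$ and every neighborhood $F\subset M(X)$ of $\mu$ there is $n^*_{F,\mu,\eta}$ with $N(F;\delta^*,n,\epsilon^* )\ge\exp(n(h(T,\mu)-\eta))$ for all $n\ge n^*_{F,\mu,\eta}$. Topological pressure of an arbitrary set $Z\subset X$ for $\psi\in C(X,\mathbb{R})$: $B_n(x,\epsilon)=\{y:\max_{0\le i\le n-1}d(T^ix,T^iy)\le\epsilon\}$, $S_n\psi=\sum_{i=0}^{n-1}\psi\circ T^i$, $\Gamma_n(Z,\epsilon)$ is the collection of finite or countable covers of $Z$ by sets $B_l(x,\epsilon)$ with $l\ge n$; $M(Z,t,\psi,n,\epsilon)=\inf_{\mathcal{C}\in\Gamma_n(Z,\epsilon)}\sum_{B_l(x,\epsilon)\in\mathcal{C}}\exp(-tl+\sup_{y\in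 B_l(x,\epsilon)}S_l\psi(y))$, $M(Z,t,\psi,\epsilon)=\lim_{n\to\infty}M(Z,t,\psi,n,\epsilon)$, $P(Z,\psi,\epsilon)=\inf\{t:M(Z,t,\psi,\epsilon)=0\}=\sup\{t:M(Z,t,\psi,\epsilon)=\infty\}$, $P(Z,\psi)=\lim_{\epsilon\to0}P(Z,\psi,\epsilon)$. *)

theory Defs
  imports "HOL-Probability.Probability"
begin

text \<open>
  The space \<open>X\<close> is a type \<open>'a\<close> of class \<open>metric_space\<close>, with \<open>compact UNIV\<close> assumed where needed.
  The class metric enters only through its topology and Borel sets: the notions below that
  depend on a metric take it as an argument \<open>d\<close>, so that they can be used with the metric induced
  by \<open>\<rho>\<close>.
\<close>

section \<open>Probability measures and the metric\<close>

definition prob_measures :: "'a::metric_space measure set" where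
  "prob_measures = {\<mu>. prob_space \<mu> \<and> sets \<mu> = sets borel}"

definition invariant_measures :: "('a::metric_space \<Rightarrow> 'a) \<Rightarrow> 'a measure set" where
  "invariant_measures T = {\<mu> \<in> prob_measures. distr \<mu> borel T = \<mu>}"

definition ergodic_measures :: "('a::metric_space \<Rightarrow> 'a) \<Rightarrow> 'a measure set" where
  "ergodic_measures T =
    {\<mu> \<in> invariant_measures T.
      \<forall>A \<in> sets borel. T -` A = A \<longrightarrow> measure \<mu> A = 0 \<or> measure \<mu> A = 1}"

definition dense_sequence :: "(nat \<Rightarrow> 'a::metric_space \<Rightarrow> real) \<Rightarrow> bool" where
  "dense_sequence \<theta> \<longleftrightarrow>
    (\<forall>k. continuous_on UNIV (\<theta> k) \<and> range (\<theta> k) \<subseteq> {0..1}) \<and>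
    (\<forall>f. continuous_on UNIV f \<and> range f \<subseteq> {0..1} \<longrightarrow>
      (\<forall>e>0. \<exists>k. \<forall>x. \<bar>f x - \<theta> k x\<bar> < e))"

text \<open>The sequence \<open>\<theta>\<close> is indexed from \<open>0\<close>, so its \<open>k\<close>-th term has weight \<open>2\<^sup>-\<^sup>(\<^sup>k\<^sup>+\<^sup>1\<^sup>)\<close>.\<close>

definition rho ::
  "(nat \<Rightarrow> 'a::metric_space \<Rightarrow> real) \<Rightarrow> 'a measure \<Rightarrow> 'a measure \<Rightarrow> real" where
  "rho \<theta> \<mu> \<nu> =
    (\<Sum>k. (1 / 2) ^ Suc k * \<bar>integral\<^sup>L \<mu> (\<theta> k) - integral\<^sup>L \<nu> (\<theta> k)\<bar>)"

definition rho_dist :: "(nat \<Rightarrow> 'a::metric_space \<Rightarrow> real) \<Rightarrow> 'a \<Rightarrow> 'a \<Rightarrow> real" where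
  "rho_dist \<theta> x y = rho \<theta> (return borel x) (return borel y)"

definition neighbourhood ::
  "(nat \<Rightarrow> 'a::metric_space \<Rightarrow> real) \<Rightarrow> 'a measure \<Rightarrow> 'a measure set \<Rightarrow> bool" where
  "neighbourhood \<theta> \<mu> F \<longleftrightarrow>
    F \<subseteq> prob_measures \<and> (\<exists>r>0. \<forall>\<nu>\<in>prob_measures. rho \<theta> \<mu> \<nu> < r \<longrightarrow> \<nu> \<in> F)"

text \<open>
  For \<open>n \<ge> 1\<close> this is \<open>(1/n) (\<delta>\<^sub>x + \<dots> + \<delta>\<^bsub>T^(n-1) x\<^esub>)\<close>, the law of \<open>T\<^sup>k x\<close> with \<open>k\<close>
  uniformly distributed on \<open>{0,\<dots>,n-1}\<close>; for \<open>n = 0\<close> it is the zero measure.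
\<close>

definition empirical_measure ::
  "('a::metric_space \<Rightarrow> 'a) \<Rightarrow> nat \<Rightarrow> 'a \<Rightarrow> 'a measure" where
  "empirical_measure T n x = distr (uniform_count_measure {..<n}) borel (\<lambda>k. (T ^^ k) x)"

definition birkhoff_sum :: "('a \<Rightarrow> 'a) \<Rightarrow> ('a \<Rightarrow> real) \<Rightarrow> nat \<Rightarrow> 'a \<Rightarrow> real" where
  "birkhoff_sum T f n x = (\<Sum>k<n. f ((T ^^ k) x))"

section \<open>Metric entropy\<close>

definition measurable_partition :: "'a::metric_space set set \<Rightarrow> bool" where
  "measurable_partition P \<longleftrightarrow> partition_on UNIV P \<and> finite P \<and> P \<subseteq> sets borel"

text \<open>The join of \<open>P, T\<^sup>-\<^sup>1 P, \<dots>, T\<^sup>-\<^sup>(\<^sup>n\<^sup>-\<^sup>1\<^sup>) P\<close>; \<open>s\<close> is the itinerary of an atom.\<close>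

definition join_partition :: "('a \<Rightarrow> 'a) \<Rightarrow> 'a set set \<Rightarrow> nat \<Rightarrow> 'a set set" where
  "join_partition T P n = {(\<Inter>i<n. (T ^^ i) -` s i) | s. \<forall>i<n. s i \<in> P} - {{}}"

text \<open>Since \<open>ln 0 = 0\<close>, atoms of measure zero contribute \<open>0\<close>.\<close>

definition partition_entropy :: "'a measure \<Rightarrow> 'a set set \<Rightarrow> real" where
  "partition_entropy \<mu> P = (\<Sum>A\<in>P. - (measure \<mu> A * ln (measure \<mu> A)))"

definition entropy_wrt :: "('a \<Rightarrow> 'a) \<Rightarrow> 'a measure \<Rightarrow> 'a set set \<Rightarrow> real" where
  "entropy_wrt T \<mu> P = lim (\<lambda>n. partition_entropy \<mu> (join_partition T P n) / real n)"

definition metric_entropy :: "('a::metric_space \<Rightarrow> 'a) \<Rightarrow> 'a measure \<Rightarrow> ereal" where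
  "metric_entropy T \<mu> = (SUP P \<in> Collect measurable_partition. ereal (entropy_wrt T \<mu> P))"

section \<open>The \<open>g\<close>-almost product property\<close>

definition blowup :: "(nat \<Rightarrow> nat) \<Rightarrow> bool" where
  "blowup g \<longleftrightarrow>
    mono_on {1..} g \<and> (\<forall>K. \<exists>n\<ge>1. K < g n) \<and> (\<forall>n\<ge>1. g n < n) \<and>
    (\<lambda>n. real (g n) / real n) \<longlonglongrightarrow> 0"

definition blowup_ball ::
  "('a \<Rightarrow> 'a \<Rightarrow> real) \<Rightarrow> ('a \<Rightarrow> 'a) \<Rightarrow> (nat \<Rightarrow> nat) \<Rightarrow> nat \<Rightarrow> 'a \<Rightarrow> real \<Rightarrow> 'a set" where
  "blowup_ball d T g n x \<epsilon> =
    {y. \<exists>\<Lambda>\<subseteq>{..<n}. card ({..<n} - \<Lambda>) \<le> g n \<and> (\<forall>j\<in>\<Lambda>. d ((T ^^ j) x) ((T ^^ j) y) \<le> \<epsilon>)}"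

definition almost_product ::
  "('a \<Rightarrow> 'a \<Rightarrow> real) \<Rightarrow> ('a \<Rightarrow> 'a) \<Rightarrow> (nat \<Rightarrow> nat) \<Rightarrow> bool" where
  "almost_product d T g \<longleftrightarrow>
    (\<exists>m :: real \<Rightarrow> nat. antimono_on {0<..} m \<and>
      (\<forall>k\<ge>1. \<forall>(x :: nat \<Rightarrow> 'a) (\<epsilon> :: nat \<Rightarrow> real) (n :: nat \<Rightarrow> nat).
        (\<forall>j\<in>{1..k}. \<epsilon> j > 0 \<and> n j \<ge> m (\<epsilon> j) \<and> n j \<ge> 1) \<longrightarrow>
        (\<Inter>j\<in>{1..k}. (T ^^ (\<Sum>i=1..j-1. n i)) -` blowup_ball d T g (n j) (x j) (\<epsilon> j)) \<noteq> {}))"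

section \<open>The uniform separation property\<close>

definition separated_points ::
  "('a \<Rightarrow> 'a \<Rightarrow> real) \<Rightarrow> ('a \<Rightarrow> 'a) \<Rightarrow> real \<Rightarrow> nat \<Rightarrow> real \<Rightarrow> 'a \<Rightarrow> 'a \<Rightarrow> bool" where
  "separated_points d T \<delta> n \<epsilon> x y \<longleftrightarrow>
    real (card {j. j < n \<and> d ((T ^^ j) x) ((T ^^ j) y) > \<epsilon>}) \<ge> \<delta> * real n"

definition separated_set ::
  "('a \<Rightarrow> 'a \<Rightarrow> real) \<Rightarrow> ('a \<Rightarrow> 'a) \<Rightarrow> real \<Rightarrow> nat \<Rightarrow> real \<Rightarrow> 'a set \<Rightarrow> bool" where
  "separated_set d T \<delta> n \<epsilon> E \<longleftrightarrow>
    (\<forall>x\<in>E. \<forall>y\<in>E. x \<noteq> y \<longrightarrow> separated_points d T \<delta> n \<epsilon> x y)"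

text \<open>
  The supremum over finite separated sets equals the maximal cardinality (\<open>\<infinity>\<close> if there is no
  bound), avoiding \<open>card E = 0\<close> for infinite \<open>E\<close>.
\<close>

definition max_separated ::
  "('a::metric_space \<Rightarrow> 'a \<Rightarrow> real) \<Rightarrow> ('a \<Rightarrow> 'a) \<Rightarrow> 'a measure set \<Rightarrow> real \<Rightarrow> nat \<Rightarrow> real \<Rightarrow> ereal"
where
  "max_separated d T F \<delta> n \<epsilon> =
    (SUP E \<in> {E. finite E \<and> E \<subseteq> {x. empirical_measure T n x \<in> F} \<and> separated_set d T \<delta> n \<epsilon> E}.
      ereal (real (card E)))"

definition ereal_exp :: "ereal \<Rightarrow> ereal" where
  "ereal_exp a = (case a of ereal r \<Rightarrow> ereal (exp r) | PInfty \<Rightarrow> \<infinity> | MInfty \<Rightarrow> 0)"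

definition uniform_separation ::
  "(nat \<Rightarrow> 'a::metric_space \<Rightarrow> real) \<Rightarrow> ('a \<Rightarrow> 'a) \<Rightarrow> bool" where
  "uniform_separation \<theta> T \<longleftrightarrow>
    (\<forall>\<eta>>0. \<exists>\<delta>>0. \<exists>\<epsilon>>0. \<forall>\<mu>\<in>ergodic_measures T. \<forall>F. neighbourhood \<theta> \<mu> F \<longrightarrow>
      (\<exists>n0. \<forall>n\<ge>n0.
        max_separated (rho_dist \<theta>) T F \<delta> n \<epsilon>
          \<ge> ereal_exp (ereal (real n) * (metric_entropy T \<mu> - ereal \<eta>))))"

section \<open>Topological pressure of arbitrary sets\<close>

definition bowen_ball ::
  "('a \<Rightarrow> 'a \<Rightarrow> real) \<Rightarrow> ('a \<Rightarrow> 'a) \<Rightarrow> nat \<Rightarrow> 'a \<Rightarrow> real \<Rightarrow> 'a set" where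
  "bowen_ball d T n x \<epsilon> = {y. \<forall>i<n. d ((T ^^ i) x) ((T ^^ i) y) \<le> \<epsilon>}"

text \<open>A cover by sets \<open>B\<^sub>l(x,\<epsilon>)\<close> is encoded by the set of pairs \<open>(l, x)\<close>.\<close>

definition bowen_covers ::
  "('a \<Rightarrow> 'a \<Rightarrow> real) \<Rightarrow> ('a \<Rightarrow> 'a) \<Rightarrow> 'a set \<Rightarrow> nat \<Rightarrow> real \<Rightarrow> (nat \<times> 'a) set set" where
  "bowen_covers d T Z n \<epsilon> =
    {\<C>. countable \<C> \<and> (\<forall>(l, x)\<in>\<C>. l \<ge> n) \<and> Z \<subseteq> (\<Union>(l, x)\<in>\<C>. bowen_ball d T l x \<epsilon>)}"

definition pressure_sum ::
  "('a \<Rightarrow> 'a \<Rightarrow> real) \<Rightarrow> ('a \<Rightarrow> 'a) \<Rightarrow> 'a set \<Rightarrow> real \<Rightarrow> ('a \<Rightarrow> real) \<Rightarrow> nat \<Rightarrow> real \<Rightarrow> ennreal"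
where
  "pressure_sum d T Z t \<psi> n \<epsilon> =
    (INF \<C> \<in> bowen_covers d T Z n \<epsilon>. \<Sum>\<^sub>\<infinity>(l, x)\<in>\<C>.
      ennreal (exp (- t * real l + (SUP y \<in> bowen_ball d T l x \<epsilon>. birkhoff_sum T \<psi> l y))))"

definition pressure_limit ::
  "('a \<Rightarrow> 'a \<Rightarrow> real) \<Rightarrow> ('a \<Rightarrow> 'a) \<Rightarrow> 'a set \<Rightarrow> real \<Rightarrow> ('a \<Rightarrow> real) \<Rightarrow> real \<Rightarrow> ennreal" where
  "pressure_limit d T Z t \<psi> \<epsilon> = lim (\<lambda>n. pressure_sum d T Z t \<psi> n \<epsilon>)"

definition pressure_at ::
  "('a \<Rightarrow> 'a \<Rightarrow> real) \<Rightarrow> ('a \<Rightarrow> 'a) \<Rightarrow> 'a set \<Rightarrow> ('a \<Rightarrow> real) \<Rightarrow> real \<Rightarrow> ereal" where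
  "pressure_at d T Z \<psi> \<epsilon> = (INF t \<in> {t. pressure_limit d T Z t \<psi> \<epsilon> = 0}. ereal t)"

definition pressure ::
  "('a \<Rightarrow> 'a \<Rightarrow> real) \<Rightarrow> ('a \<Rightarrow> 'a) \<Rightarrow> 'a set \<Rightarrow> ('a \<Rightarrow> real) \<Rightarrow> ereal" where
  "pressure d T Z \<psi> = Lim (at_right 0) (\<lambda>\<epsilon>. pressure_at d T Z \<psi> \<epsilon>)"

section \<open>Accumulation points\<close>

text \<open>Limits of subsequences of \<open>u\<close> along indices in \<open>N\<close>, the set where \<open>u\<close> is meaningful.\<close>

definition accumulation_points ::
  "nat set \<Rightarrow> (nat \<Rightarrow> 'b::topological_space) \<Rightarrow> 'b set" where
  "accumulation_points N u = {a. \<exists>r. strict_mono r \<and> range r \<subseteq> N \<and> (u \<circ> r) \<longlonglongrightarrow> a}"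

definition birkhoff_ratio ::
  "('a \<Rightarrow> 'a) \<Rightarrow> ('m::finite \<Rightarrow> 'a \<Rightarrow> real) \<Rightarrow> ('m \<Rightarrow> 'a \<Rightarrow> real) \<Rightarrow> 'a \<Rightarrow> nat \<Rightarrow> real ^ 'm" where
  "birkhoff_ratio T f g x n = (\<chi> j. birkhoff_sum T (f j) n x / birkhoff_sum T (g j) n x)"

definition ratio_accumulation ::
  "('a \<Rightarrow> 'a) \<Rightarrow> ('m::finite \<Rightarrow> 'a \<Rightarrow> real) \<Rightarrow> ('m \<Rightarrow> 'a \<Rightarrow> real) \<Rightarrow> 'a \<Rightarrow> (real ^ 'm) set" where
  "ratio_accumulation T f g x =
    accumulation_points {n. \<forall>j. birkhoff_sum T (g j) n x \<noteq> 0} (birkhoff_ratio T f g x)"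

end

theory Submission
  imports Defs
begin

text \<open>
  Write \<open>R \<mu>\<close> for the vector of ratios of the integrals of \<open>f\<^sub>i\<close> and \<open>g\<^sub>i\<close>. Every accumulation
  point of the Birkhoff averages of \<open>(f, g, \<psi>)\<close> along an orbit is the vector of integrals of an
  invariant measure, so the denominators do not vanish in the limit and the ratios accumulate in
  \<open>C\<close> exactly when all limit measures satisfy \<open>R \<mu> \<in> C\<close>.

  Upper bound: by Misiurewicz's argument the orbit segments whose averages are close to a vector
  \<open>v\<close> are exponentially no more numerous, up to \<open>\<epsilon>\<close>-separation, than the entropy of an invariant
  measure with integrals \<open>v\<close> allows. By Lindelof countably many neighbourhoods cover all relevant
  \<open>v\<close>, and for a point of the set infinitely many of its averages lie in one of them, so maximal
  separated sets yield covers with arbitrarily small sums.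

  Lower bound: fix an invariant \<open>\<mu>\<close> with \<open>R \<mu> \<in> C\<close>. Sampling long orbit segments independently
  according to \<open>\<mu>\<close> and concatenating them gives, by the law of large numbers alone and without
  ergodicity, pseudo-orbits with averages close to those of \<open>\<mu>\<close>, and there are about
  \<open>exp (n h)\<close> of them with pairwise far itineraries in the Hamming distance. The almost product
  property lets true orbits shadow arbitrary sequences of such pseudo-orbits; the resulting
  Moran-type set consists of points with averages converging to those of \<open>\<mu>\<close>, and counting codes
  bounds its pressure from below by \<open>h + \<integral>\<psi> d\<mu>\<close>.
\<close>

section \<open>Integrals of continuous functions\<close>

text \<open>Three obstacles shape the construction. The pressure admits balls of unrelated lengths
  in one cover, so a count at a single length decides nothing: above, every large length contributes
  its own separated set and the sums form geometric series; below, the cover is first made finite by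
  compactness and then weighed against the uniform count of codes. Shadowing tolerates a few errors
  per segment, and points near the boundary of an atom may have different names without being far
  apart; words that differ in a fixed proportion of letters survive both losses. Finally, the
  averages must converge while the scale at which codes are told apart stays fixed: this scale is
  chosen from the measure, a partition and the entropy gap, before the precision of the averages,
  and superblocks of one precision are repeated until those of the next are short against the
  elapsed time. The functions \<open>f\<close>, \<open>g\<close> and \<open>\<psi>\<close> form a
  single vector-valued observable, so that the constraint and the weight are controlled on the same
  orbit segments.\<close>

lemma open_eq_support:
  fixes U :: "'a::metric_space set"
  assumes "open U"
  obtains u :: "'a \<Rightarrow> real" where "continuous_on UNIV u" "\<And>x. 0 \<le> u x" "\<And>x. u x \<le> 1"
    "\<And>x. 0 < u x \<longleftrightarrow> x \<in> U"
proof (cases "U = UNIV")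
  case True
  then show ?thesis using that[of "\<lambda>_. 1"] by auto
next
  case False
  define u where "u x = min 1 (infdist x (- U))" for x
  have cl: "closed (- U)" "- U \<noteq> {}" using assms False by auto
  have "0 < infdist x (- U) \<longleftrightarrow> x \<in> U" for x
    using in_closed_iff_infdist_zero[OF cl, of x] infdist_nonneg[of x "- U"] by (auto simp: less_le)
  then show ?thesis
    using infdist_nonneg[of _ "- U"]
    by (intro that[of u]) (auto simp: u_def intro!: continuous_intros)
qed

lemma closed_indicator_approx:
  fixes F :: "'a::metric_space set"
  assumes "closed F"
  obtains u :: "nat \<Rightarrow> 'a \<Rightarrow> real" where "\<And>n. continuous_on UNIV (u n)"
    "\<And>n x. indicator F x \<le> u n x" "\<And>n x. u n x \<le> 1" "\<And>x. (\<lambda>n. u n x) \<longlonglongrightarrow> indicator F x"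
proof -
  obtain v :: "'a \<Rightarrow> real" where v: "continuous_on UNIV v" "\<And>x. 0 \<le> v x" "\<And>x. v x \<le> 1"
    "\<And>x. 0 < v x \<longleftrightarrow> x \<in> - F"
    using open_eq_support[of "- F"] assms by auto
  define u where "u n x = max 0 (1 - real n * v x)" for n x
  have "(\<lambda>n. u n x) \<longlonglongrightarrow> indicator F x" for x
  proof (cases "x \<in> F")
    case True
    then have "v x = 0" using v(4)[of x] v(2)[of x] by (auto simp: less_le)
    then show ?thesis using True by (auto simp: u_def)
  next
    case False
    then have pos: "0 < v x" using v(4) by auto
    obtain N where N: "1 < real N * v x" using pos reals_Archimedean3 by blast
    have "u n x = 0" if "n \<ge> N" for n
    proof -
      have "real N * v x \<le> real n * v x" using that pos by (intro mult_right_mono) auto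
      then show ?thesis using N by (auto simp: u_def)
    qed
    then have "eventually (\<lambda>n. u n x = 0) sequentially" by (auto simp: eventually_sequentially)
    then show ?thesis using False by (auto intro: tendsto_eventually)
  qed
  moreover have "indicator F x \<le> u n x" for n x
  proof (cases "x \<in> F")
    case True
    then have "v x = 0" using v(4)[of x] v(2)[of x] by (auto simp: less_le)
    then show ?thesis by (auto simp: u_def)
  qed (auto simp: u_def)
  moreover have "continuous_on UNIV (u n)" for n
    unfolding u_def by (intro continuous_intros v)
  moreover have "u n x \<le> 1" for n x using v(2)[of x] by (auto simp: u_def)
  ultimately show ?thesis using that by blast
qed

lemma continuous_bounded_compact:
  fixes f :: "'a::metric_space \<Rightarrow> real"
  assumes "compact (UNIV :: 'a set)" "continuous_on UNIV f"
  shows "\<exists>B>0. \<forall>x. \<bar>f x\<bar> \<le> B"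
proof -
  have "bounded (range f)" using assms by (intro compact_imp_bounded compact_continuous_image)
  then show ?thesis by (auto simp: bounded_pos)
qed

text \<open>The density of \<open>\<theta>\<close> and the layer argument for the representing
  measure concern functions with values in the unit interval; an affine change reduces every
  continuous function to these.\<close>

lemma continuous_affine_unit_range:
  fixes f :: "'a::metric_space \<Rightarrow> real"
  assumes "compact (UNIV :: 'a set)" "continuous_on UNIV f"
  shows "\<exists>B g. continuous_on UNIV g \<and> (\<forall>x. 0 \<le> g x) \<and> (\<forall>x. g x \<le> 1) \<and> f = (\<lambda>x. 2 * B * g x + (- B))"
proof -
  obtain B where B: "B > 0" "\<And>x. \<bar>f x\<bar> \<le> B" using continuous_bounded_compact[OF assms] by blast
  define g where "g x = (f x + B) / (2 * B)" for x
  have "0 \<le> g x" "g x \<le> 1" for x using B(1) B(2)[of x] by (auto simp: g_def field_simps abs_le_iff)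
  moreover have "continuous_on UNIV g" unfolding g_def using B by (intro continuous_intros assms) auto
  moreover have "f = (\<lambda>x. 2 * B * g x + (- B))" using B by (auto simp: g_def)
  ultimately show ?thesis by blast
qed

lemma integrable_continuous_compact:
  fixes f :: "'a::metric_space \<Rightarrow> real"
  assumes "compact (UNIV :: 'a set)" "finite_measure \<mu>" "sets \<mu> = sets borel" "continuous_on UNIV f"
  shows "integrable \<mu> f"
proof -
  interpret finite_measure \<mu> by fact
  obtain B where "\<And>x. \<bar>f x\<bar> \<le> B" using continuous_bounded_compact[OF assms(1,4)] by blast
  moreover have "f \<in> borel_measurable \<mu>"
    using borel_measurable_continuous_onI[OF assms(4)] measurable_cong_sets[OF assms(3) refl, of borel]
    by blast
  ultimately show ?thesis by (intro integrable_const_bound[where B = B]) auto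
qed

lemma measure_closed_LIMSEQ:
  fixes F :: "'a::metric_space set"
  assumes "compact (UNIV :: 'a set)" "finite_measure \<mu>" "sets \<mu> = sets borel" "closed F"
    and u: "\<And>n. continuous_on UNIV (u n)"
    "\<And>n x. indicator F x \<le> u n x" "\<And>n x. u n x \<le> (1::real)" "\<And>x. (\<lambda>n. u n x) \<longlonglongrightarrow> indicator F x"
  shows "(\<lambda>n. integral\<^sup>L \<mu> (u n)) \<longlonglongrightarrow> measure \<mu> F"
proof -
  interpret finite_measure \<mu> by fact
  have F: "F \<in> sets \<mu>" using assms by auto
  have *: "\<bar>u n x\<bar> \<le> 1" for n x
    using order.trans[OF indicator_pos_le u(2)[of x n]] u(3)[of n x] by auto
  have m: "u n \<in> borel_measurable \<mu>" for n
    using borel_measurable_continuous_onI[OF u(1)] measurable_cong_sets[OF assms(3) refl, of borel]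
    by blast
  have "(\<lambda>n. integral\<^sup>L \<mu> (u n)) \<longlonglongrightarrow> integral\<^sup>L \<mu> (indicator F)"
    by (rule integral_dominated_convergence[where w = "\<lambda>_. 1"]) (use m u(4) * F in auto)
  then show ?thesis using F sets.sets_into_space[OF F] by (simp add: inf_absorb1)
qed

text \<open>Closed sets are stable under intersection and generate the Borel sets, and their
  measures are limits of integrals of continuous functions.\<close>

lemma measure_eqI_continuous:
  fixes \<mu> \<nu> :: "'a::metric_space measure"
  assumes c: "compact (UNIV :: 'a set)" and mu: "finite_measure \<mu>" "sets \<mu> = sets borel"
    and nu: "finite_measure \<nu>" "sets \<nu> = sets borel"
    and eq: "\<And>f. continuous_on UNIV f \<Longrightarrow> integral\<^sup>L \<mu> f = (integral\<^sup>L \<nu> f :: real)"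
  shows "\<mu> = \<nu>"
proof -
  interpret mu: finite_measure \<mu> by fact
  interpret nu: finite_measure \<nu> by fact
  have eqF: "emeasure \<mu> F = emeasure \<nu> F" if F: "closed F" for F
  proof -
    obtain u :: "nat \<Rightarrow> 'a \<Rightarrow> real" where u: "\<And>n. continuous_on UNIV (u n)"
      "\<And>n x. indicator F x \<le> u n x" "\<And>n x. u n x \<le> 1" "\<And>x. (\<lambda>n. u n x) \<longlonglongrightarrow> indicator F x"
      using closed_indicator_approx[OF F] by blast
    have "measure \<mu> F = measure \<nu> F"
      using measure_closed_LIMSEQ[OF c mu F u] measure_closed_LIMSEQ[OF c nu F u] eq[OF u(1)]
      by (auto intro: LIMSEQ_unique)
    then show ?thesis by (simp add: mu.emeasure_eq_measure nu.emeasure_eq_measure)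
  qed
  show ?thesis
  proof (rule measure_eqI_generator_eq[where E = "Collect closed" and \<Omega> = UNIV and A = "\<lambda>_. UNIV"])
    show "sets \<mu> = sigma_sets UNIV (Collect closed)" "sets \<nu> = sigma_sets UNIV (Collect closed)"
      using mu nu by (auto simp: borel_eq_closed)
  qed (auto simp: Int_stable_def eqF)
qed

text \<open>Each \<open>L k\<close> is a monotone functional on all functions and need not be given
  as a measure, so averages over finite sets of orbit segments can be inserted as they are and
  evaluated at indicators.\<close>

lemma portmanteau_closed:
  fixes F :: "'a::metric_space set" and L :: "nat \<Rightarrow> ('a \<Rightarrow> real) \<Rightarrow> real"
  assumes c: "compact (UNIV :: 'a set)" and mu: "finite_measure \<mu>" "sets \<mu> = sets borel"
    and lim: "\<And>f. continuous_on UNIV f \<Longrightarrow> (\<lambda>k. L k f) \<longlonglongrightarrow> integral\<^sup>L \<mu> f"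
    and mono: "\<And>k f g. (\<And>x. f x \<le> g x) \<Longrightarrow> L k f \<le> L k g"
    and F: "closed F" and e: "e > 0"
  shows "eventually (\<lambda>k. L k (indicator F) \<le> measure \<mu> F + e) sequentially"
proof -
  obtain u :: "nat \<Rightarrow> 'a \<Rightarrow> real" where u: "\<And>n. continuous_on UNIV (u n)"
    "\<And>n x. indicator F x \<le> u n x" "\<And>n x. u n x \<le> 1" "\<And>x. (\<lambda>n. u n x) \<longlonglongrightarrow> indicator F x"
    using closed_indicator_approx[OF F] by blast
  have "eventually (\<lambda>n. integral\<^sup>L \<mu> (u n) < measure \<mu> F + e) sequentially"
    using measure_closed_LIMSEQ[OF c mu F u] e by (intro order_tendstoD(2)) auto
  then obtain n where "integral\<^sup>L \<mu> (u n) < measure \<mu> F + e" by (auto simp: eventually_sequentially)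
  with lim[OF u(1)] have "eventually (\<lambda>k. L k (u n) < measure \<mu> F + e) sequentially"
    by (intro order_tendstoD(2)) auto
  then show ?thesis
    by eventually_elim (use mono[of "indicator F" "u n", OF u(2)] in \<open>meson less_imp_le order.trans\<close>)
qed

text \<open>The bound for closed sets, applied to the closures of \<open>A\<close> and of its
  complement, gives both estimates: a null frontier makes the closures as small in measure as the
  sets, and \<open>compl\<close> turns the second bound into a lower one.\<close>

lemma portmanteau_frontier_null:
  fixes A :: "'a::metric_space set" and L :: "nat \<Rightarrow> ('a \<Rightarrow> real) \<Rightarrow> real"
  assumes c: "compact (UNIV :: 'a set)" and mu: "prob_space \<mu>" "sets \<mu> = sets borel"
    and lim: "\<And>f. continuous_on UNIV f \<Longrightarrow> (\<lambda>k. L k f) \<longlonglongrightarrow> integral\<^sup>L \<mu> f"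
    and mono: "\<And>k f g. (\<And>x. f x \<le> g x) \<Longrightarrow> L k f \<le> L k g"
    and compl: "\<And>k A. L k (indicator (- A)) = 1 - L k (indicator A)"
    and null: "measure \<mu> (frontier A) = 0" and A: "A \<in> sets borel"
  shows "(\<lambda>k. L k (indicator A)) \<longlonglongrightarrow> measure \<mu> A"
proof -
  interpret prob_space \<mu> by fact
  have sp: "space \<mu> = UNIV" using sets_eq_imp_space_eq[OF mu(2)] by simp
  have fin: "finite_measure \<mu>" by unfold_locales
  have upper: "eventually (\<lambda>k. L k (indicator B) \<le> measure \<mu> B + e) sequentially"
    if "measure \<mu> (frontier B) = 0" "B \<in> sets borel" "e > 0" for B e
  proof -
    have "measure \<mu> (closure B) \<le> measure \<mu> (B \<union> frontier B)"
      using that mu by (intro finite_measure_mono) (use interior_subset[of B] in \<open>auto simp: frontier_def\<close>)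
    also have "\<dots> \<le> measure \<mu> B + measure \<mu> (frontier B)"
      using that mu by (intro measure_Un_le) auto
    finally have le: "measure \<mu> (closure B) \<le> measure \<mu> B" using that by simp
    have "eventually (\<lambda>k. L k (indicator (closure B)) \<le> measure \<mu> (closure B) + e) sequentially"
      by (rule portmanteau_closed[OF c fin mu(2) lim mono _ that(3)]) auto
    moreover have "L k (indicator B) \<le> L k (indicator (closure B))" for k :: nat
      by (rule mono) (use closure_subset[of B] in \<open>auto simp: indicator_def\<close>)
    ultimately show ?thesis
      using le by (elim eventually_mono) (meson add_right_mono order.trans)
  qed
  have mc: "measure \<mu> (- A) = 1 - measure \<mu> A"
    using prob_compl[of A] A mu(2) sp by (metis Compl_eq_Diff_UNIV)
  show ?thesis
  proof (rule tendstoI)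
    fix e :: real assume e: "e > 0"
    have "eventually (\<lambda>k. L k (indicator A) \<le> measure \<mu> A + e/2) sequentially"
      using e A null by (intro upper) auto
    moreover have "eventually (\<lambda>k. L k (indicator (-A)) \<le> measure \<mu> (-A) + e/2) sequentially"
      using e A null by (intro upper) (auto simp: frontier_complement)
    ultimately show "eventually (\<lambda>k. dist (L k (indicator A)) (measure \<mu> A) < e) sequentially"
    proof eventually_elim
      case (elim k)
      then have "\<bar>L k (indicator A) - measure \<mu> A\<bar> \<le> e/2"
        using compl[of k A] mc by linarith
      then show ?case using e by (simp add: dist_real_def)
    qed
  qed
qed

section \<open>Weak limits of measures on a compact space\<close>

text \<open>Setting of the Riesz representation theorem. Linearity is asked for continuous functions
  only, because the functional to which it is applied is a limit that is known to exist only for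
  them.\<close>

locale positive_functional =
  fixes L :: "('a::metric_space \<Rightarrow> real) \<Rightarrow> real"
  assumes compact: "compact (UNIV :: 'a set)"
    and add: "continuous_on UNIV f \<Longrightarrow> continuous_on UNIV g \<Longrightarrow> L (\<lambda>x. f x + g x) = L f + L g"
    and scale: "continuous_on UNIV f \<Longrightarrow> L (\<lambda>x. c * f x) = c * L f"
    and pos: "continuous_on UNIV f \<Longrightarrow> (\<And>x. 0 \<le> f x) \<Longrightarrow> 0 \<le> L f"
    and one: "L (\<lambda>x. 1) = 1"
begin

lemma const: "L (\<lambda>x. c) = c"
  using scale[of "\<lambda>_. 1" c] one by simp

lemma mono: "L f \<le> L g" if "continuous_on UNIV f" "continuous_on UNIV g" "\<And>x. f x \<le> g x"
proof -
  have "0 \<le> L (\<lambda>x. g x + (-1) * f x)" by (intro pos continuous_intros that) (use that in auto)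
  also have "\<dots> = L g - L f" using that scale[of f "-1"] by (subst add) (auto intro!: continuous_intros)
  finally show ?thesis by simp
qed

lemma sum: "L (\<lambda>x. \<Sum>i\<in>I. f i x) = (\<Sum>i\<in>I. L (f i))"
  if "finite I" "\<And>i. i \<in> I \<Longrightarrow> continuous_on UNIV (f i)"
  using that by (induction I rule: finite_induct) (auto simp: const add continuous_on_sum)

text \<open>The content of an open set in the Riesz construction; \<open>outer\<close> extends it to
  all sets as an outer measure, whose measurable sets turn out to include the open ones.\<close>

definition inner_content :: "'a set \<Rightarrow> ennreal" where
  "inner_content U = (SUP f\<in>{f. continuous_on UNIV f \<and> (\<forall>x. 0 \<le> f x \<and> f x \<le> indicator U x)}. ennreal (L f))"

definition outer :: "'a set \<Rightarrow> ennreal" where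
  "outer A = (INF U\<in>{U. open U \<and> A \<subseteq> U}. inner_content U)"

lemma inner_content_upper:
  "continuous_on UNIV f \<Longrightarrow> (\<And>x. 0 \<le> f x) \<Longrightarrow> (\<And>x. f x \<le> indicator U x) \<Longrightarrow> ennreal (L f) \<le> inner_content U"
  unfolding inner_content_def by (intro SUP_upper) auto

lemma inner_content_mono: "U \<subseteq> V \<Longrightarrow> inner_content U \<le> inner_content V"
proof -
  assume "U \<subseteq> V"
  then have "indicator U x \<le> (indicator V x :: real)" for x by (auto simp: indicator_def)
  then show ?thesis
    unfolding inner_content_def by (intro SUP_subset_mono) (auto simp del: indicator_simps intro: order.trans)
qed

lemma inner_content_le_1: "inner_content U \<le> 1"
  unfolding inner_content_def
proof (intro SUP_least)
  fix f :: "'a \<Rightarrow> real" assume "f \<in> {f. continuous_on UNIV f \<and> (\<forall>x. 0 \<le> f x \<and> f x \<le> indicator U x)}"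
  then have f: "continuous_on UNIV f" "\<And>x. f x \<le> indicator U x" by auto
  have "L f \<le> L (\<lambda>x. 1)" using f by (intro mono) (auto intro: order.trans[OF _ indicator_le_1])
  then show "ennreal (L f) \<le> 1" by (simp add: one)
qed

lemma inner_content_UNIV: "inner_content UNIV = 1"
  using inner_content_upper[of "\<lambda>_. 1" UNIV] inner_content_le_1[of UNIV] by (auto simp: one intro!: antisym)

lemma outer_open: "open U \<Longrightarrow> outer U = inner_content U"
  unfolding outer_def by (intro antisym INF_lower INF_greatest) (auto intro: inner_content_mono)

lemma outer_mono: "A \<subseteq> B \<Longrightarrow> outer A \<le> outer B"
  unfolding outer_def by (intro INF_superset_mono) auto

lemma outer_le_1: "outer A \<le> 1"
  using outer_mono[of A UNIV] outer_open[of UNIV] inner_content_UNIV by simp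

text \<open>After this cut the function vanishes outside the closed set where \<open>f\<close> is at
  least \<open>e\<close>; that set is compact and lies inside every set whose indicator dominates
  \<open>f\<close>. The price is \<open>e\<close>.\<close>

lemma truncate:
  assumes "continuous_on UNIV f" "0 < e"
  shows "L f \<le> L (\<lambda>x. max 0 (f x - e)) + e"
proof -
  have "L f \<le> L (\<lambda>x. max 0 (f x - e) + e)" using assms by (intro mono continuous_intros) auto
  also have "\<dots> = L (\<lambda>x. max 0 (f x - e)) + e" using assms by (subst add) (auto simp: const intro!: continuous_intros)
  finally show ?thesis .
qed

text \<open>A partition of unity: the truncated function lives on the compact \<open>K\<close>,
  finitely many \<open>U i\<close> cover \<open>K\<close>, and the function is divided among them in
  proportion to \<open>u i\<close>.\<close>

lemma inner_content_subadditive: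
  assumes "\<And>i::nat. open (U i)"
  shows "inner_content (\<Union>i. U i) \<le> (\<Sum>i. inner_content (U i))"
  unfolding inner_content_def[of "\<Union>i. U i"]
proof (rule SUP_least)
  fix f :: "'a \<Rightarrow> real"
  assume "f \<in> {f. continuous_on UNIV f \<and> (\<forall>x. 0 \<le> f x \<and> f x \<le> indicator (\<Union>i. U i) x)}"
  then have f: "continuous_on UNIV f" "\<And>x. 0 \<le> f x" "\<And>x. f x \<le> indicator (\<Union>i. U i) x" by auto
  show "ennreal (L f) \<le> (\<Sum>i. inner_content (U i))"
  proof (rule ennreal_le_epsilon)
    fix e :: real assume e: "0 < e"
    define K where "K = {x. e \<le> f x}"
    have "closed K" unfolding K_def using f(1) by (intro closed_Collect_le continuous_intros) auto
    then have K: "compact K" using compact closed_Int_compact[of K UNIV] by simp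
    have "K \<subseteq> (\<Union>i. U i)"
    proof
      fix x assume "x \<in> K"
      then have "e \<le> indicator (\<Union>i. U i) x" using f(3)[of x] by (auto simp: K_def)
      then show "x \<in> (\<Union>i. U i)" using e by (auto simp: indicator_def of_bool_def split: if_splits)
    qed
    then obtain I where I: "finite I" "K \<subseteq> (\<Union>i\<in>I. U i)"
      using compactE_image[OF K, of UNIV U] assms by auto
    have "\<exists>u::'a\<Rightarrow>real. continuous_on UNIV u \<and> (\<forall>x. 0 \<le> u x \<and> u x \<le> 1 \<and> (0 < u x \<longleftrightarrow> x \<in> U i))" for i
      using open_eq_support[OF assms[of i]] by metis
    then obtain u :: "nat \<Rightarrow> 'a \<Rightarrow> real" where u: "\<And>i. continuous_on UNIV (u i)" "\<And>i x. 0 \<le> u i x"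
      "\<And>i x. u i x \<le> 1" "\<And>i x. 0 < u i x \<longleftrightarrow> x \<in> U i" by metis
    define s where "s x = (\<Sum>i\<in>I. u i x)" for x
    have s_cont: "continuous_on UNIV s" unfolding s_def by (intro continuous_intros u)
    have s_pos: "0 < s x" if xK: "x \<in> K" for x
    proof -
      obtain i where "i \<in> I" "x \<in> U i" using xK I by auto
      then show ?thesis unfolding s_def using I u by (intro sum_pos2[of I i]) auto
    qed
    obtain d where d: "0 < d" "\<And>x. x \<in> K \<Longrightarrow> d \<le> s x"
    proof (cases "K = {}")
      case False
      then obtain x where "x \<in> K" "\<forall>y\<in>K. s x \<le> s y"
        using continuous_attains_inf[OF K, of s] s_cont continuous_on_subset by blast
      then show ?thesis using that s_pos by blast
    qed (use that[of 1] in auto)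
    define g where "g x = max 0 (f x - e)" for x
    \<comment> \<open>Bounding the denominator below by \<open>d\<close> keeps \<open>h i\<close>
      continuous where \<open>s\<close> may vanish; on \<open>K\<close> it equals
      \<open>s x\<close>, and off \<open>K\<close> the factor \<open>g x\<close> is 0.\<close>
    define h where "h i x = g x * u i x / max (s x) d" for i x
    have f1: "f x \<le> 1" for x using f(3) by (rule order.trans) (rule indicator_le_1)
    have g: "continuous_on UNIV g" "\<And>x. 0 \<le> g x" "\<And>x. g x \<le> 1" "\<And>x. x \<notin> K \<Longrightarrow> g x = 0"
    proof -
      show "continuous_on UNIV g" unfolding g_def by (intro continuous_intros f)
      show "0 \<le> g x" "g x \<le> 1" "x \<notin> K \<Longrightarrow> g x = 0" for x using f1[of x] e by (auto simp: g_def K_def)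
    qed
      
    have h_cont: "continuous_on UNIV (h i)" for i
      unfolding h_def using d by (intro continuous_intros g u s_cont) (auto simp: max_def)
    have h_nonneg: "0 \<le> h i x" for i x unfolding h_def using g u d by (auto simp: max_def)
    have ug: "(\<Sum>i\<in>I. h i x) = g x" for x
    proof (cases "x \<in> K")
      case True
      then have "max (s x) d = s x" "s x \<noteq> 0" using d(2)[OF True] s_pos[OF True] by auto
      then show ?thesis by (simp add: h_def sum_divide_distrib[symmetric] sum_distrib_left[symmetric] s_def[symmetric])
    qed (simp add: h_def g)
    have h_le: "h i x \<le> indicator (U i) x" if "i \<in> I" for i x
    proof (cases "x \<in> U i")
      case True
      have "h i x \<le> (\<Sum>i\<in>I. h i x)" using that I h_nonneg by (intro member_le_sum) auto
      then show ?thesis using ug g(3)[of x] True by (auto intro: order.trans)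
    next
      case False
      then have "u i x = 0" using u(2)[of i x] u(4)[of i x] by (auto simp: less_le)
      then show ?thesis by (simp add: h_def)
    qed
    have "ennreal (L f) \<le> ennreal (L g + e)" using truncate[OF f(1) e] by (intro ennreal_leI) (simp add: g_def[abs_def])
    also have "L g = L (\<lambda>x. \<Sum>i\<in>I. h i x)" by (simp add: ug)
    also have "\<dots> = (\<Sum>i\<in>I. L (h i))" using I h_cont by (intro sum) auto
    also have "ennreal (\<dots> + e) = (\<Sum>i\<in>I. ennreal (L (h i))) + ennreal e"
      using e pos[OF h_cont h_nonneg] by (subst ennreal_plus) (auto simp: sum_nonneg sum_ennreal)
    also have "\<dots> \<le> (\<Sum>i\<in>I. inner_content (U i)) + ennreal e"
      by (intro add_right_mono sum_mono inner_content_upper h_cont h_nonneg h_le)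
    also have "\<dots> \<le> (\<Sum>i. inner_content (U i)) + ennreal e"
      by (intro add_right_mono sum_le_suminf I) auto
    finally show "ennreal (L f) \<le> (\<Sum>i. inner_content (U i)) + ennreal e" .
  qed
qed

lemma outer_countably_subadditive: "outer (\<Union>i::nat. A i) \<le> (\<Sum>i. outer (A i))"
proof (rule ennreal_le_epsilon)
  fix e :: real assume e: "0 < e"
  have "\<exists>U. open U \<and> A i \<subseteq> U \<and> inner_content U \<le> outer (A i) + ennreal (e * (1/2) ^ Suc i)" for i
  proof -
    have "outer (A i) < outer (A i) + ennreal (e * (1/2) ^ Suc i)"
      using outer_le_1[of "A i"] e ennreal_add_left_cancel_less[of "outer (A i)" 0 "ennreal (e * (1/2) ^ Suc i)"]
      by (auto simp: top_unique ennreal_less_zero_iff)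
    then obtain U where "open U" "A i \<subseteq> U" "inner_content U < outer (A i) + ennreal (e * (1/2) ^ Suc i)"
      unfolding outer_def[of "A i"] INF_less_iff by auto
    then show ?thesis by (auto intro: less_imp_le)
  qed
  then obtain U where U: "\<And>i. open (U i)" "\<And>i. A i \<subseteq> U i"
    "\<And>i. inner_content (U i) \<le> outer (A i) + ennreal (e * (1/2) ^ Suc i)" by metis
  have "outer (\<Union>i. A i) \<le> outer (\<Union>i. U i)" by (intro outer_mono) (use U in auto)
  also have "\<dots> = inner_content (\<Union>i. U i)" using U by (intro outer_open) auto
  also have "\<dots> \<le> (\<Sum>i. inner_content (U i))" by (intro inner_content_subadditive U)
  also have "\<dots> \<le> (\<Sum>i. outer (A i) + ennreal (e * (1/2) ^ Suc i))" by (intro suminf_le U) auto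
  also have "\<dots> = (\<Sum>i. outer (A i)) + (\<Sum>i. ennreal (e * (1/2) ^ Suc i))" by (subst suminf_add) auto
  also have "(\<Sum>i. ennreal (e * (1/2) ^ Suc i)) = ennreal (\<Sum>i. e * (1/2) ^ Suc i)"
    using e by (intro suminf_ennreal2) (auto intro!: summable_mult summable_geometric summable_Suc_iff[THEN iffD2])
  also have "(\<Sum>i. e * (1/2) ^ Suc i) = e"
    using sums_mult[OF power_half_series, of e] by (auto simp: sums_iff)
  finally show "outer (\<Union>i. A i) \<le> (\<Sum>i. outer (A i)) + ennreal e" .
qed

lemma outer_measure_space: "outer_measure_space UNIV outer"
proof -
  have "outer {} = 0"
  proof -
    have "inner_content {} = 0" unfolding inner_content_def
    proof (intro antisym SUP_least)
      fix f :: "'a \<Rightarrow> real" assume "f \<in> {f. continuous_on UNIV f \<and> (\<forall>x. 0 \<le> f x \<and> f x \<le> indicator {} x)}"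
      then have "f = (\<lambda>_. 0)" by (auto intro!: ext antisym)
      then show "ennreal (L f) \<le> 0" by (simp add: const)
    qed auto
    then show ?thesis using outer_open[of "{}"] by simp
  qed
  then show ?thesis
    by (auto simp: outer_measure_space_def positive_def increasing_def countably_subadditive_def
        outer_mono outer_countably_subadditive)
qed

lemma outer_subadditive: "outer A \<le> outer (A \<inter> B) + outer (A - B)"
proof -
  have "subadditive UNIV outer"
    using outer_measure_space ring_of_sets.countably_subadditive_subadditive[of UNIV UNIV outer]
      ring_of_sets_Pow[of "UNIV::'a set"]
    by (auto simp: outer_measure_space_def)
  then show ?thesis using subadditiveD[of UNIV outer "A \<inter> B" "A - B"] by (auto simp: Int_Diff_Un)
qed

text \<open>The nontrivial half of Caratheodory's condition. A function below the indicator of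
  \<open>V \<inter> U\<close> is, up to \<open>e\<close>, supported on a closed \<open>K\<close>
  inside that set, so any function below the indicator of \<open>V - K\<close> can be added to it
  without exceeding the indicator of \<open>V\<close>.\<close>

lemma inner_content_split:
  assumes V: "open V" and U: "open U"
  shows "inner_content (V \<inter> U) + outer (V - U) \<le> inner_content V"
proof -
  have *: "ennreal (L f) + outer (V - U) \<le> inner_content V"
    if f: "continuous_on UNIV f" "\<And>x. 0 \<le> f x" "\<And>x. f x \<le> indicator (V \<inter> U) x" for f
  proof (rule ennreal_le_epsilon)
    fix e :: real assume e: "0 < e"
    define K where "K = {x. e \<le> f x}"
    have clK: "closed K" unfolding K_def using f(1) by (intro closed_Collect_le continuous_intros) auto
    define g where "g x = max 0 (f x - e)" for x
    have g: "continuous_on UNIV g" "\<And>x. 0 \<le> g x" "\<And>x. x \<notin> K \<Longrightarrow> g x = 0" "\<And>x. g x \<le> f x"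
      unfolding g_def K_def using e f(2) by (auto intro!: continuous_intros f)
    have KU: "x \<in> V \<inter> U" if "x \<in> K" for x
      using that f(3)[of x] e by (auto simp: K_def indicator_def of_bool_def split: if_splits)
    have chi: "ennreal (L h) + ennreal (L g) \<le> inner_content V"
      if h: "continuous_on UNIV h" "\<And>x. 0 \<le> h x" "\<And>x. h x \<le> indicator (V - K) x" for h
    proof -
      have "h x + g x \<le> indicator V x" for x
      proof (cases "x \<in> K")
        case True
        then have "h x = 0" using h(2)[of x] h(3)[of x] by auto
        then show ?thesis using g(4)[of x] f(3)[of x] KU[OF True] by (auto intro: order.trans)
      next
        case False
        then show ?thesis using g(3)[OF False] h(3)[of x] by (auto simp: indicator_def)
      qed
      then have "ennreal (L (\<lambda>x. h x + g x)) \<le> inner_content V"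
        using h g by (intro inner_content_upper continuous_intros) auto
      then show ?thesis using h g pos[of g] pos[of h] by (simp add: add ennreal_plus)
    qed
    have "ennreal (L f) + outer (V - U) \<le> ennreal (L g + e) + inner_content (V - K)"
    proof (rule add_mono)
      show "ennreal (L f) \<le> ennreal (L g + e)" using truncate[OF f(1) e] by (intro ennreal_leI) (simp add: g_def[abs_def])
      have "outer (V - U) \<le> outer (V - K)" using KU by (intro outer_mono) auto
      then show "outer (V - U) \<le> inner_content (V - K)" using outer_open[of "V - K"] V clK by (simp add: open_Diff)
    qed
    also have "\<dots> = (inner_content (V - K) + ennreal (L g)) + ennreal e"
      using pos[OF g(1,2)] e by (simp add: ennreal_plus add_ac)
    also have "inner_content (V - K) + ennreal (L g) \<le> inner_content V"
      unfolding inner_content_def[of "V - K"]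
      by (subst ennreal_SUP_add_left[symmetric])
        (auto intro!: SUP_least chi exI[of _ "\<lambda>_. 0"] simp del: indicator_simps)
    finally show "ennreal (L f) + outer (V - U) \<le> inner_content V + ennreal e" by (simp add: add_right_mono)
  qed
  show ?thesis
    unfolding inner_content_def[of "V \<inter> U"]
    by (subst ennreal_SUP_add_left[symmetric])
        (auto intro!: SUP_least * exI[of _ "\<lambda>_. 0"] simp del: indicator_simps)
qed

lemma open_in_lambda_system:
  assumes "open U" shows "U \<in> lambda_system UNIV UNIV outer"
proof -
  have "outer (A \<inter> U) + outer (A - U) \<le> outer A" for A
    unfolding outer_def[of A]
  proof (rule INF_greatest)
    fix V assume "V \<in> {V. open V \<and> A \<subseteq> V}"
    then have V: "open V" "A \<subseteq> V" by auto
    have "outer (A \<inter> U) + outer (A - U) \<le> outer (V \<inter> U) + outer (V - U)"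
      by (intro add_mono outer_mono) (use V in auto)
    also have "\<dots> \<le> inner_content V"
      using inner_content_split[OF V(1) assms] outer_open[of "V \<inter> U"] V assms by (simp add: open_Int)
    finally show "outer (A \<inter> U) + outer (A - U) \<le> inner_content V" .
  qed
  then have "outer (A \<inter> U) + outer (A - U) = outer A" for A
    using outer_subadditive[of A U] by (auto intro: antisym)
  moreover have "A - U = (UNIV - U) \<inter> A" "A \<inter> U = U \<inter> A" for A by auto
  ultimately have "outer (U \<inter> A) + outer ((UNIV - U) \<inter> A) = outer A" for A by metis
  then show ?thesis unfolding lambda_system_def by blast
qed

section \<open>The representing measure and its integrals\<close>

definition rep_measure :: "'a measure" where
  "rep_measure = measure_of UNIV (sets borel) outer"

lemma sets_rep_measure: "sets rep_measure = sets borel"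
  unfolding rep_measure_def by (metis sets.sets_measure_of_eq space_borel)

lemma emeasure_rep_measure: "A \<in> sets borel \<Longrightarrow> emeasure rep_measure A = outer A"
proof -
  assume A: "A \<in> sets borel"
  have sa: "sigma_algebra UNIV (UNIV :: 'a set set)" by (metis Pow_UNIV sigma_algebra_Pow)
  have ms: "measure_space UNIV (lambda_system UNIV UNIV outer) outer"
    using sigma_algebra.caratheodory_lemma[OF sa outer_measure_space] by simp
  then have sl: "sigma_algebra UNIV (lambda_system UNIV UNIV outer)" by (simp add: measure_space_def)
  have sub: "sets borel \<subseteq> lambda_system UNIV UNIV outer"
    unfolding borel_def using sigma_algebra.sigma_sets_subset[OF sl, of "Collect open"] open_in_lambda_system
    by auto
  have "positive (sets borel) outer" "countably_additive (sets borel) outer"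
    using ms sub unfolding measure_space_def positive_def countably_additive_def by blast+
  then show ?thesis unfolding rep_measure_def
    using sets.sigma_algebra_axioms[of "borel :: 'a measure"] A
    by (intro emeasure_measure_of_sigma) simp_all
qed

lemma prob_space_rep_measure: "prob_space rep_measure"
proof
  have "space rep_measure = UNIV" using sets_eq_imp_space_eq[OF sets_rep_measure] by simp
  then show "emeasure rep_measure (space rep_measure) = 1"
    using emeasure_rep_measure[of UNIV] outer_open[of UNIV] inner_content_UNIV by simp
qed

lemma finite_rep_measure: "finite_measure rep_measure"
  using prob_space_rep_measure by (rule prob_space.finite_measure)

lemma measure_rep_measure_UNIV: "measure rep_measure UNIV = 1"
  using prob_space.prob_space[OF prob_space_rep_measure] sets_eq_imp_space_eq[OF sets_rep_measure] by simp

lemma integrable_rep_measure: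
  fixes g :: "'a \<Rightarrow> real" shows "continuous_on UNIV g \<Longrightarrow> integrable rep_measure g"
  by (rule integrable_continuous_compact[OF compact finite_rep_measure sets_rep_measure])

lemma integral_rep_measure_add_const:
  fixes g :: "'a \<Rightarrow> real"
  assumes "continuous_on UNIV g"
  shows "(\<integral>x. c * g x + d \<partial>rep_measure) = c * integral\<^sup>L rep_measure g + d"
  using integrable_rep_measure[OF assms] integrable_rep_measure[of "\<lambda>_. d"] measure_rep_measure_UNIV
    sets_eq_imp_space_eq[OF sets_rep_measure]
  by simp

text \<open>The function \<open>N * f\<close> is cut into \<open>N\<close> horizontal slices
  \<open>F k\<close> with values in the unit interval. Each slice is below the indicator of the
  superlevel set \<open>U k\<close>, so \<open>L\<close> of it is at most the measure of that set;
  the number of superlevel sets containing \<open>x\<close> exceeds \<open>N * f x\<close> by at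
  most 1, an error of \<open>1 / N\<close> after division.\<close>

lemma integral_rep_measure_unit:
  assumes f: "continuous_on UNIV f" "\<And>x. 0 \<le> f x" "\<And>x. f x \<le> 1"
  shows "L f \<le> integral\<^sup>L rep_measure f"
proof (rule field_le_epsilon)
  fix e :: real assume e: "0 < e"
  obtain n where n: "1 / real (Suc n) < e" by (rule nat_approx_posE[OF e])
  define N where "N = Suc n"
  have N: "0 < N" "1 / real N < e" using n unfolding N_def by auto
  define F where "F k x = max 0 (min 1 (real N * f x - real k))" for k :: nat and x
  have F_cont: "continuous_on UNIV (F k)" for k unfolding F_def by (intro continuous_intros f)
  have clamp: "(\<Sum>k<n. max 0 (min 1 (y - real k))) = max 0 (min (real n) y)" for n and y :: real
    by (induction n) (auto simp: min_def max_def)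
  have F_sum: "(\<Sum>k<N. F k x) = real N * f x" for x
  proof -
    have "real N * f x \<le> real N * 1" by (rule mult_left_mono[OF f(3)]) simp
    moreover have "0 \<le> real N * f x" by (rule mult_nonneg_nonneg[OF _ f(2)]) simp
    ultimately show ?thesis unfolding F_def clamp by simp
  qed
  define U where "U k = {x. real k < real N * f x}" for k :: nat
  have U_open: "open (U k)" for k unfolding U_def by (intro open_Collect_less continuous_intros f)
  then have U_sets: "U k \<in> sets rep_measure" for k by (simp add: sets_rep_measure)
  have LF: "L (F k) \<le> measure rep_measure (U k)" for k
  proof -
    have "ennreal (L (F k)) \<le> inner_content (U k)"
      by (intro inner_content_upper F_cont) (auto simp: F_def U_def indicator_def)
    also have "\<dots> = emeasure rep_measure (U k)"
      using U_open[of k] by (simp add: emeasure_rep_measure outer_open)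
    finally show ?thesis by (simp add: finite_measure.emeasure_eq_measure[OF finite_rep_measure])
  qed
  have ind: "(\<Sum>k<N. indicator (U k) x) \<le> real N * f x + 1" for x
  proof -
    obtain M where M: "N = Suc M" using N by (cases N) auto
    \<comment> \<open>Inside \<open>U (Suc k)\<close> the slice \<open>F k\<close> is full, so after
      a shift of the index only \<open>U 0\<close> remains uncompensated.\<close>
    have "(\<Sum>k<N. indicator (U k) x) = indicator (U 0) x + (\<Sum>k<M. indicator (U (Suc k)) x :: real)"
      unfolding M by (rule sum.lessThan_Suc_shift)
    also have "\<dots> \<le> 1 + (\<Sum>k<M. F k x)"
      by (intro add_mono sum_mono) (auto simp: U_def F_def indicator_def)
    also have "\<dots> \<le> 1 + (\<Sum>k<N. F k x)"
      by (intro add_left_mono sum_mono2) (auto simp: M F_def)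
    finally show ?thesis by (simp add: F_sum)
  qed
  have ind_int: "integrable rep_measure (indicator (U k) :: 'a \<Rightarrow> real)" for k
    using U_sets[of k] finite_measure.emeasure_finite[OF finite_rep_measure] by (simp add: less_top[symmetric])
  have int_f: "integrable rep_measure f"
    by (rule integrable_rep_measure[OF f(1)])
  have "real N * L f = L (\<lambda>x. \<Sum>k<N. F k x)" by (simp add: F_sum scale f)
  also have "\<dots> = (\<Sum>k<N. L (F k))" by (intro sum F_cont) auto
  also have "\<dots> \<le> (\<Sum>k<N. measure rep_measure (U k))" by (intro sum_mono LF)
  also have "\<dots> = (\<Sum>k<N. \<integral>x. indicator (U k) x \<partial>rep_measure)"
  proof (rule sum.cong)
    fix k
    show "measure rep_measure (U k) = (\<integral>x. indicator (U k) x \<partial>rep_measure)"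
      using sets.sets_into_space[OF U_sets[of k]] by (simp add: Int_absorb2)
  qed simp
  also have "\<dots> = (\<integral>x. (\<Sum>k<N. indicator (U k) x) \<partial>rep_measure)"
    using ind_int by (intro Bochner_Integration.integral_sum[symmetric]) auto
  also have "\<dots> \<le> (\<integral>x. real N * f x + 1 \<partial>rep_measure)"
  proof (rule integral_mono)
    show "integrable rep_measure (\<lambda>x. \<Sum>k<N. indicator (U k) x :: real)"
      using ind_int by (intro Bochner_Integration.integrable_sum)
    show "integrable rep_measure (\<lambda>x. real N * f x + 1)"
      by (intro integrable_rep_measure continuous_intros f)
  qed (rule ind)
  also have "\<dots> = real N * integral\<^sup>L rep_measure f + 1"
    by (rule integral_rep_measure_add_const[OF f(1)])
  finally have "L f \<le> integral\<^sup>L rep_measure f + 1 / real N"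
    using N by (simp add: field_simps)
  then show "L f \<le> integral\<^sup>L rep_measure f + e" using N by linarith
qed

text \<open>Applying the inequality for the unit interval to \<open>1 - g\<close> reverses
  it.\<close>

theorem integral_rep_measure:
  assumes f: "continuous_on UNIV f"
  shows "L f = integral\<^sup>L rep_measure f"
proof -
  have int: "integrable rep_measure g" if "continuous_on UNIV g" for g :: "'a \<Rightarrow> real"
    using that by (rule integrable_rep_measure)
  have unit: "L g = integral\<^sup>L rep_measure g"
    if g: "continuous_on UNIV g" "\<And>x. 0 \<le> g x" "\<And>x. g x \<le> 1" for g
  proof (rule antisym)
    show "L g \<le> integral\<^sup>L rep_measure g" by (rule integral_rep_measure_unit[OF g])
    have "L (\<lambda>x. (-1) * g x + 1) \<le> (\<integral>x. (-1) * g x + 1 \<partial>rep_measure)"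
      by (intro integral_rep_measure_unit continuous_intros g) (use g in auto)
    also have "\<dots> = 1 - integral\<^sup>L rep_measure g" by (subst integral_rep_measure_add_const[OF g(1)]) simp
    also have "L (\<lambda>x. (-1) * g x + 1) = 1 - L g"
      using g scale[of g "-1"] by (subst add) (auto simp: one intro!: continuous_intros)
    finally show "integral\<^sup>L rep_measure g \<le> L g" by simp
  qed
  obtain B g where g: "continuous_on UNIV g" "\<And>x. 0 \<le> g x" "\<And>x. g x \<le> 1"
    and fg: "f = (\<lambda>x. 2 * B * g x + (- B))"
    using continuous_affine_unit_range[OF compact f] by blast
  have "L f = L (\<lambda>x. 2 * B * g x + (- B))" by (rule arg_cong[OF fg])
  also have "\<dots> = 2 * B * L g + (- B)"
    using add[of "\<lambda>x. 2 * B * g x" "\<lambda>x. - B"] scale[OF g(1), of "2 * B"] const[of "- B"]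
    by (simp add: g(1) continuous_on_mult_left)
  also have "\<dots> = 2 * B * integral\<^sup>L rep_measure g + (- B)" using unit[OF g] by simp
  also have "\<dots> = (\<integral>x. 2 * B * g x + (- B) \<partial>rep_measure)"
    by (rule integral_rep_measure_add_const[OF g(1), symmetric])
  also have "\<dots> = integral\<^sup>L rep_measure f" by (rule arg_cong[OF fg[symmetric]])
  finally show ?thesis .
qed

end

lemma positive_functional_diff_le:
  fixes L :: "('a \<Rightarrow> real) \<Rightarrow> real"
  assumes add: "\<And>f g. L (\<lambda>x. f x + g x) = L f + L g"
    and scale: "\<And>c f. L (\<lambda>x. c * f x) = c * L f"
    and pos: "\<And>f. (\<And>x. 0 \<le> f x) \<Longrightarrow> 0 \<le> L f"
    and one: "L (\<lambda>x. 1) = 1"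
    and le: "\<And>x. \<bar>f x - g x\<bar> \<le> e"
  shows "\<bar>L f - L g\<bar> \<le> e"
proof -
  have const: "L (\<lambda>x. c) = c" for c using scale[of c "\<lambda>x. 1"] one by simp
  have diff: "L (\<lambda>x. u x - v x) = L u - L v" for u v
    using add[of u "\<lambda>x. (-1) * v x"] scale[of "-1" v] by simp
  have "0 \<le> L (\<lambda>x. e - (f x - g x))" "0 \<le> L (\<lambda>x. e - (g x - f x))"
    by (intro pos, use le in \<open>force simp: abs_le_iff\<close>)+
  then show ?thesis by (simp add: diff const abs_le_iff)
qed

text \<open>A diagonal subsequence converges at every \<open>\<theta> n\<close>, hence by uniform
  approximation at every continuous function, and the limit is represented by a measure. The
  functionals act on all functions because they are later evaluated at indicators as well.\<close>

theorem weak_limit_subsequence: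
  fixes L :: "nat \<Rightarrow> ('a::metric_space \<Rightarrow> real) \<Rightarrow> real"
  assumes compact: "compact (UNIV :: 'a set)" and dense: "dense_sequence (\<theta> :: nat \<Rightarrow> 'a \<Rightarrow> real)"
    and add: "\<And>k f g. L k (\<lambda>x. f x + g x) = L k f + L k g"
    and scale: "\<And>k c f. L k (\<lambda>x. c * f x) = c * L k f"
    and pos: "\<And>k f. (\<And>x. 0 \<le> f x) \<Longrightarrow> 0 \<le> L k f"
    and one: "\<And>k. L k (\<lambda>x. 1) = 1"
  obtains r :: "nat \<Rightarrow> nat" and \<mu> :: "'a measure" where "strict_mono r" "prob_space \<mu>" "sets \<mu> = sets borel"
    "\<And>f. continuous_on UNIV f \<Longrightarrow> (\<lambda>k. L (r k) f) \<longlonglongrightarrow> integral\<^sup>L \<mu> f"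
proof -
  have diff_le: "\<bar>L k f - L k g\<bar> \<le> e" if "\<And>x. \<bar>f x - g x\<bar> \<le> e" for k f g e
    by (rule positive_functional_diff_le[of "L k", OF add scale pos one that])
  have const: "L k (\<lambda>x. c) = c" for c k using scale[of k c "\<lambda>x. 1"] one by simp
  have bdd: "\<bar>L k f\<bar> \<le> e" if "\<And>x. \<bar>f x\<bar> \<le> e" for k f e
    using diff_le[of f "\<lambda>_. 0" e k] that const[of k 0] by simp
  have theta: "continuous_on UNIV (\<theta> n)" "\<bar>\<theta> n x\<bar> \<le> 1" for n x
    using dense unfolding dense_sequence_def image_subset_iff by (auto simp: abs_le_iff)
  define P where "P n s \<longleftrightarrow> convergent (\<lambda>k. L (s k) (\<theta> n))" for n :: nat and s :: "nat \<Rightarrow> nat"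
  interpret subseqs P
  proof
    fix n :: nat and s :: "nat \<Rightarrow> nat"
    have "bounded (range (\<lambda>k. L (s k) (\<theta> n)))"
      unfolding bounded_iff using bdd[of "\<theta> n" 1] theta(2) by auto
    then obtain l r where "strict_mono r" "((\<lambda>k. L (s k) (\<theta> n)) \<circ> r) \<longlonglongrightarrow> l"
      using bounded_imp_convergent_subsequence by blast
    then show "\<exists>r'. strict_mono r' \<and> P n (s \<circ> r')"
      unfolding P_def by (intro exI[of _ r]) (auto simp: o_def convergent_def)
  qed
  define r where "r = diagseq"
  have r: "strict_mono r" unfolding r_def by (rule subseq_diagseq)
  have conv_theta: "convergent (\<lambda>k. L (r k) (\<theta> n))" for n
  proof -
    \<comment> \<open>From index \<open>Suc n\<close> on, the diagonal sequence is a subsequence of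
      the one extracted for \<open>\<theta> n\<close>; the shift is undone by ignoring an initial
      segment.\<close>
    have "P n (diagseq \<circ> ((+) (Suc n)))"
    proof (rule diagseq_holds)
      fix q s :: "nat \<Rightarrow> nat" and n assume "strict_mono q" "P n s"
      then show "P n (s \<circ> q)"
        unfolding P_def convergent_def using LIMSEQ_subseq_LIMSEQ[of "\<lambda>k. L (s k) (\<theta> n)" _ q] by (auto simp: o_def)
    qed
    then have "convergent (\<lambda>k. L (r (k + Suc n)) (\<theta> n))"
      using P_def[of n "diagseq \<circ> ((+) (Suc n))"] by (simp add: r_def add.commute)
    then show ?thesis
      using convergent_ignore_initial_segment[of "\<lambda>k. L (r k) (\<theta> n)" "Suc n"] by simp
  qed
  have conv_unit: "convergent (\<lambda>k. L (r k) f)" if f: "continuous_on UNIV f" "range f \<subseteq> {0..1}" for f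
  proof (rule Cauchy_convergent, rule metric_CauchyI)
    fix e :: real assume e: "0 < e"
    then obtain n where "\<forall>x. \<bar>f x - \<theta> n x\<bar> < e / 4" using dense f unfolding dense_sequence_def
      by (metis zero_less_divide_iff zero_less_numeral)
    then have n: "\<bar>L k f - L k (\<theta> n)\<bar> \<le> e / 4" for k by (intro diff_le) (auto intro: less_imp_le)
    obtain N where N: "\<And>i j. N \<le> i \<Longrightarrow> N \<le> j \<Longrightarrow> dist (L (r i) (\<theta> n)) (L (r j) (\<theta> n)) < e / 4"
      using metric_CauchyD[OF convergent_Cauchy[OF conv_theta[of n]], of "e / 4"] e by auto
    show "\<exists>M. \<forall>i\<ge>M. \<forall>j\<ge>M. dist (L (r i) f) (L (r j) f) < e"
    proof (intro exI[of _ N] allI impI)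
      fix i j assume "N \<le> i" "N \<le> j"
      from N[OF this] n[of "r i"] n[of "r j"] e
      show "dist (L (r i) f) (L (r j) f) < e" unfolding dist_real_def by linarith
    qed
  qed
  have conv: "convergent (\<lambda>k. L (r k) f)" if f: "continuous_on UNIV f" for f
  proof -
    obtain B g where g: "continuous_on UNIV g" "\<And>x. 0 \<le> g x" "\<And>x. g x \<le> 1"
      and fg: "f = (\<lambda>x. 2 * B * g x + (- B))"
      using continuous_affine_unit_range[OF compact f] by blast
    then have "convergent (\<lambda>k. L (r k) g)" by (intro conv_unit) auto
    then obtain l where "(\<lambda>k. L (r k) g) \<longlonglongrightarrow> l" by (auto simp: convergent_def)
    then have "(\<lambda>k. 2 * B * L (r k) g + (- B)) \<longlonglongrightarrow> 2 * B * l + (- B)" by (intro tendsto_intros)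
    then have "convergent (\<lambda>k. 2 * B * L (r k) g + (- B))" by (rule convergentI)
    moreover have "L k f = 2 * B * L k g + (- B)" for k
    proof -
      from arg_cong[OF fg, of "L k"] show ?thesis
        using add[of k "\<lambda>x. 2 * B * g x" "\<lambda>x. - B"] scale[of k "2 * B" g] const[of k "- B"] by simp
    qed
    ultimately show ?thesis by simp
  qed
  define \<Lambda> where "\<Lambda> f = lim (\<lambda>k. L (r k) f)" for f
  have Lam: "(\<lambda>k. L (r k) f) \<longlonglongrightarrow> \<Lambda> f" if "continuous_on UNIV f" for f
    using conv[OF that] unfolding \<Lambda>_def by (simp add: convergent_LIMSEQ_iff)
  interpret positive_functional \<Lambda>
  proof
    fix f g :: "'a \<Rightarrow> real" assume fg: "continuous_on UNIV f" "continuous_on UNIV g"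
    show "\<Lambda> (\<lambda>x. f x + g x) = \<Lambda> f + \<Lambda> g"
      using Lam[of "\<lambda>x. f x + g x"] tendsto_add[OF Lam[OF fg(1)] Lam[OF fg(2)]] fg
      by (auto simp: add continuous_on_add intro: LIMSEQ_unique)
  next
    fix f :: "'a \<Rightarrow> real" and c assume f: "continuous_on UNIV f"
    show "\<Lambda> (\<lambda>x. c * f x) = c * \<Lambda> f"
      using Lam[of "\<lambda>x. c * f x"] tendsto_mult_left[OF Lam[OF f], of c] f
      by (auto simp: scale continuous_on_mult_left intro: LIMSEQ_unique)
  next
    fix f :: "'a \<Rightarrow> real" assume f: "continuous_on UNIV f" "\<And>x. 0 \<le> f x"
    show "0 \<le> \<Lambda> f" using Lam[OF f(1)] pos[OF f(2)] by (intro LIMSEQ_le_const) auto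
  next
    show "\<Lambda> (\<lambda>x. 1) = 1" using Lam[of "\<lambda>x. 1"] one by (auto simp: LIMSEQ_const_iff)
  qed (rule compact)
  show ?thesis
    using that[OF r prob_space_rep_measure sets_rep_measure] Lam integral_rep_measure by force
qed

section \<open>Entropy of itineraries\<close>

definition eta :: "real \<Rightarrow> real" where "eta x = - (x * ln x)"

lemma eta_0 [simp]: "eta 0 = 0" by (simp add: eta_def)

lemma eta_nonneg: "0 \<le> x \<Longrightarrow> x \<le> 1 \<Longrightarrow> 0 \<le> eta x"
  by (cases "x = 0") (auto simp: eta_def mult_le_0_iff)

lemma continuous_eta: "continuous_on {0..} eta"
proof -
  have "continuous (at x within {0..}) eta" if "x \<ge> 0" for x
  proof (cases "x = 0")
    case False
    then show ?thesis unfolding eta_def using that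
      by (intro continuous_intros continuous_at_imp_continuous_at_within) auto
  next
    case True
    have "((\<lambda>x. - (x * ln x)) \<longlongrightarrow> 0) (at_right (0::real))" by real_asymp
    then have "((\<lambda>x. - (x * ln x)) \<longlongrightarrow> eta 0) (at (0::real) within {0..})"
      by (simp add: at_within_Ici_at_right)
    then show ?thesis using True by (simp add: continuous_within eta_def[abs_def])
  qed
  then show ?thesis by (auto simp: continuous_on_eq_continuous_within)
qed

text \<open>Jensen's inequality: \<open>- x * ln m + (m - x)\<close> is the tangent of
  \<open>eta\<close> at the mean \<open>m\<close>. Concavity puts \<open>eta\<close> below it, and
  its sum over the \<open>a i\<close> is exactly the right-hand side.\<close>

lemma eta_mean:
  assumes "finite I" "I \<noteq> {}" "\<And>i. i \<in> I \<Longrightarrow> 0 \<le> a i"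
  shows "(\<Sum>i\<in>I. eta (a i)) \<le> real (card I) * eta ((\<Sum>i\<in>I. a i) / real (card I))"
proof -
  define n where "n = real (card I)"
  define m where "m = (\<Sum>i\<in>I. a i) / n"
  have n: "n > 0" using assms by (simp add: n_def card_gt_0_iff)
  have sum: "(\<Sum>i\<in>I. a i) = n * m" using n by (simp add: m_def)
  show ?thesis
  proof (cases "m = 0")
    case True
    then have "(\<Sum>i\<in>I. a i) = 0" using sum by simp
    then have "a i = 0" if "i \<in> I" for i using sum_nonneg_eq_0_iff[of I a] assms that by auto
    then show ?thesis using True by (simp add: m_def n_def)
  next
    case False
    have "m \<ge> 0" unfolding m_def using n assms by (auto intro!: divide_nonneg_pos sum_nonneg)
    with False have m: "m > 0" by simp
    have le: "eta x \<le> - x * ln m + (m - x)" if "x \<ge> 0" for x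
    proof (cases "x = 0")
      case True then show ?thesis using m by simp
    next
      case False
      with that have x: "x > 0" by simp
      have "x * ln (m / x) \<le> x * (m / x - 1)" using x m by (intro mult_left_mono ln_le_minus_one) auto
      then show ?thesis using x m by (simp add: eta_def ln_div algebra_simps)
    qed
    have "(\<Sum>i\<in>I. eta (a i)) \<le> (\<Sum>i\<in>I. - a i * ln m + (m - a i))"
      using assms le by (intro sum_mono) auto
    also have "\<dots> = - (\<Sum>i\<in>I. a i) * ln m + (n * m - (\<Sum>i\<in>I. a i))"
      by (simp add: sum.distrib sum_subtractf sum_negf sum_distrib_right n_def)
    also have "\<dots> = n * eta m" by (simp add: sum eta_def)
    finally show ?thesis by (simp add: m_def n_def)
  qed
qed

text \<open>Fekete's lemma; the limit is the infimum \<open>Inf S\<close>. Division with remainder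
  by a nearly optimal \<open>m\<close> bounds \<open>a n\<close> by at most \<open>n / m\<close>
  copies of \<open>a m\<close>, and \<open>C\<close> bounds the remainder.\<close>

lemma subadditive_limit:
  fixes a :: "nat \<Rightarrow> real"
  assumes nonneg: "\<And>n. 0 \<le> a n" and sub: "\<And>m n. a (m + n) \<le> a m + a n"
  shows "\<exists>l. (\<lambda>n. a n / real n) \<longlonglongrightarrow> l"
proof -
  define S where "S = (\<lambda>n. a n / real n) ` {1..}"
  have bdd: "bdd_below S" unfolding S_def using nonneg by (intro bdd_belowI[of _ 0]) auto
  have ne: "S \<noteq> {}" by (auto simp: S_def)
  have mult: "a (q * m + s) \<le> real q * a m + a s" for q m s
  proof (induction q)
    case (Suc q)
    have "a (Suc q * m + s) \<le> a m + a (q * m + s)" using sub[of m "q * m + s"] by (simp add: add.assoc)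
    with Suc show ?case by (simp add: algebra_simps)
  qed simp
  have "(\<lambda>n. a n / real n) \<longlonglongrightarrow> Inf S"
  proof (rule tendstoI)
    fix e :: real assume e: "0 < e"
    obtain m where m: "1 \<le> m" "a m / real m < Inf S + e / 2"
    proof -
      have "\<exists>y\<in>S. y < Inf S + e / 2" using cInf_lessD[OF ne, of "Inf S + e / 2"] e by auto
      then show ?thesis using that by (auto simp: S_def)
    qed
    define C where "C = (\<Sum>s<m. a s)"
    have C: "a s \<le> C" if "s < m" for s unfolding C_def using that nonneg by (intro member_le_sum) auto
    have "(\<lambda>n. C / real n) \<longlonglongrightarrow> 0" by real_asymp
    then have "eventually (\<lambda>n. C / real n < e / 2) sequentially" using e by (intro order_tendstoD) auto
    then show "eventually (\<lambda>n. dist (a n / real n) (Inf S) < e) sequentially"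
      using eventually_ge_at_top[of 1]
    proof eventually_elim
      case (elim n)
      have "Inf S \<le> a n / real n" using elim bdd by (intro cInf_lower) (auto simp: S_def)
      have "a n \<le> real (n div m) * a m + a (n mod m)" using mult[of "n div m" m "n mod m"] by simp
      also have "\<dots> \<le> real (n div m) * a m + C" using C m by simp
      also have "real (n div m) * a m \<le> (real n / real m) * a m"
      proof (rule mult_right_mono[OF _ nonneg])
        have "real (n div m * m) \<le> real n" by (intro of_nat_mono) simp
        then show "real (n div m) \<le> real n / real m" using m by (simp add: field_simps)
      qed
      finally have "a n / real n \<le> a m / real m + C / real n" using elim by (simp add: field_simps)
      with m(2) elim(1) \<open>Inf S \<le> a n / real n\<close> show ?case unfolding dist_real_def by linarith
    qed
  qed
  then show ?thesis ..
qed

text \<open>Entropy of the partition of \<open>space M\<close> into the fibres of \<open>F\<close>.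
  Working with maps turns joins of partitions into pairs and concatenated lists, for which
  subadditivity follows from the chain rule.\<close>

definition ent :: "'a measure \<Rightarrow> ('a \<Rightarrow> 'b) \<Rightarrow> real" where
  "ent M F = (\<Sum>v\<in>F ` space M. eta (measure M (F -` {v} \<inter> space M)))"

lemma ent_superset:
  assumes "finite S" "F ` space M \<subseteq> S"
  shows "ent M F = (\<Sum>v\<in>S. eta (measure M (F -` {v} \<inter> space M)))"
  unfolding ent_def
proof (rule sum.mono_neutral_left[OF assms])
  have "F -` {v} \<inter> space M = {}" if "v \<in> S - F ` space M" for v using that by auto
  then show "\<forall>v\<in>S - F ` space M. eta (measure M (F -` {v} \<inter> space M)) = 0" by auto
qed

context prob_space
begin

lemma information_space_exp_1: "information_space M (exp 1)"
  by unfold_locales auto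

lemma ent_eq_entropy:
  assumes "simple_function M F"
  shows "ent M F = entropy (exp 1) (count_space (F ` space M)) F"
  using information_space.entropy_simple_distributed[OF information_space_exp_1 simple_distributedI[OF assms measure_nonneg refl]]
  by (simp add: ent_def eta_def sum_negf log_def)

lemma ent_nonneg: "0 \<le> ent M F"
  unfolding ent_def by (intro sum_nonneg eta_nonneg) auto

lemma ent_compose_le: "simple_function M F \<Longrightarrow> ent M (f \<circ> F) \<le> ent M F"
  using information_space.entropy_data_processing[OF information_space_exp_1, of F f]
  by (subst (1 2) ent_eq_entropy) (auto simp: simple_function_compose)

lemma ent_pair_le:
  assumes F: "simple_function M F" and G: "simple_function M G"
  shows "ent M (\<lambda>x. (F x, G x)) \<le> ent M F + ent M G"
  using information_space.entropy_chain_rule[OF information_space_exp_1 F G]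
    information_space.conditional_entropy_less_eq_entropy[OF information_space_exp_1 G F]
  by (simp add: ent_eq_entropy F G simple_function_Pair[OF F G])

lemma ent_append_le:
  assumes F: "simple_function M F" and G: "simple_function M G"
  shows "ent M (\<lambda>x. F x @ G x) \<le> ent M F + ent M G"
proof -
  have "ent M ((\<lambda>(u, v). u @ v) \<circ> (\<lambda>x. (F x, G x))) \<le> ent M (\<lambda>x. (F x, G x))"
    by (intro ent_compose_le simple_function_Pair F G)
  also have "\<dots> \<le> ent M F + ent M G" by (rule ent_pair_le[OF F G])
  finally show ?thesis by (simp add: comp_def)
qed

lemma ent_le_ln_card: "simple_function M F \<Longrightarrow> ent M F \<le> ln (real (card (F ` space M)))"
  using information_space.entropy_le_card[OF information_space_exp_1 simple_distributedI[OF _ measure_nonneg refl], of F]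
  by (simp add: ent_eq_entropy log_def)

end

section \<open>Itineraries as names of the atoms of a join\<close>

definition cell :: "'a set set \<Rightarrow> 'a \<Rightarrow> 'a set" where
  "cell P x = (THE A. A \<in> P \<and> x \<in> A)"

lemma cell:
  assumes "partition_on UNIV P"
  shows cell_in: "cell P x \<in> P" and mem_cell: "x \<in> cell P x"
    and cell_eq: "A \<in> P \<Longrightarrow> cell P x = A \<longleftrightarrow> x \<in> A"
proof -
  have "\<exists>!A. A \<in> P \<and> x \<in> A"
    using assms by (auto simp: partition_on_def disjoint_def)
  from theI'[OF this] show "cell P x \<in> P" "x \<in> cell P x" by (auto simp: cell_def)
  with \<open>\<exists>!A. A \<in> P \<and> x \<in> A\<close> show "A \<in> P \<Longrightarrow> cell P x = A \<longleftrightarrow> x \<in> A" by blast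
qed

definition itinerary :: "('a \<Rightarrow> 'a) \<Rightarrow> 'a set set \<Rightarrow> nat \<Rightarrow> 'a \<Rightarrow> 'a set list" where
  "itinerary T P n x = map (\<lambda>i. cell P ((T ^^ i) x)) [0..<n]"

lemma length_itinerary [simp]: "length (itinerary T P n x) = n"
  by (simp add: itinerary_def)

lemma itinerary_0 [simp]: "itinerary T P 0 x = []"
  by (simp add: itinerary_def)

lemma itinerary_add:
  "itinerary T P (m + n) x = itinerary T P m x @ itinerary T P n ((T ^^ m) x)"
  by (rule nth_equalityI) (auto simp: itinerary_def nth_append funpow_add[symmetric, THEN fun_cong, unfolded o_apply] simp flip: funpow_add)

lemma itinerary_eq_iff:
  "itinerary T P n x = itinerary T P n y \<longleftrightarrow> (\<forall>i<n. cell P ((T ^^ i) x) = cell P ((T ^^ i) y))"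
  by (auto simp: itinerary_def list_eq_iff_nth_eq)

definition words :: "'a set set \<Rightarrow> nat \<Rightarrow> 'a set list set" where
  "words P n = {w. set w \<subseteq> P \<and> length w = n}"

lemma finite_words: "finite P \<Longrightarrow> finite (words P n)"
  unfolding words_def by (rule finite_lists_length_eq)

lemma itinerary_in_words: "partition_on UNIV P \<Longrightarrow> itinerary T P n x \<in> words P n"
  by (auto simp: words_def itinerary_def cell_in)

text \<open>The atoms of the join are the nonempty fibres of the itinerary map, in agreement with
  the removal of the empty set in the definition, and different names have different fibres; the two
  sums correspond term by term.\<close>

lemma partition_entropy_join:
  assumes P: "measurable_partition P" and sp: "space \<mu> = UNIV"
  shows "partition_entropy \<mu> (join_partition T P n) = ent \<mu> (itinerary T P n)"
proof -
  have part: "partition_on UNIV P" using P by (simp add: measurable_partition_def)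
  have "join_partition T P n = (\<lambda>v. itinerary T P n -` {v}) ` range (itinerary T P n)"
  proof (intro equalityI subsetI)
    fix A assume "A \<in> join_partition T P n"
    then obtain s x where s: "\<forall>i<n. s i \<in> P" "A = (\<Inter>i<n. (T ^^ i) -` s i)" "x \<in> A"
      by (auto simp: join_partition_def)
    have "cell P ((T ^^ i) x) = s i" if "i < n" for i using that s cell_eq[OF part, of "s i"] by auto
    then have "itinerary T P n y = itinerary T P n x \<longleftrightarrow> (\<forall>i<n. cell P ((T ^^ i) y) = s i)" for y
      by (auto simp: itinerary_eq_iff)
    moreover have "(\<forall>i<n. cell P ((T ^^ i) y) = s i) \<longleftrightarrow> y \<in> A" for y using s cell_eq[OF part] by auto
    ultimately have "A = itinerary T P n -` {itinerary T P n x}" by auto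
    then show "A \<in> (\<lambda>v. itinerary T P n -` {v}) ` range (itinerary T P n)" by auto
  next
    fix A assume "A \<in> (\<lambda>v. itinerary T P n -` {v}) ` range (itinerary T P n)"
    then obtain x where x: "A = itinerary T P n -` {itinerary T P n x}" by auto
    have "y \<in> A \<longleftrightarrow> (\<forall>i<n. (T ^^ i) y \<in> cell P ((T ^^ i) x))" for y
      using cell_eq[OF part cell_in[OF part]] by (simp add: x itinerary_eq_iff)
    then have "A = (\<Inter>i<n. (T ^^ i) -` cell P ((T ^^ i) x))"
      by (simp only: set_eq_iff INT_iff vimage_eq Ball_def lessThan_iff simp_thms)
    then have "A \<in> {(\<Inter>i<n. (T ^^ i) -` s i) | s. \<forall>i<n. s i \<in> P}"
      by (intro CollectI exI[of _ "\<lambda>i. cell P ((T ^^ i) x)"]) (simp add: cell_in[OF part])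
    moreover have "x \<in> A" using x by simp
    ultimately show "A \<in> join_partition T P n" unfolding join_partition_def by blast
  qed
  moreover have "inj_on (\<lambda>v. itinerary T P n -` {v}) (range (itinerary T P n))"
    by (auto simp: inj_on_def)
  ultimately show ?thesis
    by (simp add: partition_entropy_def ent_def eta_def sp sum.reindex)
qed

lemma measurable_funpow_borel:
  fixes T :: "'a::metric_space \<Rightarrow> 'a"
  assumes "continuous_on UNIV T" shows "T ^^ k \<in> borel_measurable borel"
  using borel_measurable_continuous_onI[OF assms] by (intro measurable_compose_n) auto

lemma simple_function_itinerary:
  fixes T :: "'a::metric_space \<Rightarrow> 'a"
  assumes P: "measurable_partition P" and T: "continuous_on UNIV T" and M: "sets M = sets borel"
  shows "simple_function M (\<lambda>x. itinerary T P n ((T ^^ k) x))"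
proof (induction n)
  case 0
  show ?case by simp
next
  case (Suc n)
  have part: "partition_on UNIV P" "finite P" "P \<subseteq> sets borel"
    using P by (auto simp: measurable_partition_def)
  have sp: "space M = UNIV" using sets_eq_imp_space_eq[OF M] by simp
  have "simple_function M (\<lambda>x. cell P ((T ^^ (n + k)) x))"
    unfolding simple_function_def
  proof (intro conjI ballI)
    show "finite ((\<lambda>x. cell P ((T ^^ (n + k)) x)) ` space M)"
      by (rule finite_subset[OF _ part(2)]) (auto simp: cell_in[OF part(1)])
    fix A assume "A \<in> (\<lambda>x. cell P ((T ^^ (n + k)) x)) ` space M"
    then have A: "A \<in> P" by (auto simp: cell_in[OF part(1)])
    then have "(\<lambda>x. cell P ((T ^^ (n + k)) x)) -` {A} \<inter> space M = (T ^^ (n + k)) -` A \<inter> space borel"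
      by (intro set_eqI) (simp add: cell_eq[OF part(1) A] sp)
    also have "\<dots> \<in> sets borel"
      using measurable_funpow_borel[OF T] A part by (intro measurable_sets) auto
    finally show "(\<lambda>x. cell P ((T ^^ (n + k)) x)) -` {A} \<inter> space M \<in> sets M" by (simp add: M)
  qed
  from simple_function_compose2[OF Suc this, of "\<lambda>u v. u @ [v]"] show ?case
    using itinerary_add[of T P n 1] by (simp add: itinerary_def[of T P "Suc 0"] funpow_add)
qed

lemma invariant_measure_props:
  assumes "\<mu> \<in> invariant_measures T"
  shows "prob_space \<mu>" "sets \<mu> = sets borel" "space \<mu> = UNIV" "distr \<mu> borel T = \<mu>"
  using assms sets_eq_imp_space_eq[of \<mu> borel] by (auto simp: invariant_measures_def prob_measures_def)

lemma distr_funpow_invariant: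
  assumes "\<mu> \<in> invariant_measures T" "continuous_on UNIV T"
  shows "distr \<mu> borel (T ^^ k) = \<mu>"
proof (induction k)
  case 0
  show ?case using invariant_measure_props(2)[OF assms(1)] by (simp add: id_def distr_id2)
next
  case (Suc k)
  have m: "T ^^ k \<in> measurable borel borel" "T \<in> measurable \<mu> borel"
    using measurable_funpow_borel[OF assms(2)] measurable_funpow_borel[OF assms(2), of 1]
      invariant_measure_props(2)[OF assms(1)] measurable_cong_sets by (auto simp: o_def cong: measurable_cong_sets)
  have "distr \<mu> borel (T ^^ Suc k) = distr (distr \<mu> borel T) borel (T ^^ k)"
    using m by (subst distr_distr) (simp_all add: funpow_Suc_right del: funpow.simps)
  then show ?case using Suc invariant_measure_props(4)[OF assms(1)] by (simp del: funpow.simps)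
qed

lemma measure_funpow_vimage:
  assumes "\<mu> \<in> invariant_measures T" "continuous_on UNIV T" "A \<in> sets borel"
  shows "measure \<mu> ((T ^^ k) -` A) = measure \<mu> A"
proof -
  have "T ^^ k \<in> measurable \<mu> borel"
    using measurable_funpow_borel[OF assms(2)] invariant_measure_props(2)[OF assms(1)]
    by (auto cong: measurable_cong_sets)
  from measure_distr[OF this assms(3)] show ?thesis
    using distr_funpow_invariant[OF assms(1,2)] invariant_measure_props(3)[OF assms(1)] by simp
qed

lemma ent_itinerary_shift:
  fixes T :: "'a::metric_space \<Rightarrow> 'a"
  assumes mu: "\<mu> \<in> invariant_measures T" and T: "continuous_on UNIV T" and P: "measurable_partition P"
  shows "ent \<mu> (\<lambda>x. itinerary T P n ((T ^^ k) x)) = ent \<mu> (itinerary T P n)"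
proof -
  have part: "partition_on UNIV P" "finite P" using P by (auto simp: measurable_partition_def)
  note props = invariant_measure_props[OF mu]
  have sf: "simple_function \<mu> (itinerary T P n)"
    using simple_function_itinerary[OF P T props(2), of n 0] by simp
  have "measure \<mu> ((\<lambda>x. itinerary T P n ((T ^^ k) x)) -` {v} \<inter> space \<mu>) = measure \<mu> (itinerary T P n -` {v} \<inter> space \<mu>)" for v
  proof -
    have "itinerary T P n -` {v} \<in> sets borel"
      using simple_functionD(2)[OF sf, of "{v}"] props by simp
    from measure_funpow_vimage[OF mu T this, of k] show ?thesis by (simp add: props vimage_def)
  qed
  then show ?thesis
    using itinerary_in_words[OF part(1)] finite_words[OF part(2)]
    by (subst (1 2) ent_superset[of "words P n"]) auto
qed

lemma ent_itinerary_subadditive: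
  fixes T :: "'a::metric_space \<Rightarrow> 'a"
  assumes mu: "\<mu> \<in> invariant_measures T" and T: "continuous_on UNIV T" and P: "measurable_partition P"
  shows "ent \<mu> (itinerary T P (m + n)) \<le> ent \<mu> (itinerary T P m) + ent \<mu> (itinerary T P n)"
proof -
  note props = invariant_measure_props[OF mu]
  interpret prob_space \<mu> by (rule props)
  have "ent \<mu> (itinerary T P (m + n)) = ent \<mu> (\<lambda>x. itinerary T P m ((T ^^ 0) x) @ itinerary T P n ((T ^^ m) x))"
    by (simp add: itinerary_add[abs_def])
  also have "\<dots> \<le> ent \<mu> (\<lambda>x. itinerary T P m ((T ^^ 0) x)) + ent \<mu> (\<lambda>x. itinerary T P n ((T ^^ m) x))"
    by (intro ent_append_le simple_function_itinerary P T props)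
  finally show ?thesis by (simp add: ent_itinerary_shift[OF mu T P])
qed

text \<open>\<open>entropy_wrt\<close> is defined through \<open>lim\<close>, which says nothing
  without convergence; invariance makes the entropies of the itineraries subadditive and so supplies
  it.\<close>

lemma entropy_wrt_limit:
  fixes T :: "'a::metric_space \<Rightarrow> 'a"
  assumes mu: "\<mu> \<in> invariant_measures T" and T: "continuous_on UNIV T" and P: "measurable_partition P"
  shows "(\<lambda>n. ent \<mu> (itinerary T P n) / real n) \<longlonglongrightarrow> entropy_wrt T \<mu> P"
proof -
  note props = invariant_measure_props[OF mu]
  interpret prob_space \<mu> by (rule props)
  have "\<exists>l. (\<lambda>n. ent \<mu> (itinerary T P n) / real n) \<longlonglongrightarrow> l"
    by (intro subadditive_limit ent_nonneg ent_itinerary_subadditive mu T P)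
  then show ?thesis
    by (simp add: entropy_wrt_def partition_entropy_join[OF P props(3)] convergent_def[symmetric] convergent_LIMSEQ_iff)
qed

section \<open>Entropy of weak limits of empirical measures\<close>

text \<open>The sets whose measures are limits under weak convergence to \<open>\<mu>\<close>. They
  form an algebra which, for invariant \<open>\<mu>\<close>, is stable under preimages by the
  iterates of \<open>T\<close>, so the atoms of all joins of a partition into such sets are again of
  this kind.\<close>

definition continuity_set :: "'a::metric_space measure \<Rightarrow> 'a set \<Rightarrow> bool" where
  "continuity_set \<mu> A \<longleftrightarrow> A \<in> sets borel \<and> measure \<mu> (frontier A) = 0"

lemma frontier_sets_borel [simp]: "frontier A \<in> sets borel"
  by (intro borel_closed frontier_closed)

lemma continuity_set_compl: "continuity_set \<mu> A \<Longrightarrow> continuity_set \<mu> (- A)"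
  unfolding continuity_set_def by (auto simp: frontier_complement)

lemma continuity_set_UNIV: "continuity_set \<mu> UNIV"
  by (simp add: continuity_set_def)

lemma continuity_set_Int:
  assumes mu: "sets \<mu> = sets borel" "finite_measure \<mu>" and A: "continuity_set \<mu> A" and B: "continuity_set \<mu> B"
  shows "continuity_set \<mu> (A \<inter> B)"
proof -
  have "measure \<mu> (frontier (A \<inter> B)) \<le> measure \<mu> (frontier A \<union> frontier B)"
    using mu frontier_Int_subset[of A B] by (intro finite_measure.finite_measure_mono) auto
  also have "\<dots> \<le> measure \<mu> (frontier A) + measure \<mu> (frontier B)"
    using mu by (intro measure_Un_le) auto
  also have "\<dots> = 0" using A B by (simp add: continuity_set_def)
  finally have "measure \<mu> (frontier (A \<inter> B)) = 0" using measure_nonneg[of \<mu> "frontier (A \<inter> B)"] by linarith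
  then show ?thesis using A B by (auto simp: continuity_set_def)
qed

lemma continuity_set_INT:
  assumes mu: "sets \<mu> = sets borel" "finite_measure \<mu>" and "finite I" "\<And>i. i \<in> I \<Longrightarrow> continuity_set \<mu> (A i)"
  shows "continuity_set \<mu> (\<Inter>i\<in>I. A i)"
  using assms(3,4)
  by (induction I rule: finite_induct) (auto simp: continuity_set_UNIV intro!: continuity_set_Int mu)

lemma continuous_on_funpow:
  fixes T :: "'a::topological_space \<Rightarrow> 'a"
  assumes "continuous_on UNIV T" shows "continuous_on UNIV (T ^^ k)"
proof (induction k)
  case (Suc k)
  have "continuous_on UNIV (T \<circ> (T ^^ k))"
    by (intro continuous_on_compose Suc continuous_on_subset[OF assms]) auto
  then show ?case by simp
qed (simp add: id_def)

lemma continuity_set_vimage: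
  fixes T :: "'a::metric_space \<Rightarrow> 'a"
  assumes mu: "\<mu> \<in> invariant_measures T" and T: "continuous_on UNIV T" and A: "continuity_set \<mu> A"
  shows "continuity_set \<mu> ((T ^^ k) -` A)"
proof -
  note props = invariant_measure_props[OF mu]
  note Tk = continuous_on_funpow[OF T, of k]
  have "closure ((T ^^ k) -` A) \<subseteq> (T ^^ k) -` closure A"
    using closure_subset[of A] by (intro closure_minimal continuous_closed_vimage) (auto simp: continuous_on_eq_continuous_at[OF open_UNIV, THEN iffD1, OF Tk, rule_format])
  moreover have "(T ^^ k) -` interior A \<subseteq> interior ((T ^^ k) -` A)"
    using interior_subset[of A] by (intro interior_maximal open_vimage Tk) auto
  ultimately have sub: "frontier ((T ^^ k) -` A) \<subseteq> (T ^^ k) -` frontier A"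
    by (auto simp: frontier_def)
  have m: "(T ^^ k) -` B \<in> sets borel" if "B \<in> sets borel" for B
    using measurable_sets[OF measurable_funpow_borel[OF T] that, of k] by simp
  have "measure \<mu> (frontier ((T ^^ k) -` A)) \<le> measure \<mu> ((T ^^ k) -` frontier A)"
    using sub props m by (intro finite_measure.finite_measure_mono prob_space.finite_measure) auto
  also have "\<dots> = 0" using measure_funpow_vimage[OF mu T, of "frontier A" k] A by (simp add: continuity_set_def)
  finally have "measure \<mu> (frontier ((T ^^ k) -` A)) = 0"
    using measure_nonneg[of \<mu> "frontier ((T ^^ k) -` A)"] by linarith
  then show ?thesis using A m by (auto simp: continuity_set_def)
qed

text \<open>The law of the distance to \<open>x\<close> has at most countably many atoms, so some
  radius below \<open>e\<close> has a null sphere, and the frontier of the ball lies in that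
  sphere.\<close>

lemma continuity_ball:
  fixes x :: "'a::metric_space"
  assumes mu: "sets \<mu> = sets borel" "finite_measure \<mu>" and e: "e > 0"
  obtains r where "0 < r" "r < e" "continuity_set \<mu> (ball x r)"
proof -
  have m: "dist x \<in> borel_measurable \<mu>"
    using borel_measurable_continuous_onI[OF continuous_on_dist[OF continuous_on_const continuous_on_id]] mu(1)
    by (simp cong: measurable_cong_sets)
  define \<nu> where "\<nu> = distr \<mu> borel (dist x)"
  interpret mu: finite_measure \<mu> by fact
  have "finite_measure \<nu>" unfolding \<nu>_def by (rule mu.finite_measure_distr[OF m])
  from finite_measure.countable_support[OF this] have "countable {r. measure \<nu> {r} \<noteq> 0}" .
  moreover have "uncountable {0<..<e}" using e by (simp add: uncountable_open_interval)
  ultimately have "\<not> {0<..<e} \<subseteq> {r. measure \<nu> {r} \<noteq> 0}" using countable_subset by blast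
  then obtain r where r: "0 < r" "r < e" "measure \<nu> {r} = 0" by auto
  have "frontier (ball x r) \<subseteq> dist x -` {r}"
    using closure_minimal[OF ball_subset_cball closed_cball, of x r] by (auto simp: frontier_def interior_open)
  moreover have "measure \<mu> (dist x -` {r} \<inter> space \<mu>) = 0"
    using r(3) measure_distr[OF m, of "{r}"] by (simp add: \<nu>_def)
  moreover have "space \<mu> = UNIV" using sets_eq_imp_space_eq[OF mu(1)] by simp
  moreover have "dist x -` {r} \<in> sets \<mu>" using measurable_sets[OF m, of "{r}"] \<open>space \<mu> = UNIV\<close> by simp
  ultimately have "measure \<mu> (frontier (ball x r)) = 0"
    using mu.finite_measure_mono[of "frontier (ball x r)" "dist x -` {r}"] measure_nonneg[of \<mu> "frontier (ball x r)"] by simp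
  then show ?thesis using that r by (auto simp: continuity_set_def)
qed

text \<open>The atoms collect the points with the same signature \<open>N y\<close>, the set of
  balls of a finite cover that contain \<open>y\<close>. Signatures are nonempty, so every atom lies
  in a ball of radius below \<open>e / 2\<close>, and atoms are Boolean combinations of balls with
  null frontier.\<close>

lemma continuity_partition:
  fixes \<mu> :: "'a::metric_space measure"
  assumes c: "compact (UNIV :: 'a set)" and mu: "sets \<mu> = sets borel" "finite_measure \<mu>" and e: "e > 0"
  obtains P where "measurable_partition P" "\<And>A. A \<in> P \<Longrightarrow> continuity_set \<mu> A"
    "\<And>A x y. A \<in> P \<Longrightarrow> x \<in> A \<Longrightarrow> y \<in> A \<Longrightarrow> dist x y < e"
proof -
  have "\<exists>r. 0 < r \<and> r < e / 2 \<and> continuity_set \<mu> (ball x r)" for x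
    using continuity_ball[OF mu, of "e / 2" x] e by auto
  then obtain r where r: "\<And>x. 0 < r x" "\<And>x. r x < e / 2" "\<And>x. continuity_set \<mu> (ball x (r x))" by metis
  have cov: "UNIV \<subseteq> (\<Union>x\<in>UNIV. ball x (r x))"
  proof
    fix x show "x \<in> (\<Union>x\<in>UNIV. ball x (r x))" using r(1)[of x] by (intro UN_I[of x]) auto
  qed
  obtain I where "I \<subseteq> (UNIV :: 'a set)" and I: "finite I" "UNIV \<subseteq> (\<Union>x\<in>I. ball x (r x))"
    by (rule compactE_image[where f = "\<lambda>x. ball x (r x)" and C = UNIV, OF c _ cov]) (rule open_ball)
  define C where "C S = (\<Inter>i\<in>I. if i \<in> S then ball i (r i) else - ball i (r i))" for S
  define N where "N y = {i\<in>I. y \<in> ball i (r i)}" for y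
  have C_iff: "z \<in> C (N y) \<longleftrightarrow> N z = N y" for y z
  proof -
    have "z \<in> C (N y) \<longleftrightarrow> (\<forall>i\<in>I. z \<in> ball i (r i) \<longleftrightarrow> i \<in> N y)"
      unfolding C_def INT_iff by (intro ball_cong refl) simp
    also have "\<dots> \<longleftrightarrow> N z = N y" unfolding N_def by blast
    finally show ?thesis .
  qed
  define P where "P = range (\<lambda>y. C (N y))"
  have "continuity_set \<mu> (C S)" for S
    unfolding C_def using r(3) continuity_set_compl[OF r(3)] by (intro continuity_set_INT[OF mu I(1)]) simp
  then have cs: "continuity_set \<mu> A" if "A \<in> P" for A using that unfolding P_def by blast
  have "partition_on UNIV P"
  proof (rule partition_onI)
    show "\<Union> P = UNIV" unfolding P_def using C_iff[THEN iffD2, OF refl] by blast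
    show "{} \<notin> P" using C_iff[THEN iffD2, OF refl] unfolding P_def by blast
    show "disjnt p q" if "p \<in> P" "q \<in> P" "p \<noteq> q" for p q
      using that unfolding P_def disjnt_def by (auto simp: C_iff set_eq_iff)
  qed
  moreover have "finite P"
  proof (rule finite_subset)
    show "P \<subseteq> C ` Pow I" unfolding P_def N_def by auto
  qed (use I in auto)
  moreover have "P \<subseteq> sets borel" using cs by (auto simp: continuity_set_def)
  moreover have "dist x y < e" if "A \<in> P" "x \<in> A" "y \<in> A" for A x y
  proof -
    obtain z where "A = C (N z)" using \<open>A \<in> P\<close> by (auto simp: P_def)
    then have "N x = N y" using that C_iff by auto
    moreover have "\<exists>i\<in>I. x \<in> ball i (r i)" using I(2) by blast
    then obtain i where i: "i \<in> N x" by (auto simp: N_def)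
    ultimately have "dist i x < r i" "dist i y < r i" by (auto simp: N_def)
    then show ?thesis using r(2)[of i] dist_triangle3[of x y i] by linarith
  qed
  ultimately show ?thesis using that cs by (auto simp: measurable_partition_def)
qed

lemma continuity_set_itinerary:
  fixes T :: "'a::metric_space \<Rightarrow> 'a"
  assumes mu: "\<mu> \<in> invariant_measures T" and T: "continuous_on UNIV T"
    and P: "partition_on UNIV P" "\<And>A. A \<in> P \<Longrightarrow> continuity_set \<mu> A" and w: "w \<in> words P q"
  shows "continuity_set \<mu> {x. itinerary T P q x = w}"
proof -
  note props = invariant_measure_props[OF mu]
  have w': "length w = q" "\<And>i. i < q \<Longrightarrow> w ! i \<in> P" using w by (auto simp: words_def)
  have "itinerary T P q x = w \<longleftrightarrow> (\<forall>i<q. (T ^^ i) x \<in> w ! i)" for x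
    using cell_eq[OF P(1) w'(2)] w'(1) by (simp add: itinerary_def list_eq_iff_nth_eq)
  then have "{x. itinerary T P q x = w} = (\<Inter>i\<in>{..<q}. (T ^^ i) -` (w ! i))"
    by (simp only: set_eq_iff mem_Collect_eq INT_iff vimage_eq Ball_def lessThan_iff simp_thms)
  also have "continuity_set \<mu> \<dots>"
    by (intro continuity_set_INT continuity_set_vimage props prob_space.finite_measure mu T P w') auto
  finally show ?thesis .
qed

section \<open>Cutting long itineraries into blocks\<close>

context prob_space
begin

lemma ent_itinerary_le:
  assumes P: "partition_on UNIV P" "finite P"
    and sf: "simple_function M (\<lambda>x. itinerary T P s ((T ^^ a) x))"
  shows "ent M (\<lambda>x. itinerary T P s ((T ^^ a) x)) \<le> real s * ln (real (card P))"
proof -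
  have "P \<noteq> {}" using P by (auto simp: partition_on_def)
  then have cP: "card P > 0" using P by (simp add: card_gt_0_iff)
  have sub: "(\<lambda>x. itinerary T P s ((T ^^ a) x)) ` space M \<subseteq> words P s"
    using itinerary_in_words[OF P(1)] by auto
  then have "card ((\<lambda>x. itinerary T P s ((T ^^ a) x)) ` space M) \<le> card P ^ s"
    using card_mono[OF finite_words[OF P(2)] sub] card_lists_length_eq[OF P(2), of s] by (simp add: words_def)
  moreover have "card ((\<lambda>x. itinerary T P s ((T ^^ a) x)) ` space M) > 0"
    using not_empty finite_subset[OF sub finite_words[OF P(2)]] by (simp add: card_gt_0_iff)
  ultimately have "ln (real (card ((\<lambda>x. itinerary T P s ((T ^^ a) x)) ` space M))) \<le> ln (real (card P ^ s))"
    by (subst ln_le_cancel_iff) (use cP in \<open>auto simp del: of_nat_power\<close>)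
  also have "\<dots> = real s * ln (real (card P))" using cP by (simp add: ln_realpow)
  finally show ?thesis using ent_le_ln_card[OF sf] by linarith
qed

lemma ent_itinerary_blocks:
  assumes P: "partition_on UNIV P" "finite P"
    and sf: "\<And>s a. simple_function M (\<lambda>x. itinerary T P s ((T ^^ a) x))"
  shows "ent M (\<lambda>x. itinerary T P (m * q + s) ((T ^^ j) x))
    \<le> (\<Sum>i<m. ent M (\<lambda>x. itinerary T P q ((T ^^ (j + i * q)) x))) + real s * ln (real (card P))"
proof (induction m arbitrary: j)
  case 0
  show ?case using ent_itinerary_le[OF P sf] by simp
next
  case (Suc m)
  have "ent M (\<lambda>x. itinerary T P (Suc m * q + s) ((T ^^ j) x))
    = ent M (\<lambda>x. itinerary T P q ((T ^^ j) x) @ itinerary T P (m * q + s) ((T ^^ (j + q)) x))"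
    using itinerary_add[of T P q "m * q + s"] by (simp add: add.assoc funpow_add add.commute[of j q])
  also have "\<dots> \<le> ent M (\<lambda>x. itinerary T P q ((T ^^ j) x)) + ent M (\<lambda>x. itinerary T P (m * q + s) ((T ^^ (j + q)) x))"
    by (intro ent_append_le sf)
  also have "\<dots> \<le> ent M (\<lambda>x. itinerary T P q ((T ^^ j) x)) +
    ((\<Sum>i<m. ent M (\<lambda>x. itinerary T P q ((T ^^ (j + q + i * q)) x))) + real s * ln (real (card P)))"
    by (intro add_left_mono Suc.IH)
  also have "\<dots> = (\<Sum>i<Suc m. ent M (\<lambda>x. itinerary T P q ((T ^^ (j + i * q)) x))) + real s * ln (real (card P))"
    unfolding sum.lessThan_Suc_shift by (simp add: add_ac)
  finally show ?case .
qed

text \<open>Cutting an orbit of length \<open>n\<close> into blocks of length \<open>q\<close>, starting at each of the offsets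
  \<open>j < q\<close>, uses every starting time at most once.\<close>

lemma ent_itinerary_average:
  assumes P: "partition_on UNIV P" "finite P"
    and sf: "\<And>s a. simple_function M (\<lambda>x. itinerary T P s ((T ^^ a) x))"
    and q: "1 \<le> q" "q \<le> n"
  shows "real q * ent M (itinerary T P n)
    \<le> (\<Sum>t<n. ent M (\<lambda>x. itinerary T P q ((T ^^ t) x))) + 2 * real q ^ 2 * ln (real (card P))"
proof -
  define K where "K = ln (real (card P))"
  have "P \<noteq> {}" using P by (auto simp: partition_on_def)
  then have "card P > 0" using P by (simp add: card_gt_0_iff)
  then have K: "K \<ge> 0" by (simp add: K_def)
  define a where "a t = ent M (\<lambda>x. itinerary T P q ((T ^^ t) x))" for t
  define m where "m j = (n - j) div q" for j
  have a0: "a t \<ge> 0" for t unfolding a_def by (rule ent_nonneg)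
  have one: "ent M (itinerary T P n) \<le> (\<Sum>i<m j. a (j + i * q)) + 2 * real q * K" if j: "j < q" for j
  proof -
    define s where "s = (n - j) mod q"
    have n: "n = j + (m j * q + s)" using j q by (simp add: m_def s_def)
    have "ent M (itinerary T P n) = ent M (\<lambda>x. itinerary T P j ((T ^^ 0) x) @ itinerary T P (m j * q + s) ((T ^^ j) x))"
      by (subst n) (simp add: itinerary_add[of T P j "m j * q + s", abs_def])
    also have "\<dots> \<le> ent M (\<lambda>x. itinerary T P j ((T ^^ 0) x)) + ent M (\<lambda>x. itinerary T P (m j * q + s) ((T ^^ j) x))"
      by (intro ent_append_le sf)
    \<comment> \<open>The head of length \<open>j < q\<close> and the remainder of length
      \<open>s < q\<close> cost at most \<open>K\<close> per letter, which is the source of the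
      error \<open>2 * real q * K\<close>.\<close>
    also have "\<dots> \<le> real j * K + ((\<Sum>i<m j. a (j + i * q)) + real s * K)"
      unfolding K_def a_def by (intro add_mono ent_itinerary_blocks ent_itinerary_le P sf)
    also have "\<dots> = (\<Sum>i<m j. a (j + i * q)) + real (j + s) * K" by (simp add: algebra_simps)
    also have "real (j + s) * K \<le> real (2 * q) * K"
    proof (rule mult_right_mono[OF _ K])
      have "j + s \<le> 2 * q" using j mod_less_divisor[of q "n - j"] unfolding s_def by linarith
      then show "real (j + s) \<le> real (2 * q)" by (rule of_nat_mono)
    qed
    finally show ?thesis by simp
  qed
  have "real q * ent M (itinerary T P n) = (\<Sum>j<q. ent M (itinerary T P n))" by simp
  also have "\<dots> \<le> (\<Sum>j<q. (\<Sum>i<m j. a (j + i * q)) + 2 * real q * K)" by (intro sum_mono one) auto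
  also have "\<dots> = (\<Sum>j<q. \<Sum>i<m j. a (j + i * q)) + 2 * real q ^ 2 * K"
    by (simp add: sum.distrib power2_eq_square)
  also have "(\<Sum>j<q. \<Sum>i<m j. a (j + i * q)) = (\<Sum>(j, i)\<in>Sigma {..<q} (\<lambda>j. {..<m j}). a (j + i * q))"
    by (subst sum.Sigma) auto
  also have "\<dots> = (\<Sum>t\<in>(\<lambda>(j, i). j + i * q) ` Sigma {..<q} (\<lambda>j. {..<m j}). a t)"
  proof -
    have "inj_on (\<lambda>(j, i). j + i * q) (Sigma {..<q} (\<lambda>j. {..<m j}))"
    proof (rule inj_onI, clarsimp)
      fix j i j' i' assume h: "j < q" "j' < q" "j + i * q = j' + i' * q"
      have "(j + i * q) mod q = (j' + i' * q) mod q" by (simp only: h(3))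
      then have "j = j'" using h(1,2) by simp
      then show "j = j' \<and> i = i'" using h by auto
    qed
    from sum.reindex[OF this, of a] show ?thesis by (simp add: case_prod_unfold comp_def)
  qed
  also have "\<dots> \<le> (\<Sum>t<n. a t)"
  proof (rule sum_mono2)
    show "(\<lambda>(j, i). j + i * q) ` Sigma {..<q} (\<lambda>j. {..<m j}) \<subseteq> {..<n}"
    proof clarsimp
      fix j i assume h: "j < q" "i < m j"
      then have "Suc i * q \<le> m j * q" by (intro mult_right_mono) auto
      also have "\<dots> \<le> n - j" unfolding m_def by simp
      finally show "j + i * q < n" using q h by simp
    qed
  qed (use a0 in auto)
  finally show ?thesis by (simp add: a_def K_def)
qed

end


text \<open>Construction of the measure in the variational principle. The limit
  \<open>\<sigma>\<close> of the averages \<open>L k\<close> is invariant because orbit sums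
  telescope. Separation makes itineraries injective on \<open>E k\<close>, so the uniform measure
  there has entropy \<open>ln (card (E k))\<close>; cutting into blocks of length \<open>q\<close>
  and concavity of \<open>eta\<close> compare this with the block entropy of \<open>L k\<close>, and
  atoms with null frontier let the comparison pass to the limit.\<close>

theorem misiurewicz:
  fixes T :: "'a::metric_space \<Rightarrow> 'a" and \<theta> :: "nat \<Rightarrow> 'a \<Rightarrow> real" and \<Phi> :: "'b \<Rightarrow> 'a \<Rightarrow> real"
    and n :: "nat \<Rightarrow> nat"
  assumes compact: "compact (UNIV :: 'a set)" and T: "continuous_on UNIV T" and dense: "dense_sequence \<theta>"
    and n: "filterlim n at_top sequentially" "\<And>k. 1 \<le> n k"
    and E: "\<And>k. finite (E k)" "\<And>k. E k \<noteq> {}"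
    and e: "0 < e" and sep: "\<And>k x y. x \<in> E k \<Longrightarrow> y \<in> E k \<Longrightarrow> x \<noteq> y \<Longrightarrow> \<exists>i<n k. e \<le> dist ((T ^^ i) x) ((T ^^ i) y)"
    and card: "\<And>k. exp (c * real (n k)) \<le> real (card (E k))"
    and Phi: "\<And>j. continuous_on UNIV (\<Phi> j)"
    and avg: "\<And>k x j. x \<in> E k \<Longrightarrow> \<bar>birkhoff_sum T (\<Phi> j) (n k) x / real (n k) - v j\<bar> \<le> \<delta> k" and \<delta>: "\<delta> \<longlonglongrightarrow> 0"
  obtains \<sigma> where "\<sigma> \<in> invariant_measures T" "\<And>j. integral\<^sup>L \<sigma> (\<Phi> j) = v j" "ereal c \<le> metric_entropy T \<sigma>"
proof -
  define L where "L k f = (\<Sum>x\<in>E k. birkhoff_sum T f (n k) x) / (real (card (E k)) * real (n k))" for k and f :: "'a \<Rightarrow> real"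
  have cE: "0 < real (card (E k))" for k using E by (simp add: card_gt_0_iff)
  have npos: "0 < real (n k)" for k using n(2)[of k] by linarith
  have L_add: "L k (\<lambda>x. f x + g x) = L k f + L k g" for k f g
    by (simp add: L_def birkhoff_sum_def sum.distrib add_divide_distrib)
  have L_scale: "L k (\<lambda>x. c * f x) = c * L k f" for k c f
    by (simp add: L_def birkhoff_sum_def sum_distrib_left[symmetric])
  have L_pos: "0 \<le> L k f" if "\<And>x. 0 \<le> f x" for k f
    unfolding L_def birkhoff_sum_def using that cE npos by (intro divide_nonneg_nonneg sum_nonneg) auto
  have L_one: "L k (\<lambda>x. 1) = 1" for k
    using cE[of k] npos[of k] by (simp add: L_def birkhoff_sum_def)
  obtain r \<sigma> where r: "strict_mono r" and sigma: "prob_space \<sigma>" "sets \<sigma> = sets borel"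
    and lim: "\<And>f. continuous_on UNIV f \<Longrightarrow> (\<lambda>k. L (r k) f) \<longlonglongrightarrow> integral\<^sup>L \<sigma> f"
    using weak_limit_subsequence[of \<theta> L, OF compact dense L_add L_scale L_pos L_one] by blast
  interpret sigma: prob_space \<sigma> by (rule sigma)
  have sp: "space \<sigma> = UNIV" using sets_eq_imp_space_eq[OF sigma(2)] by simp
  have nr: "filterlim (\<lambda>k. n (r k)) at_top sequentially"
    by (rule filterlim_compose[OF n(1) filterlim_subseq[OF r]])
  have inv: "(\<integral>x. f (T x) \<partial>\<sigma>) = integral\<^sup>L \<sigma> f" if f: "continuous_on UNIV f" for f :: "'a \<Rightarrow> real"
  proof -
    obtain B where B: "\<And>x. \<bar>f x\<bar> \<le> B" using continuous_bounded_compact[OF compact f] by blast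
    have fT: "continuous_on UNIV (\<lambda>x. f (T x))"
      using continuous_on_compose2[OF f T] by simp
    have bnd: "\<bar>L k (\<lambda>x. f (T x)) - L k f\<bar> \<le> 2 * B / real (n k)" for k
    proof -
      have "(\<Sum>i<n k. f (T ((T ^^ i) x))) - (\<Sum>i<n k. f ((T ^^ i) x)) = f ((T ^^ n k) x) - f x" for x
        using sum_lessThan_telescope[of "\<lambda>i. f ((T ^^ i) x)" "n k"] by (simp add: sum_subtractf)
      then have "L k (\<lambda>x. f (T x)) - L k f = (\<Sum>x\<in>E k. f ((T ^^ n k) x) - f x) / (real (card (E k)) * real (n k))"
        by (simp add: L_def birkhoff_sum_def diff_divide_distrib[symmetric] sum_subtractf[symmetric])
      then have "\<bar>L k (\<lambda>x. f (T x)) - L k f\<bar> = \<bar>\<Sum>x\<in>E k. f ((T ^^ n k) x) - f x\<bar> / (real (card (E k)) * real (n k))"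
        by (simp add: abs_divide abs_mult)
      also have "\<dots> \<le> (\<Sum>x\<in>E k. 2 * B) / (real (card (E k)) * real (n k))"
      proof (intro divide_right_mono order.trans[OF sum_abs] sum_mono)
        fix x show "\<bar>f ((T ^^ n k) x) - f x\<bar> \<le> 2 * B" using B[of x] B[of "(T ^^ n k) x"] by linarith
      qed simp
      also have "\<dots> = 2 * B / real (n k)" using cE[of k] by simp
      finally show ?thesis .
    qed
    have lim0: "(\<lambda>k. 2 * B / real (n (r k))) \<longlonglongrightarrow> 0"
      by (intro tendsto_divide_0[OF tendsto_const] filterlim_at_top_imp_at_infinity filterlim_compose[OF filterlim_real_sequentially nr])
    have "(\<lambda>k. L (r k) (\<lambda>x. f (T x)) - L (r k) f) \<longlonglongrightarrow> 0"
      by (rule Lim_null_comparison[OF always_eventually lim0]) (simp add: bnd)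
    moreover have "(\<lambda>k. L (r k) (\<lambda>x. f (T x)) - L (r k) f) \<longlonglongrightarrow> (\<integral>x. f (T x) \<partial>\<sigma>) - integral\<^sup>L \<sigma> f"
      by (intro tendsto_diff lim f fT)
    ultimately show ?thesis using LIMSEQ_unique by fastforce
  qed
  have Tm: "T \<in> measurable \<sigma> borel"
    using borel_measurable_continuous_onI[OF T] sigma(2) by (simp cong: measurable_cong_sets)
  have "distr \<sigma> borel T = \<sigma>"
  proof (rule measure_eqI_continuous[OF compact])
    show "finite_measure (distr \<sigma> borel T)" by (rule sigma.finite_measure_distr[OF Tm])
    show "finite_measure \<sigma>" by (rule sigma.finite_measure_axioms)
    fix f :: "'a \<Rightarrow> real" assume f: "continuous_on UNIV f"
    show "integral\<^sup>L (distr \<sigma> borel T) f = integral\<^sup>L \<sigma> f"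
      using integral_distr[OF Tm borel_measurable_continuous_onI[OF f]] inv[OF f] by simp
  qed (use sigma in auto)
  then have sigma_inv: "\<sigma> \<in> invariant_measures T"
    using sigma by (simp add: invariant_measures_def prob_measures_def)
  have int: "integral\<^sup>L \<sigma> (\<Phi> j) = v j" for j
  proof -
    have bnd: "\<bar>L k (\<Phi> j) - v j\<bar> \<le> \<delta> k" for k
    proof -
      have "L k (\<Phi> j) - v j = (\<Sum>x\<in>E k. birkhoff_sum T (\<Phi> j) (n k) x / real (n k) - v j) / real (card (E k))"
        using cE[of k] by (simp add: L_def sum_subtractf diff_divide_distrib sum_divide_distrib[symmetric] mult.commute)
      then have "\<bar>L k (\<Phi> j) - v j\<bar> = \<bar>\<Sum>x\<in>E k. birkhoff_sum T (\<Phi> j) (n k) x / real (n k) - v j\<bar> / real (card (E k))"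
        by (simp add: abs_divide)
      also have "\<dots> \<le> (\<Sum>x\<in>E k. \<delta> k) / real (card (E k))"
        by (intro divide_right_mono order.trans[OF sum_abs] sum_mono avg) auto
      also have "\<dots> = \<delta> k" using cE[of k] by simp
      finally show ?thesis .
    qed
    have "(\<lambda>k. L (r k) (\<Phi> j) - v j) \<longlonglongrightarrow> 0"
      by (rule Lim_null_comparison[OF always_eventually LIMSEQ_subseq_LIMSEQ[OF \<delta> r]]) (simp add: bnd)
    then have "(\<lambda>k. L (r k) (\<Phi> j)) \<longlonglongrightarrow> v j" by (simp add: LIM_zero_iff)
    then show ?thesis using lim[OF Phi] LIMSEQ_unique by blast
  qed
  \<comment> \<open>The partition can only be chosen now: its atoms need diameters below the
    separation \<open>e\<close>, and frontiers that are null for the limit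
    \<open>\<sigma>\<close>.\<close>
  obtain P where P: "measurable_partition P" and P_cont: "\<And>A. A \<in> P \<Longrightarrow> continuity_set \<sigma> A"
    and P_small: "\<And>A x y. A \<in> P \<Longrightarrow> x \<in> A \<Longrightarrow> y \<in> A \<Longrightarrow> dist x y < e"
    using continuity_partition[OF compact sigma(2) sigma.finite_measure_axioms e] by blast
  have part: "partition_on UNIV P" "finite P" using P by (auto simp: measurable_partition_def)
  define K where "K = ln (real (card P))"
  have block: "c \<le> ent \<sigma> (itinerary T P q) / real q" if q: "1 \<le> q" for q
  proof -
    define A where "A w = {x. itinerary T P q x = w}" for w
    have bound: "c \<le> (\<Sum>w\<in>words P q. eta (L k (indicator (A w)))) / real q + 2 * real q * K / real (n k)"
      if nq: "q \<le> n k" for k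
    proof -
      \<comment> \<open>The block argument runs with the uniform measure on \<open>E k\<close>,
        whose images at different times differ; averaging over time comes only afterwards, through
        \<open>eta_mean\<close>, and produces \<open>L k\<close>.\<close>
      define U where "U = uniform_count_measure (E k)"
      interpret U: prob_space U unfolding U_def by (intro prob_space_uniform_count_measure E)
      have sf: "simple_function U F" for F :: "'a \<Rightarrow> 'c"
        using E(1)[of k] by (auto simp: U_def simple_function_def space_uniform_count_measure sets_uniform_count_measure)
      have mU: "measure U B = real (card B) / real (card (E k))" if "B \<subseteq> E k" for B
        unfolding U_def using that E by (intro measure_uniform_count_measure) auto
      have spU: "space U = E k" by (simp add: U_def space_uniform_count_measure)
      have inj: "inj_on (itinerary T P (n k)) (E k)"
      proof (rule inj_onI, rule ccontr)
        fix x y assume xy: "x \<in> E k" "y \<in> E k" "itinerary T P (n k) x = itinerary T P (n k) y" "x \<noteq> y"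
        then obtain i where i: "i < n k" "e \<le> dist ((T ^^ i) x) ((T ^^ i) y)" using sep by blast
        then have "cell P ((T ^^ i) x) = cell P ((T ^^ i) y)" using xy by (simp add: itinerary_eq_iff)
        then have "dist ((T ^^ i) x) ((T ^^ i) y) < e"
          using mem_cell[OF part(1)] by (intro P_small[OF cell_in[OF part(1), of "(T ^^ i) x"]]) auto
        with i show False by simp
      qed
      \<comment> \<open>By injectivity every name has a single preimage in \<open>E k\<close>, so
        the entropy is the largest possible.\<close>
      have "ent U (itinerary T P (n k)) = (\<Sum>x\<in>E k. eta (1 / real (card (E k))))"
        unfolding ent_def spU sum.reindex[OF inj] o_def
      proof (rule sum.cong)
        fix x assume x: "x \<in> E k"
        then have "itinerary T P (n k) -` {itinerary T P (n k) x} \<inter> E k = {x}"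
          using inj by (auto simp: inj_on_def)
        then show "eta (measure U (itinerary T P (n k) -` {itinerary T P (n k) x} \<inter> E k)) = eta (1 / real (card (E k)))"
          using mU[of "{x}"] x by simp
      qed simp
      also have "\<dots> = ln (real (card (E k)))" using cE[of k] by (simp add: eta_def ln_div)
      finally have entU: "ent U (itinerary T P (n k)) = ln (real (card (E k)))" .
      have "c * real (n k) \<le> ln (real (card (E k)))"
        using card[of k] cE[of k] ln_ge_iff by blast
      then have "real q * (c * real (n k)) \<le> real q * ent U (itinerary T P (n k))"
        unfolding entU by (rule mult_left_mono) simp
      also have "\<dots> \<le> (\<Sum>t<n k. ent U (\<lambda>x. itinerary T P q ((T ^^ t) x))) + 2 * real q ^ 2 * K"
        unfolding K_def by (rule U.ent_itinerary_average[OF part sf q nq])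
      also have "(\<Sum>t<n k. ent U (\<lambda>x. itinerary T P q ((T ^^ t) x)))
        = (\<Sum>t<n k. \<Sum>w\<in>words P q. eta (real (card {x\<in>E k. (T ^^ t) x \<in> A w}) / real (card (E k))))"
      proof (rule sum.cong)
        fix t
        have "(\<lambda>x. itinerary T P q ((T ^^ t) x)) -` {w} \<inter> E k = {x\<in>E k. (T ^^ t) x \<in> A w}" for w
          by (auto simp: A_def)
        then show "ent U (\<lambda>x. itinerary T P q ((T ^^ t) x)) = (\<Sum>w\<in>words P q. eta (real (card {x\<in>E k. (T ^^ t) x \<in> A w}) / real (card (E k))))"
          using itinerary_in_words[OF part(1)] finite_words[OF part(2)]
          by (subst ent_superset[of "words P q"]) (auto simp: spU mU)
      qed simp
      also have "\<dots> = (\<Sum>w\<in>words P q. \<Sum>t<n k. eta (real (card {x\<in>E k. (T ^^ t) x \<in> A w}) / real (card (E k))))"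
        by (rule sum.swap)
      also have "\<dots> \<le> (\<Sum>w\<in>words P q. real (n k) * eta (L k (indicator (A w))))"
      proof (rule sum_mono)
        fix w
        have "(\<Sum>t<n k. eta (real (card {x\<in>E k. (T ^^ t) x \<in> A w}) / real (card (E k))))
          \<le> real (card {..<n k}) * eta ((\<Sum>t<n k. real (card {x\<in>E k. (T ^^ t) x \<in> A w}) / real (card (E k))) / real (card {..<n k}))"
          using n(2)[of k] by (intro eta_mean) (auto simp: lessThan_empty_iff)
        also have "(\<Sum>t<n k. real (card {x\<in>E k. (T ^^ t) x \<in> A w}) / real (card (E k))) / real (card {..<n k}) = L k (indicator (A w))"
        proof -
          have "real (card {x\<in>E k. (T ^^ t) x \<in> A w}) = (\<Sum>x\<in>E k. indicator (A w) ((T ^^ t) x))" for t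
            using E(1)[of k] by (simp add: indicator_def of_bool_def sum.If_cases Int_def)
          then show ?thesis
            by (simp add: L_def birkhoff_sum_def sum_divide_distrib[symmetric] sum.swap[of _ "E k"])
        qed
        finally show "(\<Sum>t<n k. eta (real (card {x\<in>E k. (T ^^ t) x \<in> A w}) / real (card (E k)))) \<le> real (n k) * eta (L k (indicator (A w)))"
          by simp
      qed
      also have "\<dots> = real (n k) * (\<Sum>w\<in>words P q. eta (L k (indicator (A w))))" by (simp add: sum_distrib_left)
      finally show ?thesis using q npos[of k] by (simp add: field_simps power2_eq_square)
    qed
    have Lk: "(\<lambda>k. L (r k) (indicator (A w))) \<longlonglongrightarrow> measure \<sigma> (A w)" if w: "w \<in> words P q" for w
    proof (rule portmanteau_frontier_null[OF compact sigma lim])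
      have "continuity_set \<sigma> (A w)"
        unfolding A_def by (rule continuity_set_itinerary[OF sigma_inv T part(1) P_cont w])
      then show "measure \<sigma> (frontier (A w)) = 0" "A w \<in> sets borel" by (auto simp: continuity_set_def)
      show "L (r k) f \<le> L (r k) g" if "\<And>x. f x \<le> g x" for k f g
        unfolding L_def birkhoff_sum_def using that cE npos by (intro divide_right_mono sum_mono) auto
      show "L (r k) (indicator (- B)) = 1 - L (r k) (indicator B)" for k B
      proof -
        have "(\<lambda>x. indicator (- B) x + indicator B x) = (\<lambda>x::'a. 1::real)" by (auto simp: indicator_def)
        then show ?thesis using L_add[of "r k" "indicator (- B)" "indicator B"] L_one[of "r k"] by simp
      qed
    qed auto
    have "(\<lambda>k. \<Sum>w\<in>words P q. eta (L (r k) (indicator (A w)))) \<longlonglongrightarrow> (\<Sum>w\<in>words P q. eta (measure \<sigma> (A w)))"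
    proof (rule tendsto_sum)
      fix w assume w: "w \<in> words P q"
      show "(\<lambda>k. eta (L (r k) (indicator (A w)))) \<longlonglongrightarrow> eta (measure \<sigma> (A w))"
        by (rule continuous_on_tendsto_compose[OF continuous_eta Lk[OF w]]) (auto intro!: L_pos always_eventually)
    qed
    also have "(\<Sum>w\<in>words P q. eta (measure \<sigma> (A w))) = ent \<sigma> (itinerary T P q)"
      using itinerary_in_words[OF part(1)] finite_words[OF part(2)]
      by (subst ent_superset[of "words P q"]) (auto simp: sp A_def vimage_def)
    finally have l1: "(\<lambda>k. \<Sum>w\<in>words P q. eta (L (r k) (indicator (A w)))) \<longlonglongrightarrow> ent \<sigma> (itinerary T P q)" .
    have "(\<lambda>k. 2 * real q * K / real (n (r k))) \<longlonglongrightarrow> 0"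
      by (intro tendsto_divide_0[OF tendsto_const] filterlim_at_top_imp_at_infinity filterlim_compose[OF filterlim_real_sequentially nr])
    from tendsto_add[OF tendsto_divide[OF l1 tendsto_const, of "real q"] this]
    have "(\<lambda>k. (\<Sum>w\<in>words P q. eta (L (r k) (indicator (A w)))) / real q + 2 * real q * K / real (n (r k)))
      \<longlonglongrightarrow> ent \<sigma> (itinerary T P q) / real q" using q by simp
    moreover have "eventually (\<lambda>k. q \<le> n (r k)) sequentially" using nr by (auto simp: filterlim_at_top)
    then have "eventually (\<lambda>k. c \<le> (\<Sum>w\<in>words P q. eta (L (r k) (indicator (A w)))) / real q + 2 * real q * K / real (n (r k))) sequentially"
      by eventually_elim (rule bound)
    ultimately show ?thesis by (intro tendsto_lowerbound) auto
  qed
  have "c \<le> entropy_wrt T \<sigma> P"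
    using entropy_wrt_limit[OF sigma_inv T P] block
    by (intro LIMSEQ_le_const[of "\<lambda>n. ent \<sigma> (itinerary T P n) / real n"]) auto
  then have "ereal c \<le> metric_entropy T \<sigma>"
    unfolding metric_entropy_def using P by (intro SUP_upper2[of P]) auto
  then show ?thesis using that sigma_inv int by blast
qed

section \<open>The metric induced by \<open>\<rho>\<close>\<close>

text \<open>The counting arguments use the pseudometric axioms. The two comparisons with the metric
  of the class are uniform, so that moduli of continuity and separation constants transfer in both
  directions.\<close>

locale equivalent_metric =
  fixes d :: "'a::metric_space \<Rightarrow> 'a \<Rightarrow> real"
  assumes d_same [simp]: "d x x = 0" and d_sym: "d x y = d y x" and d_triangle: "d x z \<le> d x y + d y z"
    and dist_imp_d: "0 < e \<Longrightarrow> \<exists>r>0. \<forall>x y. dist x y < r \<longrightarrow> d x y < e"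
    and d_imp_dist: "0 < e \<Longrightarrow> \<exists>r>0. \<forall>x y. d x y < r \<longrightarrow> dist x y < e"

lemma rho_dist_eq:
  fixes \<theta> :: "nat \<Rightarrow> 'a::metric_space \<Rightarrow> real"
  assumes "dense_sequence \<theta>"
  shows "rho_dist \<theta> x y = (\<Sum>k. (1 / 2) ^ Suc k * \<bar>\<theta> k x - \<theta> k y\<bar>)"
proof -
  have "\<theta> k \<in> borel_measurable borel" for k
    using assms by (intro borel_measurable_continuous_onI) (auto simp: dense_sequence_def)
  then have "integral\<^sup>L (return borel z) (\<theta> k) = \<theta> k z" for z k by (simp add: integral_return)
  then show ?thesis by (simp add: rho_dist_def rho_def)
qed

text \<open>In one direction the tail of the series is cut off and the finitely many remaining
  \<open>\<theta> k\<close> are uniformly continuous. In the other, pairs that are far in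
  \<open>dist\<close> but ever closer in \<open>rho_dist\<close> would accumulate at two different
  points that no \<open>\<theta> k\<close> separates.\<close>

lemma equivalent_metric_rho_dist:
  fixes \<theta> :: "nat \<Rightarrow> 'a::metric_space \<Rightarrow> real"
  assumes compact: "compact (UNIV :: 'a set)" and dense: "dense_sequence \<theta>"
  shows "equivalent_metric (rho_dist \<theta>)"
proof -
  define a where "a x y k = (1 / 2 :: real) ^ Suc k * \<bar>\<theta> k x - \<theta> k y\<bar>" for x y k
  have d_eq: "rho_dist \<theta> x y = (\<Sum>k. a x y k)" for x y by (simp add: rho_dist_eq[OF dense] a_def)
  have cont: "continuous_on UNIV (\<theta> k)" and range: "0 \<le> \<theta> k x" "\<theta> k x \<le> 1" for k x
    using dense unfolding dense_sequence_def image_subset_iff by auto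
  have diff1: "\<bar>\<theta> k x - \<theta> k y\<bar> \<le> 1" for k x y using range[of k x] range[of k y] by linarith
  have a0: "0 \<le> a x y k" and a1: "a x y k \<le> (1 / 2) ^ Suc k" for x y k
    using diff1[of k x y] by (auto simp: a_def mult_left_le)
  have sg: "summable (\<lambda>k. (1 / 2 :: real) ^ Suc k)"
    using summable_geometric[of "1/2::real"] by (subst summable_Suc_iff) auto
  have sa: "summable (a x y)" for x y
    by (rule summable_comparison_test'[OF sg]) (use a0 a1 in \<open>auto simp del: power_Suc\<close>)
  show ?thesis
  proof
    fix x y z
    show "rho_dist \<theta> x x = 0" by (simp add: d_eq a_def)
    show "rho_dist \<theta> x y = rho_dist \<theta> y x" by (simp add: d_eq a_def abs_minus_commute)
    have "a x z k \<le> a x y k + a y z k" for k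
      unfolding a_def distrib_left[symmetric] by (rule mult_left_mono) auto
    then show "rho_dist \<theta> x z \<le> rho_dist \<theta> x y + rho_dist \<theta> y z"
      unfolding d_eq suminf_add[OF sa sa] by (intro suminf_le sa summable_add)
  next
    fix e :: real assume e: "0 < e"
    obtain N where N: "(1 / 2 :: real) ^ N < e / 2"
      using real_arch_pow_inv[of "e / 2" "1 / 2"] e by auto
    have "\<exists>r>0. \<forall>x y. dist x y < r \<longrightarrow> \<bar>\<theta> k x - \<theta> k y\<bar> < e / 2" for k
    proof -
      have "uniformly_continuous_on UNIV (\<theta> k)" by (rule compact_uniformly_continuous[OF cont compact])
      then obtain r where "r > 0" "\<And>x y. dist y x < r \<Longrightarrow> dist (\<theta> k y) (\<theta> k x) < e / 2"
        using e unfolding uniformly_continuous_on_def by (metis UNIV_I half_gt_zero)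
      then show ?thesis by (auto simp: dist_real_def)
    qed
    then obtain r where r: "\<And>k. 0 < r k" "\<And>k x y. dist x y < r k \<Longrightarrow> \<bar>\<theta> k x - \<theta> k y\<bar> < e / 2" by metis
    define R where "R = Min (insert 1 (r ` {..<N}))"
    have R: "R > 0" "\<And>k. k < N \<Longrightarrow> R \<le> r k" using r(1) by (auto simp: R_def)
    have "rho_dist \<theta> x y < e" if xy: "dist x y < R" for x y
    proof -
      \<comment> \<open>The tail is at most \<open>(1 / 2) ^ N < e / 2\<close>, and the weights of
        the head sum to at most 1.\<close>
      have "rho_dist \<theta> x y = (\<Sum>k. a x y (k + N)) + (\<Sum>k<N. a x y k)"
        unfolding d_eq by (rule suminf_split_initial_segment[OF sa])
      also have "(\<Sum>k. a x y (k + N)) \<le> (\<Sum>k. (1 / 2) ^ N * (1 / 2) ^ Suc k)"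
      proof (rule suminf_le)
        show "a x y (k + N) \<le> (1 / 2) ^ N * (1 / 2) ^ Suc k" for k
          using a1[of x y "k + N"] by (simp add: power_add mult_ac)
        show "summable (\<lambda>k. a x y (k + N))" using sa by (simp add: summable_iff_shift)
        show "summable (\<lambda>k. (1 / 2 :: real) ^ N * (1 / 2) ^ Suc k)" by (rule summable_mult[OF sg])
      qed
      also have "\<dots> = (1 / 2) ^ N"
        using sums_mult[OF power_half_series, of "(1 / 2) ^ N"] by (simp add: sums_iff)
      also have "(\<Sum>k<N. a x y k) \<le> (\<Sum>k<N. (1 / 2) ^ Suc k * (e / 2))"
        unfolding a_def
      proof (intro sum_mono mult_left_mono)
        fix k assume "k \<in> {..<N}"
        then have "dist x y < r k" using less_le_trans[OF xy R(2)] by simp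
        then show "\<bar>\<theta> k x - \<theta> k y\<bar> \<le> e / 2" using r(2) by (intro less_imp_le)
      qed simp
      also have "\<dots> = (\<Sum>k<N. (1 / 2) ^ Suc k) * (e / 2)" by (rule sum_distrib_right[symmetric])
      also have "\<dots> \<le> 1 * (e / 2)"
      proof (rule mult_right_mono)
        have "(\<Sum>k<N. (1 / 2 :: real) ^ Suc k) \<le> (\<Sum>k. (1 / 2) ^ Suc k)" by (intro sum_le_suminf sg) auto
        then show "(\<Sum>k<N. (1 / 2 :: real) ^ Suc k) \<le> 1" using power_half_series by (simp add: sums_iff)
      qed (use e in simp)
      finally show ?thesis using N by simp
    qed
    with R(1) show "\<exists>r>0. \<forall>x y. dist x y < r \<longrightarrow> rho_dist \<theta> x y < e" by blast
  next
    fix e :: real assume e: "0 < e"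
    show "\<exists>r>0. \<forall>x y. rho_dist \<theta> x y < r \<longrightarrow> dist x y < e"
    proof (rule ccontr)
      assume neg: "\<not> (\<exists>r>0. \<forall>x y. rho_dist \<theta> x y < r \<longrightarrow> dist x y < e)"
      have "\<exists>x y. rho_dist \<theta> x y < 1 / real (Suc n) \<and> e \<le> dist x y" for n
        using neg by (metis not_less zero_less_divide_iff of_nat_0_less_iff zero_less_Suc zero_less_one)
      then obtain x y where xy: "\<And>n. rho_dist \<theta> (x n) (y n) < 1 / real (Suc n)" "\<And>n. e \<le> dist (x n) (y n)"
        by metis
      have sc: "seq_compact (UNIV :: 'a set)" using compact by (simp add: compact_eq_seq_compact_metric)
      obtain l r where r: "strict_mono r" "(x \<circ> r) \<longlonglongrightarrow> l"
        using sc unfolding seq_compact_def by blast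
      obtain l' r' where r': "strict_mono r'" "(y \<circ> r \<circ> r') \<longlonglongrightarrow> l'"
        using sc unfolding seq_compact_def by blast
      define q where "q = r \<circ> r'"
      have q: "strict_mono q" unfolding q_def by (rule strict_mono_o[OF r(1) r'(1)])
      have xl: "(\<lambda>n. x (q n)) \<longlonglongrightarrow> l" using LIMSEQ_subseq_LIMSEQ[OF r(2) r'(1)] by (simp add: q_def o_def)
      have yl: "(\<lambda>n. y (q n)) \<longlonglongrightarrow> l'" using r'(2) by (simp add: q_def o_def)
      have "\<theta> k l = \<theta> k l'" for k
      proof -
        have c: "(\<lambda>n. \<theta> k (z n)) \<longlonglongrightarrow> \<theta> k w" if "z \<longlonglongrightarrow> w" for z :: "nat \<Rightarrow> 'a" and w
          using continuous_on_tendsto_compose[OF cont that] by auto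
        have "(\<lambda>n. a (x (q n)) (y (q n)) k) \<longlonglongrightarrow> a l l' k"
          unfolding a_def by (intro tendsto_intros c xl yl)
        moreover have "(\<lambda>n. a (x (q n)) (y (q n)) k) \<longlonglongrightarrow> 0"
        proof (rule tendsto_sandwich[OF _ _ tendsto_const])
          have "a (x n) (y n) k \<le> 1 / real (Suc n)" for n
          proof -
            have "a (x n) (y n) k \<le> (\<Sum>k. a (x n) (y n) k)"
              using sum_le_suminf[OF sa, of "{k}" "x n" "y n"] a0 by simp
            also have "\<dots> < 1 / real (Suc n)" using xy(1)[of n] by (simp add: d_eq)
            finally show ?thesis by simp
          qed
          then show "\<forall>\<^sub>F n in sequentially. a (x (q n)) (y (q n)) k \<le> 1 / real (Suc (q n))" by simp
          have "(\<lambda>n. 1 / real (Suc n)) \<longlonglongrightarrow> 0" by real_asymp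
          from LIMSEQ_subseq_LIMSEQ[OF this q] show "(\<lambda>n. 1 / real (Suc (q n))) \<longlonglongrightarrow> 0" by (simp add: o_def)
        qed (use a0 in auto)
        ultimately have "a l l' k = 0" by (rule LIMSEQ_unique)
        then show ?thesis by (simp add: a_def)
      qed
      have "l = l'"
      proof (rule ccontr)
        assume "l \<noteq> l'"
        \<comment> \<open>A continuous function with values in the unit interval that separates the
          two points; a \<open>\<theta> k\<close> within \<open>f l' / 2\<close> of it separates
          them too.\<close>
        define f where "f z = min 1 (dist l z)" for z
        have "continuous_on UNIV f" "range f \<subseteq> {0..1}" by (auto simp: f_def intro!: continuous_intros)
        moreover have f: "0 < f l'" "f l = 0" using \<open>l \<noteq> l'\<close> by (auto simp: f_def)
        ultimately obtain k where k: "\<And>z. \<bar>f z - \<theta> k z\<bar> < f l' / 2"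
          using dense unfolding dense_sequence_def by (metis half_gt_zero)
        from k[of l] k[of l'] f \<open>\<And>k. \<theta> k l = \<theta> k l'\<close>[of k] show False by linarith
      qed
      moreover have "(\<lambda>n. dist (x (q n)) (y (q n))) \<longlonglongrightarrow> dist l l'" by (intro tendsto_dist xl yl)
      then have "e \<le> dist l l'" by (rule LIMSEQ_le_const) (use xy(2) in auto)
      ultimately show False using e by simp
    qed
  qed
qed

section \<open>The upper bound\<close>

definition birkhoff_average :: "('a \<Rightarrow> 'a) \<Rightarrow> ('b::finite \<Rightarrow> 'a \<Rightarrow> real) \<Rightarrow> nat \<Rightarrow> 'a \<Rightarrow> real ^ 'b" where
  "birkhoff_average T \<Phi> n x = (\<chi> j. birkhoff_sum T (\<Phi> j) n x / real n)"

text \<open>An infinite sum of nonnegative extended reals is the supremum over finite subfamilies,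
  so a bound for these is enough.\<close>

lemma pressure_sum_le:
  assumes "\<C> \<in> bowen_covers d T Z n \<epsilon>"
    and "\<And>F. finite F \<Longrightarrow> F \<subseteq> \<C> \<Longrightarrow>
      (\<Sum>(l, x)\<in>F. exp (- t * real l + (SUP y\<in>bowen_ball d T l x \<epsilon>. birkhoff_sum T \<psi> l y))) \<le> e"
  shows "pressure_sum d T Z t \<psi> n \<epsilon> \<le> ennreal e"
proof -
  define f where "f = (\<lambda>(l, x). exp (- t * real l + (SUP y\<in>bowen_ball d T l x \<epsilon>. birkhoff_sum T \<psi> l y)))"
  have "pressure_sum d T Z t \<psi> n \<epsilon> \<le> (\<Sum>\<^sub>\<infinity>p\<in>\<C>. ennreal (f p))"
    unfolding pressure_sum_def f_def using assms(1) by (intro INF_lower2[of \<C>]) (auto simp: case_prod_unfold)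
  also have "\<dots> = (SUP F\<in>{F. finite F \<and> F \<subseteq> \<C>}. \<Sum>p\<in>F. ennreal (f p))"
    by (rule nonneg_infsum_complete) simp
  also have "\<dots> \<le> ennreal e"
  proof (rule SUP_least)
    fix F assume F: "F \<in> {F. finite F \<and> F \<subseteq> \<C>}"
    have "(\<Sum>p\<in>F. ennreal (f p)) = ennreal (\<Sum>p\<in>F. f p)"
      by (rule sum_ennreal) (auto simp: f_def case_prod_unfold)
    also have "\<dots> \<le> ennreal e" using assms(2)[of F] F by (intro ennreal_leI) (simp add: f_def)
    finally show "(\<Sum>p\<in>F. ennreal (f p)) \<le> ennreal e" .
  qed
  finally show ?thesis .
qed

lemma pressure_limit_eq_0I:
  assumes "\<And>n e. 0 < e \<Longrightarrow> pressure_sum d T Z t \<psi> n \<epsilon> \<le> ennreal e"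
  shows "pressure_limit d T Z t \<psi> \<epsilon> = 0"
proof -
  have "pressure_sum d T Z t \<psi> n \<epsilon> = 0" for n
  proof (rule antisym)
    show "pressure_sum d T Z t \<psi> n \<epsilon> \<le> 0"
      by (rule ennreal_le_epsilon) (simp add: assms)
  qed simp
  then show ?thesis unfolding pressure_limit_def by (simp add: limI)
qed

context equivalent_metric
begin

text \<open>A separated set of largest size is spanning, since a point outside all the balls could
  be added to it. The bound \<open>b\<close> guarantees that a largest size exists.\<close>

lemma exists_maximal_separated:
  assumes eps: "0 \<le> \<epsilon>" and bound: "\<And>E. finite E \<Longrightarrow> E \<subseteq> S \<Longrightarrow> (\<forall>x\<in>E. \<forall>y\<in>E. x \<noteq> y \<longrightarrow> (\<exists>i<n. \<epsilon> < d ((T ^^ i) x) ((T ^^ i) y))) \<Longrightarrow> real (card E) \<le> b"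
  obtains E where "finite E" "E \<subseteq> S" "real (card E) \<le> b" "S \<subseteq> (\<Union>x\<in>E. bowen_ball d T n x \<epsilon>)"
proof -
  define sep where "sep E \<longleftrightarrow> finite E \<and> E \<subseteq> S \<and> (\<forall>x\<in>E. \<forall>y\<in>E. x \<noteq> y \<longrightarrow> (\<exists>i<n. \<epsilon> < d ((T ^^ i) x) ((T ^^ i) y)))" for E
  have "sep {}" by (simp add: sep_def)
  moreover have "\<forall>E. sep E \<longrightarrow> card E < Suc (nat \<lceil>b\<rceil>)"
  proof (intro allI impI)
    fix E assume "sep E"
    then have "real (card E) \<le> b" by (intro bound) (auto simp: sep_def)
    then show "card E < Suc (nat \<lceil>b\<rceil>)" by linarith
  qed
  ultimately have "\<exists>E. sep E \<and> (\<forall>E'. sep E' \<longrightarrow> card E' \<le> card E)"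
    by (rule ex_has_greatest_nat)
  then obtain E where E: "sep E" "\<forall>E'. sep E' \<longrightarrow> card E' \<le> card E" by blast
  have "S \<subseteq> (\<Union>x\<in>E. bowen_ball d T n x \<epsilon>)"
  proof (rule subsetI, rule ccontr)
    fix z assume z: "z \<in> S" "z \<notin> (\<Union>x\<in>E. bowen_ball d T n x \<epsilon>)"
    then have far: "\<exists>i<n. \<epsilon> < d ((T ^^ i) x) ((T ^^ i) z)" if "x \<in> E" for x
      using that by (auto simp: bowen_ball_def not_le)
    show False
    proof (cases "z \<in> E")
      case True
      then show False using far[OF True] eps by simp
    next
      case False
      have "sep (insert z E)" unfolding sep_def
      proof (intro conjI ballI impI)
        fix x y assume "x \<in> insert z E" "y \<in> insert z E" "x \<noteq> y"
        then consider "x = z" "y \<in> E" | "x \<in> E" "y = z" | "x \<in> E" "y \<in> E" by auto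
        then show "\<exists>i<n. \<epsilon> < d ((T ^^ i) x) ((T ^^ i) y)"
          using far E(1) \<open>x \<noteq> y\<close> by cases (auto simp: sep_def d_sym)
      qed (use E(1) z in \<open>auto simp: sep_def\<close>)
      then have "card (insert z E) \<le> card E" using E(2) by blast
      then show False using False E(1) by (simp add: sep_def)
    qed
  qed
  moreover have "real (card E) \<le> b" using E(1) by (intro bound) (auto simp: sep_def)
  ultimately show ?thesis using that E(1) by (auto simp: sep_def)
qed

text \<open>If no neighbourhood worked, separated sets witnessing this would produce, by
  \<open>misiurewicz\<close>, an invariant measure with integrals \<open>v\<close> and entropy at least \<open>c\<close>.\<close>

lemma separated_card_bound:
  fixes T :: "'a \<Rightarrow> 'a" and \<theta> :: "nat \<Rightarrow> 'a \<Rightarrow> real" and \<Phi> :: "'b::finite \<Rightarrow> 'a \<Rightarrow> real"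
  assumes compact: "compact (UNIV :: 'a set)" and T: "continuous_on UNIV T" and dense: "dense_sequence \<theta>"
    and Phi: "\<And>j. continuous_on UNIV (\<Phi> j)" and eps: "0 < \<epsilon>" and eta: "0 < \<eta>"
    and no_measure: "\<And>\<sigma>. \<sigma> \<in> invariant_measures T \<Longrightarrow> (\<chi> j. integral\<^sup>L \<sigma> (\<Phi> j)) = v \<Longrightarrow> \<not> ereal c \<le> metric_entropy T \<sigma>"
  obtains r N where "0 < r" "r \<le> \<eta>"
    "\<And>n E. N \<le> n \<Longrightarrow> finite E \<Longrightarrow> E \<subseteq> {x. dist (birkhoff_average T \<Phi> n x) v \<le> r} \<Longrightarrow>
      (\<forall>x\<in>E. \<forall>y\<in>E. x \<noteq> y \<longrightarrow> (\<exists>i<n. \<epsilon> < d ((T ^^ i) x) ((T ^^ i) y))) \<Longrightarrow> real (card E) \<le> exp (c * real n)"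
proof (rule ccontr)
  assume not: "\<not> thesis"
  \<comment> \<open>One index controls both the length and the radius, so that the counterexamples
    have lengths tending to infinity and averages tending to \<open>v\<close>, as
    \<open>misiurewicz\<close> requires.\<close>
  define bad where "bad k n E \<longleftrightarrow> Suc k \<le> n \<and> finite E \<and> E \<subseteq> {x. dist (birkhoff_average T \<Phi> n x) v \<le> min \<eta> (1 / real (Suc k))} \<and>
      (\<forall>x\<in>E. \<forall>y\<in>E. x \<noteq> y \<longrightarrow> (\<exists>i<n. \<epsilon> < d ((T ^^ i) x) ((T ^^ i) y))) \<and> exp (c * real n) < real (card E)" for k n E
  have "\<exists>n E. bad k n E" for k
  proof (rule ccontr)
    assume none: "\<nexists>n E. bad k n E"
    have "thesis"
    proof (rule that[of "min \<eta> (1 / real (Suc k))" "Suc k"])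
      fix n E assume "Suc k \<le> n" "finite E" "E \<subseteq> {x. dist (birkhoff_average T \<Phi> n x) v \<le> min \<eta> (1 / real (Suc k))}"
        "\<forall>x\<in>E. \<forall>y\<in>E. x \<noteq> y \<longrightarrow> (\<exists>i<n. \<epsilon> < d ((T ^^ i) x) ((T ^^ i) y))"
      with none show "real (card E) \<le> exp (c * real n)" unfolding bad_def by (meson not_le)
    qed (use eta in auto)
    with not show False by blast
  qed
  then obtain n E where bad: "\<And>k. bad k (n k) (E k)" by metis
  \<comment> \<open>Separation by \<open>\<epsilon>\<close> in \<open>d\<close> becomes separation
    by \<open>e\<close> in \<open>dist\<close>, the form used by \<open>misiurewicz\<close>.\<close>
  obtain e where e: "0 < e" "\<And>x y. dist x y < e \<Longrightarrow> d x y < \<epsilon>" using dist_imp_d[OF eps] by blast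
  have d0: "(\<lambda>k. 1 / real (Suc k)) \<longlonglongrightarrow> 0" by real_asymp
  obtain \<sigma> where sigma: "\<sigma> \<in> invariant_measures T" "\<And>j. integral\<^sup>L \<sigma> (\<Phi> j) = v $ j" "ereal c \<le> metric_entropy T \<sigma>"
  proof (rule misiurewicz[OF compact T dense, where n = n and E = E and e = e and c = c and \<Phi> = \<Phi> and v = "($) v" and \<delta> = "\<lambda>k. 1 / real (Suc k)"])
    show "filterlim n at_top sequentially"
    proof (rule filterlim_at_top_mono[OF filterlim_Suc])
      show "\<forall>\<^sub>F k in sequentially. Suc k \<le> n k" using bad by (simp add: bad_def)
    qed
    show "1 \<le> n k" for k using bad[of k] by (simp add: bad_def)
    show "finite (E k)" for k using bad[of k] by (simp add: bad_def)
    have "0 < real (card (E k))" for k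
      using bad[of k] less_trans[OF exp_gt_zero] unfolding bad_def by blast
    then show "E k \<noteq> {}" for k using card_gt_0_iff[of "E k"] by (metis of_nat_0_less_iff)
    show "exp (c * real (n k)) \<le> real (card (E k))" for k using bad[of k] by (simp add: bad_def)
    show "\<exists>i<n k. e \<le> dist ((T ^^ i) x) ((T ^^ i) y)" if "x \<in> E k" "y \<in> E k" "x \<noteq> y" for k x y
    proof -
      obtain i where i: "i < n k" "\<epsilon> < d ((T ^^ i) x) ((T ^^ i) y)" using bad[of k] \<open>x \<in> E k\<close> \<open>y \<in> E k\<close> \<open>x \<noteq> y\<close> unfolding bad_def by blast
      then have "\<not> dist ((T ^^ i) x) ((T ^^ i) y) < e" using e(2) less_asym by blast
      then show ?thesis using i(1) by (auto simp: not_less)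
    qed
    show "\<bar>birkhoff_sum T (\<Phi> j) (n k) x / real (n k) - v $ j\<bar> \<le> 1 / real (Suc k)" if "x \<in> E k" for k x j
    proof -
      have "\<bar>(birkhoff_average T \<Phi> (n k) x - v) $ j\<bar> \<le> norm (birkhoff_average T \<Phi> (n k) x - v)"
        by (rule component_le_norm_cart)
      also have "\<dots> \<le> 1 / real (Suc k)"
        using bad[of k] \<open>x \<in> E k\<close> unfolding bad_def dist_norm[symmetric] by auto
      finally show ?thesis by (simp add: birkhoff_average_def)
    qed
  qed (use e Phi d0 in auto)
  have "(\<chi> j. integral\<^sup>L \<sigma> (\<Phi> j)) = v" by (simp add: sigma(2))
  with no_measure sigma show False by blast
qed

text \<open>At length \<open>l\<close> the number of points times the weight is at most
  \<open>exp (- \<eta> * l)\<close>, and the lengths from \<open>N\<close> on give a geometric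
  series, with a bound independent of \<open>M\<close>.\<close>

lemma weighted_count_sum:
  fixes a :: "nat \<Rightarrow> 'c \<Rightarrow> real"
  assumes "\<And>l. finite (E l)" and card: "\<And>l. real (card (E l)) \<le> exp (c * real l)"
    and a: "\<And>l x. x \<in> E l \<Longrightarrow> a l x \<le> exp ((- c - \<eta>) * real l)" and eta: "0 < \<eta>"
  shows "(\<Sum>l\<in>{N..<M}. \<Sum>x\<in>E l. a l x) \<le> exp (- \<eta>) ^ N / (1 - exp (- \<eta>))"
proof -
  have q: "0 < exp (- \<eta>)" "exp (- \<eta>) < 1" using eta by auto
  have "(\<Sum>l\<in>{N..<M}. \<Sum>x\<in>E l. a l x) \<le> (\<Sum>l\<in>{N..<M}. exp (- \<eta>) ^ l)"
  proof (rule sum_mono)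
    fix l
    have "(\<Sum>x\<in>E l. a l x) \<le> (\<Sum>x\<in>E l. exp ((- c - \<eta>) * real l))" by (intro sum_mono a)
    also have "\<dots> = real (card (E l)) * exp ((- c - \<eta>) * real l)" by simp
    also have "\<dots> \<le> exp (c * real l) * exp ((- c - \<eta>) * real l)" by (intro mult_right_mono card) simp
    also have "\<dots> = exp (- \<eta>) ^ l" by (simp add: exp_of_nat2_mult[symmetric] exp_add[symmetric] algebra_simps)
    finally show "(\<Sum>x\<in>E l. a l x) \<le> exp (- \<eta>) ^ l" .
  qed
  also have "\<dots> \<le> (\<Sum>l\<in>{N..<N + M}. exp (- \<eta>) ^ l)" using q by (intro sum_mono2) auto
  also have "\<dots> = (\<Sum>l<M. exp (- \<eta>) ^ N * exp (- \<eta>) ^ l)"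
    using sum.shift_bounds_nat_ivl[of "\<lambda>l. exp (- \<eta>) ^ l" 0 N M] by (simp add: lessThan_atLeast0 power_add add.commute mult.commute)
  also have "\<dots> = exp (- \<eta>) ^ N * (\<Sum>l<M. exp (- \<eta>) ^ l)" by (rule sum_distrib_left[symmetric])
  also have "\<dots> \<le> exp (- \<eta>) ^ N * (1 / (1 - exp (- \<eta>)))"
  proof (rule mult_left_mono)
    have "(\<Sum>l<M. exp (- \<eta>) ^ l) \<le> (\<Sum>l. exp (- \<eta>) ^ l)"
      using q by (intro sum_le_suminf summable_geometric) auto
    also have "\<dots> = 1 / (1 - exp (- \<eta>))" using q by (intro suminf_geometric) auto
    finally show "(\<Sum>l<M. exp (- \<eta>) ^ l) \<le> 1 / (1 - exp (- \<eta>))" .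
  qed (use q in auto)
  finally show ?thesis by simp
qed

text \<open>Near \<open>v\<close> the weight per unit of time is about \<open>v $ j0\<close>, so the
  count \<open>exp (c v * l)\<close> is balanced against \<open>t\<close> separately for each
  \<open>v\<close>. The starting length \<open>M i\<close> may depend on the neighbourhood, and so
  the bounds need not be uniform over \<open>D\<close>.\<close>

theorem pressure_limit_eq_0:
  fixes T :: "'a \<Rightarrow> 'a" and \<theta> :: "nat \<Rightarrow> 'a \<Rightarrow> real" and \<Phi> :: "'b::finite \<Rightarrow> 'a \<Rightarrow> real"
  assumes compact: "compact (UNIV :: 'a set)" and T: "continuous_on UNIV T" and dense: "dense_sequence \<theta>"
    and Phi: "\<And>j. continuous_on UNIV (\<Phi> j)" and eps: "0 < \<epsilon>"
    and omega: "\<And>x y. d x y \<le> \<epsilon> \<Longrightarrow> \<bar>\<Phi> j0 x - \<Phi> j0 y\<bar> \<le> \<omega>"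
    and D: "\<And>\<sigma>. \<sigma> \<in> invariant_measures T \<Longrightarrow> (\<chi> j. integral\<^sup>L \<sigma> (\<Phi> j)) \<in> D \<Longrightarrow>
      metric_entropy T \<sigma> + ereal (integral\<^sup>L \<sigma> (\<Phi> j0)) \<le> ereal s"
    and Z: "\<And>x. x \<in> Z \<Longrightarrow> \<exists>v\<in>D. \<exists>r. strict_mono r \<and> (\<lambda>k. birkhoff_average T \<Phi> (r k) x) \<longlonglongrightarrow> v"
    and t: "s + \<omega> < t"
  shows "pressure_limit d T Z t (\<Phi> j0) \<epsilon> = 0"
proof -
  \<comment> \<open>The gap is split in three: one \<open>\<eta>\<close> makes
    \<open>c v + v $ j0\<close> exceed \<open>s\<close>, so that no invariant measure with integrals
    \<open>v\<close> has entropy at least \<open>c v\<close>; one pays for the radius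
    \<open>r \<le> \<eta>\<close>; one is left for geometric decay.\<close>
  define \<eta> where "\<eta> = (t - s - \<omega>) / 3"
  have eta: "0 < \<eta>" using t by (simp add: \<eta>_def)
  define c where "c v = t - \<omega> - v $ j0 - 2 * \<eta>" for v :: "real ^ 'b"
  define good where "good v r N \<longleftrightarrow> 0 < r \<and> r \<le> \<eta> \<and> (\<forall>n E. N \<le> n \<longrightarrow> finite E \<longrightarrow> E \<subseteq> {x. dist (birkhoff_average T \<Phi> n x) v \<le> r} \<longrightarrow>
      (\<forall>x\<in>E. \<forall>y\<in>E. x \<noteq> y \<longrightarrow> (\<exists>i<n. \<epsilon> < d ((T ^^ i) x) ((T ^^ i) y))) \<longrightarrow> real (card E) \<le> exp (c v * real n))" for v r N
  have "\<exists>r N. good v r N" if v: "v \<in> D" for v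
  proof (rule separated_card_bound[OF compact T dense Phi eps eta, where v = v and c = "c v"])
    fix \<sigma> assume sigma: "\<sigma> \<in> invariant_measures T" "(\<chi> j. integral\<^sup>L \<sigma> (\<Phi> j)) = v"
    have "integral\<^sup>L \<sigma> (\<Phi> j0) = v $ j0" using sigma(2) by auto
    then have le: "metric_entropy T \<sigma> + ereal (v $ j0) \<le> ereal s" using D[OF sigma(1)] sigma(2) v by simp
    show "\<not> ereal (c v) \<le> metric_entropy T \<sigma>"
    proof
      assume "ereal (c v) \<le> metric_entropy T \<sigma>"
      then have "ereal (c v) + ereal (v $ j0) \<le> ereal s" using le add_right_mono order.trans by blast
      then show False using eta by (simp add: c_def \<eta>_def field_simps)
    qed
  next
    fix r N assume r: "0 < r" "r \<le> \<eta>" and N: "\<And>n E. N \<le> n \<Longrightarrow> finite E \<Longrightarrow> E \<subseteq> {x. dist (birkhoff_average T \<Phi> n x) v \<le> r} \<Longrightarrow>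
      (\<forall>x\<in>E. \<forall>y\<in>E. x \<noteq> y \<longrightarrow> (\<exists>i<n. \<epsilon> < d ((T ^^ i) x) ((T ^^ i) y))) \<Longrightarrow> real (card E) \<le> exp (c v * real n)"
    have "good v r N" unfolding good_def using r N by blast
    then show "\<exists>r N. good v r N" by blast
  qed
  then obtain r N where rN: "\<And>v. v \<in> D \<Longrightarrow> good v (r v) (N v)" by metis
  obtain V where V: "V \<subseteq> D" "countable V" "D \<subseteq> (\<Union>v\<in>V. ball v (r v))"
  proof -
    have opn: "open B" if "B \<in> (\<lambda>v. ball v (r v)) ` D" for B using that by blast
    obtain \<F> where F: "\<F> \<subseteq> (\<lambda>v. ball v (r v)) ` D" "countable \<F>" "\<Union>\<F> = \<Union>((\<lambda>v. ball v (r v)) ` D)"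
      by (rule Lindelof[OF opn])
    from F(1,2) have "\<exists>V. countable V \<and> V \<subseteq> D \<and> \<F> = (\<lambda>v. ball v (r v)) ` V"
      using countable_subset_image[of \<F> "\<lambda>v. ball v (r v)" D] by blast
    then obtain V where V: "V \<subseteq> D" "countable V" "\<F> = (\<lambda>v. ball v (r v)) ` V" by blast
    have "D \<subseteq> \<Union>((\<lambda>v. ball v (r v)) ` D)"
    proof
      fix v assume v: "v \<in> D"
      then have "v \<in> ball v (r v)" using rN[OF v] by (simp add: good_def)
      with v show "v \<in> \<Union>((\<lambda>v. ball v (r v)) ` D)" by (rule UN_I)
    qed
    then show ?thesis using V F(3) by (intro that[of V]) simp_all
  qed
  show ?thesis
  proof (rule pressure_limit_eq_0I)
    fix n0 :: nat and e :: real assume e: "0 < e"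
    define w where "w = from_nat_into V"
    have "\<exists>K. exp (- \<eta>) ^ K / (1 - exp (- \<eta>)) \<le> e * (1 / 2) ^ Suc i" for i
    proof -
      have "0 < e * (1 / 2) ^ Suc i * (1 - exp (- \<eta>))" "exp (- \<eta>) < 1" using e eta by simp_all
      from real_arch_pow_inv[OF this] obtain K where "exp (- \<eta>) ^ K < e * (1 / 2) ^ Suc i * (1 - exp (- \<eta>))" ..
      then show ?thesis using eta by (intro exI[of _ K]) (simp add: divide_le_eq)
    qed
    then obtain K where K: "\<And>i. exp (- \<eta>) ^ K i / (1 - exp (- \<eta>)) \<le> e * (1 / 2) ^ Suc i" by metis
    \<comment> \<open>From length \<open>M i\<close> on, the \<open>i\<close>-th geometric tail fits
      into its share of \<open>e\<close>, the counting bound holds, and the balls are long enough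
      for the cover.\<close>
    define M where "M i = max (K i) (max (N (w i)) (max 1 n0))" for i
    have M: "exp (- \<eta>) ^ M i / (1 - exp (- \<eta>)) \<le> e * (1 / 2) ^ Suc i" for i
    proof (rule order.trans[OF divide_right_mono K])
      show "exp (- \<eta>) ^ M i \<le> exp (- \<eta>) ^ K i" using eta by (intro power_decreasing) (auto simp: M_def)
    qed (use eta in auto)
    define S where "S i l = {x. dist (birkhoff_average T \<Phi> l x) (w i) \<le> r (w i)}" for i l
    \<comment> \<open>At lengths below \<open>M i\<close> the covering clause is void, so the empty
      set qualifies and \<open>E\<close> is defined for all indices. The guard
      \<open>V \<noteq> {}\<close> is there because \<open>from_nat_into\<close> has no meaning on
      the empty set.\<close>
    define ok where "ok i l E \<longleftrightarrow> finite E \<and> E \<subseteq> S i l \<and> real (card E) \<le> exp (c (w i) * real l) \<and>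
      (M i \<le> l \<longrightarrow> V \<noteq> {} \<longrightarrow> S i l \<subseteq> (\<Union>x\<in>E. bowen_ball d T l x \<epsilon>))" for i l E
    have "\<exists>E. ok i l E" for i l
    proof (cases "M i \<le> l \<and> V \<noteq> {}")
      case True
      then have "w i \<in> D" using V(1) from_nat_into[of V i] by (auto simp: w_def)
      from rN[OF this] have g: "good (w i) (r (w i)) (N (w i))" .
      obtain E where "finite E" "E \<subseteq> S i l" "real (card E) \<le> exp (c (w i) * real l)" "S i l \<subseteq> (\<Union>x\<in>E. bowen_ball d T l x \<epsilon>)"
      proof (rule exists_maximal_separated[where S = "S i l" and n = l and \<epsilon> = \<epsilon> and T = T and b = "exp (c (w i) * real l)"])
        fix E assume "finite E" "E \<subseteq> S i l" "\<forall>x\<in>E. \<forall>y\<in>E. x \<noteq> y \<longrightarrow> (\<exists>i<l. \<epsilon> < d ((T ^^ i) x) ((T ^^ i) y))"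
        moreover have "N (w i) \<le> l" using True by (simp add: M_def)
        ultimately show "real (card E) \<le> exp (c (w i) * real l)" using g unfolding good_def S_def by blast
      qed (use eps in auto)
      then show ?thesis unfolding ok_def by blast
    next
      case False
      then show ?thesis unfolding ok_def by (intro exI[of _ "{}"]) auto
    qed
    then obtain E where E: "\<And>i l. ok i l (E i l)" by metis
    \<comment> \<open>If \<open>V\<close> is empty then so are \<open>D\<close> and
      \<open>Z\<close>, and the empty cover suffices.\<close>
    define \<C> where "\<C> = (if V = {} then {} else (\<Union>i. \<Union>l\<in>{M i..}. {l} \<times> E i l))"
    define a where "a l x = exp (- t * real l + (SUP y\<in>bowen_ball d T l x \<epsilon>. birkhoff_sum T (\<Phi> j0) l y))" for l x
    have cover: "\<C> \<in> bowen_covers d T Z n0 \<epsilon>"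
      unfolding bowen_covers_def
    proof (intro CollectI conjI subsetI)
      have "countable (E i l)" for i l using E[of i l] by (auto simp: ok_def intro: countable_finite)
      then show "countable \<C>" unfolding \<C>_def by auto
      show "\<forall>(l, x)\<in>\<C>. n0 \<le> l" by (auto simp: \<C>_def M_def)
      fix x assume "x \<in> Z"
      then obtain v q where v: "v \<in> D" "strict_mono q" "(\<lambda>k. birkhoff_average T \<Phi> (q k) x) \<longlonglongrightarrow> v" using Z by blast
      then obtain u where u: "u \<in> V" "v \<in> ball u (r u)" using V(3) by blast
      obtain i where i: "w i = u" using from_nat_into_surj[OF V(2) u(1)] by (auto simp: w_def)
      have "eventually (\<lambda>k. birkhoff_average T \<Phi> (q k) x \<in> ball u (r u)) sequentially"
        using topological_tendstoD[OF v(3) open_ball u(2)] .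
      moreover have "eventually (\<lambda>k. M i \<le> q k) sequentially"
        using filterlim_subseq[OF v(2)] by (auto simp: filterlim_at_top)
      ultimately have "eventually (\<lambda>k. birkhoff_average T \<Phi> (q k) x \<in> ball u (r u) \<and> M i \<le> q k) sequentially"
        by (rule eventually_conj)
      then obtain k where k: "birkhoff_average T \<Phi> (q k) x \<in> ball u (r u)" "M i \<le> q k"
        by (auto simp: eventually_sequentially)
      then have "x \<in> S i (q k)" by (simp add: S_def i dist_commute)
      moreover have Vne: "V \<noteq> {}" using u by auto
      ultimately obtain z where "z \<in> E i (q k)" "x \<in> bowen_ball d T (q k) z \<epsilon>"
        using E[of i "q k"] k(2) unfolding ok_def by blast
      then show "x \<in> (\<Union>(l, x)\<in>\<C>. bowen_ball d T l x \<epsilon>)"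
        using k(2) Vne by (intro UN_I[of "(q k, z)"]) (auto simp: \<C>_def)
    qed
    have a_le: "a l x \<le> exp ((- c (w i) - \<eta>) * real l)" if "x \<in> E i l" "V \<noteq> {}" for i l x
    proof -
      have "birkhoff_sum T (\<Phi> j0) l y \<le> real l * (w i $ j0 + \<eta> + \<omega>)" if y: "y \<in> bowen_ball d T l x \<epsilon>" for y
      proof (cases "l = 0")
        case False
        have "birkhoff_sum T (\<Phi> j0) l y \<le> (\<Sum>k<l. \<Phi> j0 ((T ^^ k) x) + \<omega>)"
          unfolding birkhoff_sum_def
        proof (rule sum_mono)
          fix k assume "k \<in> {..<l}"
          then have "d ((T ^^ k) x) ((T ^^ k) y) \<le> \<epsilon>" using y by (simp add: bowen_ball_def)
          from omega[OF this] show "\<Phi> j0 ((T ^^ k) y) \<le> \<Phi> j0 ((T ^^ k) x) + \<omega>" by linarith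
        qed
        also have "\<dots> = real l * (birkhoff_average T \<Phi> l x $ j0 + \<omega>)"
          using False by (simp add: birkhoff_average_def birkhoff_sum_def sum.distrib algebra_simps)
        also have "\<dots> \<le> real l * (w i $ j0 + \<eta> + \<omega>)"
        proof (rule mult_left_mono)
          have "x \<in> S i l" using E[of i l] \<open>x \<in> E i l\<close> by (auto simp: ok_def)
          moreover have "r (w i) \<le> \<eta>" using rN[of "w i"] V(1) from_nat_into[OF \<open>V \<noteq> {}\<close>, of i] unfolding good_def w_def by blast
          ultimately have "norm (birkhoff_average T \<Phi> l x - w i) \<le> \<eta>" by (simp add: S_def dist_norm)
          then have "\<bar>(birkhoff_average T \<Phi> l x - w i) $ j0\<bar> \<le> \<eta>"
            using component_le_norm_cart order.trans by blast
          then show "birkhoff_average T \<Phi> l x $ j0 + \<omega> \<le> w i $ j0 + \<eta> + \<omega>" by simp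
        qed simp
        finally show ?thesis .
      qed (simp add: birkhoff_sum_def)
      then have "(SUP y\<in>bowen_ball d T l x \<epsilon>. birkhoff_sum T (\<Phi> j0) l y) \<le> real l * (w i $ j0 + \<eta> + \<omega>)"
        using eps by (intro cSUP_least) (auto simp: bowen_ball_def intro!: exI[of _ x])
      then have "- t * real l + (SUP y\<in>bowen_ball d T l x \<epsilon>. birkhoff_sum T (\<Phi> j0) l y) \<le> (- c (w i) - \<eta>) * real l"
        by (simp add: c_def algebra_simps)
      then show ?thesis unfolding a_def by simp
    qed
    show "pressure_sum d T Z t (\<Phi> j0) n0 \<epsilon> \<le> ennreal e"
    proof (rule pressure_sum_le[OF cover])
      fix F assume F: "finite F" "F \<subseteq> \<C>"
      show "(\<Sum>(l, x)\<in>F. exp (- t * real l + (SUP y\<in>bowen_ball d T l x \<epsilon>. birkhoff_sum T (\<Phi> j0) l y))) \<le> e"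
      proof (cases "V = {}")
        case True
        then show ?thesis using F e by (simp add: \<C>_def)
      next
        case False
        have "\<forall>p\<in>F. \<exists>i. M i \<le> fst p \<and> snd p \<in> E i (fst p)" using F(2) False by (auto simp: \<C>_def)
        then obtain \<iota> where iota: "\<And>p. p \<in> F \<Longrightarrow> M (\<iota> p) \<le> fst p \<and> snd p \<in> E (\<iota> p) (fst p)" by metis
        \<comment> \<open>The sums serve as upper bounds for the finitely many indices and lengths,
          which places \<open>F\<close> inside a finite triple sum.\<close>
        define I where "I = Suc (\<Sum>p\<in>F. \<iota> p)"
        define L where "L = Suc (\<Sum>p\<in>F. fst p)"
        have I: "\<iota> p < I" "fst p < L" if "p \<in> F" for p
          using that F(1) member_le_sum[of p F \<iota>] member_le_sum[of p F fst] by (auto simp: I_def L_def less_Suc_eq_le)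
        define G where "G = Sigma {..<I} (\<lambda>i. Sigma {M i..<L} (\<lambda>l. E i l))"
        have finE: "finite (E i l)" for i l using E[of i l] by (simp add: ok_def)
        then have finG: "finite G" unfolding G_def by (intro finite_SigmaI) auto
        have sub: "F \<subseteq> (\<lambda>(i, l, x). (l, x)) ` G"
        proof
          fix p assume p: "p \<in> F"
          obtain l x where lx: "p = (l, x)" by (cases p)
          then show "p \<in> (\<lambda>(i, l, x). (l, x)) ` G"
            using iota[OF p] I[OF p] by (intro image_eqI[of _ _ "(\<iota> p, l, x)"]) (auto simp: G_def)
        qed
        have "(\<Sum>(l, x)\<in>F. a l x) \<le> (\<Sum>(l, x)\<in>(\<lambda>(i, l, x). (l, x)) ` G. a l x)"
          using finG sub by (intro sum_mono2) (auto simp: a_def)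
        \<comment> \<open>The same pair may occur for several neighbourhoods, so dropping the index
          need not be injective and gives only an inequality.\<close>
        also have "\<dots> \<le> sum ((\<lambda>(l, x). a l x) \<circ> (\<lambda>(i, l, x). (l, x))) G"
          by (rule sum_image_le[OF finG]) (auto simp: a_def)
        also have "\<dots> = (\<Sum>i<I. \<Sum>l\<in>{M i..<L}. \<Sum>x\<in>E i l. a l x)"
        proof -
          have "(\<Sum>i<I. \<Sum>l\<in>{M i..<L}. \<Sum>x\<in>E i l. a l x) = (\<Sum>i<I. \<Sum>p\<in>Sigma {M i..<L} (E i). a (fst p) (snd p))"
          proof (rule sum.cong[OF refl])
            fix i
            show "(\<Sum>l\<in>{M i..<L}. \<Sum>x\<in>E i l. a l x) = (\<Sum>p\<in>Sigma {M i..<L} (E i). a (fst p) (snd p))"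
              using sum.Sigma[of "{M i..<L}" "E i" a] finE by (simp add: case_prod_unfold)
          qed
          also have "\<dots> = (\<Sum>q\<in>G. a (fst (snd q)) (snd (snd q)))"
            unfolding G_def using finE by (subst sum.Sigma) (auto simp: case_prod_unfold)
          finally show ?thesis by (simp add: case_prod_unfold comp_def)
        qed
        also have "\<dots> \<le> (\<Sum>i<I. e * (1 / 2) ^ Suc i)"
        proof (rule sum_mono)
          fix i
          have "(\<Sum>l\<in>{M i..<L}. \<Sum>x\<in>E i l. a l x) \<le> exp (- \<eta>) ^ M i / (1 - exp (- \<eta>))"
            using E eta by (intro weighted_count_sum[where c = "c (w i)"] a_le False) (auto simp: ok_def)
          with M[of i] show "(\<Sum>l\<in>{M i..<L}. \<Sum>x\<in>E i l. a l x) \<le> e * (1 / 2) ^ Suc i" by linarith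
        qed
        also have "\<dots> \<le> (\<Sum>i. e * (1 / 2) ^ Suc i)"
          using e sums_mult[OF power_half_series, of e] by (intro sum_le_suminf) (auto simp: sums_iff)
        also have "\<dots> = e" using sums_mult[OF power_half_series, of e] by (simp add: sums_iff)
        finally show ?thesis by (simp add: a_def)
      qed
    qed
  qed
qed

end

section \<open>Typical words of product measures\<close>

text \<open>The coordinates of the product measure are independent with law \<open>\<mu>\<close>,
  and the values of \<open>u\<close> lie in an interval of length \<open>2 * B\<close>.\<close>

lemma hoeffding_product:
  fixes \<mu> :: "'a measure" and u :: "'a \<Rightarrow> real"
  assumes mu: "prob_space \<mu>" and u: "u \<in> borel_measurable \<mu>" "\<And>x. \<bar>u x\<bar> \<le> B" "0 < B"
    and K: "1 \<le> K" and tau: "0 \<le> \<tau>"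
  defines "M \<equiv> \<Pi>\<^sub>M j\<in>{..<K}. \<mu>"
  shows "measure M {s \<in> space M. \<tau> \<le> \<bar>(\<Sum>j<K. u (s j)) / real K - integral\<^sup>L \<mu> u\<bar>}
    \<le> 2 * exp (- 2 * real K * \<tau>\<^sup>2 / (2 * B)\<^sup>2)"
proof -
  interpret mu: prob_space \<mu> by fact
  interpret P: finite_product_prob_space "\<lambda>_. \<mu>" "{..<K}" by unfold_locales auto
  have M: "prob_space M" unfolding M_def by (rule P.prob_space_axioms)
  interpret M: prob_space M by (rule M)
  have comp: "distr M \<mu> (\<lambda>s. s j) = \<mu>" if "j < K" for j
    unfolding M_def using that mu by (intro distr_PiM_component) auto
  have mc: "(\<lambda>s. s j) \<in> measurable M \<mu>" if "j < K" for j
    unfolding M_def using that by (intro measurable_component_singleton) auto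
  have "M.indep_vars (\<lambda>_. \<mu>) (\<lambda>j s. s j) {..<K}"
  proof (subst M.indep_vars_iff_distr_eq_PiM')
    have "distr M (\<Pi>\<^sub>M i\<in>{..<K}. \<mu>) (\<lambda>x. \<lambda>i\<in>{..<K}. x i) = distr M M (\<lambda>x. x)"
    proof (rule distr_cong)
      fix x assume "x \<in> space M"
      then have "x \<in> extensional {..<K}" by (auto simp: M_def space_PiM PiE_def)
      then show "(\<lambda>i\<in>{..<K}. x i) = x" by (rule extensional_restrict)
    qed (simp_all add: M_def)
    also have "\<dots> = M" by (rule distr_id)
    also have "\<dots> = (\<Pi>\<^sub>M i\<in>{..<K}. distr M \<mu> (\<lambda>s. s i))"
      unfolding M_def by (intro PiM_cong refl) (simp add: comp[unfolded M_def])
    finally show "distr M (\<Pi>\<^sub>M i\<in>{..<K}. \<mu>) (\<lambda>x. \<lambda>i\<in>{..<K}. x i) = (\<Pi>\<^sub>M i\<in>{..<K}. distr M \<mu> (\<lambda>s. s i))" .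
    show "{..<K} \<noteq> {}" using K by (auto simp: lessThan_empty_iff)
  qed (use mc in auto)
  then have indep: "M.indep_vars (\<lambda>_. borel) (\<lambda>j s. u (s j)) {..<K}"
    by (rule M.indep_vars_compose2) (rule u)
  have distr: "distr M borel (\<lambda>s. u (s j)) = distr \<mu> borel u" if "j < K" for j
    using distr_distr[OF u(1) mc[OF that]] comp[OF that] by (simp add: comp_def)
  have exp: "M.expectation (\<lambda>s. u (s 0)) = integral\<^sup>L \<mu> u"
    using integral_distr[OF mc, of 0 u] comp[of 0] u K by simp
  have m0: "(\<lambda>s. u (s 0)) \<in> borel_measurable M"
    using measurable_compose[OF mc u(1), of 0] K by simp
  interpret iid: Hoeffding_ineq_iid M "{..<K}" "\<lambda>j s. u (s j)" "\<lambda>s. u (s 0)" "- B" B "integral\<^sup>L \<mu> u"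
  proof unfold_locales
    show "AE s in M. u (s 0) \<in> {- B..B}" using u(2) by (auto simp: abs_le_iff minus_le_iff)
  qed (use indep distr K m0 exp in auto)
  have "M.prob {s \<in> space M. \<tau> \<le> \<bar>(\<Sum>j<K. u (s j)) / real (card {..<K}) - integral\<^sup>L \<mu> u\<bar>}
    \<le> 2 * exp (- 2 * real (card {..<K}) * \<tau>\<^sup>2 / (B - - B)\<^sup>2)"
    using K u(3) by (intro iid.Hoeffding_ineq_abs_ge'[OF tau]) (auto simp: lessThan_empty_iff)
  then show ?thesis by simp
qed

text \<open>The exceptional probabilities decay exponentially in \<open>K\<close>, so a union bound
  over the finite index set makes them small together.\<close>

lemma law_of_large_numbers_product:
  fixes \<mu> :: "'a measure" and u :: "'i \<Rightarrow> 'a \<Rightarrow> real"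
  assumes mu: "prob_space \<mu>" and I: "finite I" and u: "\<And>i. i \<in> I \<Longrightarrow> u i \<in> borel_measurable \<mu>"
    "\<And>i. i \<in> I \<Longrightarrow> \<exists>B. \<forall>x. \<bar>u i x\<bar> \<le> B" and tau: "0 < \<tau>"
  shows "eventually (\<lambda>K. 1 / 2 \<le> measure (\<Pi>\<^sub>M j\<in>{..<K}. \<mu>)
    {s \<in> space (\<Pi>\<^sub>M j\<in>{..<K}. \<mu>). \<forall>i\<in>I. \<bar>(\<Sum>j<K. u i (s j)) / real K - integral\<^sup>L \<mu> (u i)\<bar> < \<tau>}) sequentially"
proof -
  have "\<exists>B. 0 < B \<and> (\<forall>x. \<bar>u i x\<bar> \<le> B)" if i: "i \<in> I" for i
  proof -
    obtain B where "\<forall>x. \<bar>u i x\<bar> \<le> B" using u(2)[OF i] by blast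
    then have "\<forall>x. \<bar>u i x\<bar> \<le> max 1 B" by (meson max.coboundedI2)
    then show ?thesis by (intro exI[of _ "max 1 B"]) auto
  qed
  then obtain B where B: "\<And>i. i \<in> I \<Longrightarrow> 0 < B i" "\<And>i x. i \<in> I \<Longrightarrow> \<bar>u i x\<bar> \<le> B i" by metis
  have "(\<lambda>K. \<Sum>i\<in>I. 2 * exp (- 2 * real K * \<tau>\<^sup>2 / (2 * B i)\<^sup>2)) \<longlonglongrightarrow> (\<Sum>i\<in>I. 0)"
  proof (rule tendsto_sum)
    fix i assume i: "i \<in> I"
    define c where "c = 2 * \<tau>\<^sup>2 / (2 * B i)\<^sup>2"
    have "c > 0" using tau B(1)[OF i] by (simp add: c_def)
    then have "(\<lambda>K. 2 * exp (- c * real K)) \<longlonglongrightarrow> 0" by real_asymp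
    then show "(\<lambda>K. 2 * exp (- 2 * real K * \<tau>\<^sup>2 / (2 * B i)\<^sup>2)) \<longlonglongrightarrow> 0" by (simp add: c_def mult_ac)
  qed
  then have "eventually (\<lambda>K. (\<Sum>i\<in>I. 2 * exp (- 2 * real K * \<tau>\<^sup>2 / (2 * B i)\<^sup>2)) < 1 / 2) sequentially"
    by (intro order_tendstoD(2)) auto
  then show ?thesis using eventually_ge_at_top[of 1]
  proof eventually_elim
    case (elim K)
    define M where "M = (\<Pi>\<^sub>M j\<in>{..<K}. \<mu>)"
    interpret M: prob_space M unfolding M_def using mu by (intro prob_space_PiM)
    define bad where "bad i = {s \<in> space M. \<tau> \<le> \<bar>(\<Sum>j<K. u i (s j)) / real K - integral\<^sup>L \<mu> (u i)\<bar>}" for i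
    have mc: "(\<lambda>s. s j) \<in> measurable M \<mu>" if "j < K" for j
      unfolding M_def using that by (intro measurable_component_singleton) auto
    have meas: "bad i \<in> sets M" if i: "i \<in> I" for i
    proof -
      have "(\<lambda>s. \<bar>(\<Sum>j<K. u i (s j)) / real K - integral\<^sup>L \<mu> (u i)\<bar>) \<in> borel_measurable M"
        using measurable_compose[OF mc u(1)[OF i]]
        by (intro borel_measurable_abs borel_measurable_diff borel_measurable_divide borel_measurable_sum borel_measurable_const) auto
      then show ?thesis unfolding bad_def by (intro borel_measurable_le) auto
    qed
    have "measure M (\<Union>i\<in>I. bad i) \<le> (\<Sum>i\<in>I. measure M (bad i))"
      using I meas by (intro M.finite_measure_subadditive_finite) auto
    also have "\<dots> \<le> (\<Sum>i\<in>I. 2 * exp (- 2 * real K * \<tau>\<^sup>2 / (2 * B i)\<^sup>2))"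
      unfolding bad_def M_def using mu u B elim tau by (intro sum_mono hoeffding_product) auto
    finally have "measure M (\<Union>i\<in>I. bad i) \<le> 1 / 2" using elim by simp
    moreover have "{s \<in> space M. \<forall>i\<in>I. \<bar>(\<Sum>j<K. u i (s j)) / real K - integral\<^sup>L \<mu> (u i)\<bar> < \<tau>} = space M - (\<Union>i\<in>I. bad i)"
      by (auto simp: bad_def not_le)
    moreover have "(\<Union>i\<in>I. bad i) \<in> sets M" using I meas by (intro sets.finite_UN) auto
    ultimately show ?case
      using M.prob_compl[of "\<Union>i\<in>I. bad i"] unfolding M_def[symmetric] by simp
  qed
qed

text \<open>The information \<open>inf x = - ln (p (F x))\<close> has integral
  \<open>ent \<mu> F\<close>, and for positive letter probabilities its sum along a sample is minus
  the logarithm of the measure of all samples with the same name. The law of large numbers thus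
  gives every typical name measure at most \<open>exp (- (K * (ent \<mu> F - \<tau>)))\<close>,
  while the typical samples have mass at least one half.\<close>

lemma many_typical_names:
  fixes \<mu> :: "'a measure" and u :: "'i \<Rightarrow> 'a \<Rightarrow> real" and F :: "'a \<Rightarrow> 'w"
  assumes mu: "prob_space \<mu>" "space \<mu> = UNIV" and I: "finite I" and u: "\<And>i. i \<in> I \<Longrightarrow> u i \<in> borel_measurable \<mu>"
    "\<And>i. i \<in> I \<Longrightarrow> \<exists>B. \<forall>x. \<bar>u i x\<bar> \<le> B" and tau: "0 < \<tau>"
    and F: "simple_function \<mu> F"
  shows "eventually (\<lambda>K. \<exists>G. (\<forall>s\<in>G. \<forall>i\<in>I. \<bar>(\<Sum>j<K. u i (s j)) / real K - integral\<^sup>L \<mu> (u i)\<bar> < \<tau>) \<and>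
    exp (real K * (ent \<mu> F - \<tau>)) / 2 \<le> real (card ((\<lambda>s. map (\<lambda>j. F (s j)) [0..<K]) ` G))) sequentially"
proof -
  interpret mu: prob_space \<mu> by (rule mu)
  define p where "p v = measure \<mu> (F -` {v})" for v
  have finF: "finite (range F)" and measF: "F -` {v} \<in> sets \<mu>" for v
    using simple_functionD(1)[OF F] simple_functionD(2)[OF F, of "{v}"] by (auto simp: mu(2))
  define inf where "inf x = - ln (p (F x))" for x
  have inf_eq: "inf = (\<lambda>x. \<Sum>v\<in>range F. - ln (p v) * indicator (F -` {v}) x)"
  proof
    fix x
    have "(\<Sum>v\<in>range F. - ln (p v) * indicator (F -` {v}) x) = (\<Sum>v\<in>{F x}. - ln (p v) * indicator (F -` {v}) x)"
      using finF by (intro sum.mono_neutral_right) (auto simp: indicator_def)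
    then show "inf x = (\<Sum>v\<in>range F. - ln (p v) * indicator (F -` {v}) x)" by (simp add: inf_def)
  qed
  have inf_meas: "inf \<in> borel_measurable \<mu>"
    unfolding inf_eq using measF by (intro borel_measurable_sum borel_measurable_times borel_measurable_const borel_measurable_indicator)
  have inf_bdd: "\<exists>B. \<forall>x. \<bar>inf x\<bar> \<le> B"
  proof (intro exI allI)
    fix x show "\<bar>inf x\<bar> \<le> (\<Sum>v\<in>range F. \<bar>ln (p v)\<bar>)"
      using member_le_sum[of "F x" "range F" "\<lambda>v. \<bar>ln (p v)\<bar>"] finF by (simp add: inf_def)
  qed
  have inf_int: "integral\<^sup>L \<mu> inf = ent \<mu> F"
    unfolding inf_eq using measF
    by (subst Bochner_Integration.integral_sum) (auto simp: ent_def mu(2) eta_def p_def less_top[symmetric] mult.commute intro!: sum.cong)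
  \<comment> \<open>\<open>None\<close> adds the information function to the observables, so that
    one application of the law of large numbers handles all of them.\<close>
  define J where "J = insert None (Some ` I)"
  define w where "w i = (case i of None \<Rightarrow> inf | Some i \<Rightarrow> u i)" for i
  have "eventually (\<lambda>K. 1 / 2 \<le> measure (\<Pi>\<^sub>M j\<in>{..<K}. \<mu>)
    {s \<in> space (\<Pi>\<^sub>M j\<in>{..<K}. \<mu>). \<forall>i\<in>J. \<bar>(\<Sum>j<K. w i (s j)) / real K - integral\<^sup>L \<mu> (w i)\<bar> < \<tau>}) sequentially"
  proof (rule law_of_large_numbers_product[OF mu(1) _ _ _ tau])
    show "finite J" using I by (simp add: J_def)
    fix i assume i: "i \<in> J"
    show "w i \<in> borel_measurable \<mu>" using i inf_meas u(1) by (auto simp: J_def w_def)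
    show "\<exists>B. \<forall>x. \<bar>w i x\<bar> \<le> B"
    proof (cases i)
      case None
      then show ?thesis using inf_bdd by (simp add: w_def)
    next
      case (Some k)
      then have "k \<in> I" using i by (auto simp: J_def)
      from u(2)[OF this] show ?thesis by (simp add: w_def Some)
    qed
  qed
  then show ?thesis using eventually_ge_at_top[of 1]
  proof eventually_elim
    case (elim K)
    define M where "M = (\<Pi>\<^sub>M j\<in>{..<K}. \<mu>)"
    interpret P: finite_product_prob_space "\<lambda>_. \<mu>" "{..<K}" by unfold_locales auto
    interpret M: prob_space M unfolding M_def by (rule P.prob_space_axioms)
    define G where "G = {s \<in> space M. \<forall>i\<in>J. \<bar>(\<Sum>j<K. w i (s j)) / real K - integral\<^sup>L \<mu> (w i)\<bar> < \<tau>}"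
    define name where "name s = map (\<lambda>j. F (s j)) [0..<K]" for s :: "nat \<Rightarrow> 'a"
    have G: "1 / 2 \<le> measure M G" using elim by (simp add: G_def M_def)
    have "name ` G \<subseteq> {xs. set xs \<subseteq> range F \<and> length xs = K}" by (auto simp: name_def)
    then have fin: "finite (name ` G)" using finite_lists_length_eq[OF finF] finite_subset by blast
    define cls where "cls v = {s \<in> space M. name s = v}" for v
    have cls_eq: "cls v = (\<Pi>\<^sub>E j\<in>{..<K}. F -` {v ! j})" if "length v = K" for v
      using that by (auto simp: cls_def name_def M_def space_PiM mu(2) list_eq_iff_nth_eq PiE_def Pi_def)
    have len: "length v = K" if "v \<in> name ` G" for v using that by (auto simp: name_def)
    have cls_meas: "cls v \<in> sets M" if "v \<in> name ` G" for v
      unfolding cls_eq[OF len[OF that]] M_def using measF by (intro sets_PiM_I_finite) auto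
    have cls_le: "measure M (cls v) \<le> exp (- (real K * (ent \<mu> F - \<tau>)))" if v: "v \<in> name ` G" for v
    proof -
      obtain s where s: "s \<in> G" "v = name s" using v by auto
      have eq: "measure M (cls v) = (\<Prod>j<K. p (F (s j)))"
        unfolding cls_eq[OF len[OF v]] M_def using measF P.prob_times[of "\<lambda>j. F -` {v ! j}"] s(2)
        by (simp add: p_def name_def)
      \<comment> \<open>With \<open>ln 0 = 0\<close> the information of a letter of probability 0 is
        0 instead of infinite, so names containing such a letter are treated apart; their classes
        are null.\<close>
      show ?thesis
      proof (cases "\<exists>j<K. p (F (s j)) = 0")
        case True
        then have "(\<Prod>j<K. p (F (s j))) = 0" by (intro prod_zero) auto
        then show ?thesis unfolding eq by (simp only: exp_ge_zero)
      next
        case False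
        then have pos: "0 < p (F (s j))" if "j < K" for j
          using that measure_nonneg[of \<mu> "F -` {F (s j)}"] by (metis less_le p_def)
        have "measure M (cls v) = (\<Prod>j<K. exp (- inf (s j)))"
          unfolding eq by (rule prod.cong) (auto simp: inf_def pos)
        also have "\<dots> = exp (- (\<Sum>j<K. inf (s j)))" by (simp add: exp_sum[symmetric] sum_negf)
        also have "\<dots> \<le> exp (- (real K * (ent \<mu> F - \<tau>)))"
        proof -
          have "\<bar>(\<Sum>j<K. inf (s j)) / real K - ent \<mu> F\<bar> < \<tau>"
            using s(1) inf_int by (auto simp: G_def J_def w_def)
          then have "ent \<mu> F - \<tau> \<le> (\<Sum>j<K. inf (s j)) / real K" by linarith
          then have "real K * (ent \<mu> F - \<tau>) \<le> real K * ((\<Sum>j<K. inf (s j)) / real K)" by (rule mult_left_mono) simp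
          also have "\<dots> = (\<Sum>j<K. inf (s j))" using elim by simp
          finally show ?thesis by simp
        qed
        finally show ?thesis .
      qed
    qed
    have "measure M G \<le> measure M (\<Union>v\<in>name ` G. cls v)"
      using fin cls_meas by (intro M.finite_measure_mono sets.finite_UN) (auto simp: cls_def G_def)
    also have "\<dots> \<le> (\<Sum>v\<in>name ` G. measure M (cls v))"
      using fin cls_meas by (intro M.finite_measure_subadditive_finite) auto
    also have "\<dots> \<le> (\<Sum>v\<in>name ` G. exp (- (real K * (ent \<mu> F - \<tau>))))" by (intro sum_mono cls_le)
    finally have "1 / 2 \<le> real (card (name ` G)) * exp (- (real K * (ent \<mu> F - \<tau>)))" using G by simp
    then have "exp x / 2 \<le> exp x * (real (card (name ` G)) * exp (- x))" if "x = real K * (ent \<mu> F - \<tau>)" for x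
      using mult_left_mono[of "1 / 2" _ "exp x"] that by simp
    then have "exp (real K * (ent \<mu> F - \<tau>)) / 2 \<le> real (card (name ` G))"
      using mult_exp_exp[of "real K * (ent \<mu> F - \<tau>)" "- (real K * (ent \<mu> F - \<tau>))"]
      by (simp only: mult.left_commute[of "exp _"] add.right_inverse exp_zero mult_1_right)
    moreover have "\<forall>s\<in>G. \<forall>i\<in>I. \<bar>(\<Sum>j<K. u i (s j)) / real K - integral\<^sup>L \<mu> (u i)\<bar> < \<tau>"
      by (auto simp: G_def J_def w_def)
    ultimately show ?case unfolding name_def by blast
  qed
qed

section \<open>Hamming balls and separated codes\<close>

definition hamming :: "'w list \<Rightarrow> 'w list \<Rightarrow> nat" where
  "hamming v w = card {i. i < length v \<and> v ! i \<noteq> w ! i}"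

lemma hamming_Cons: "hamming (a # v) (b # w) = (if a = b then 0 else 1) + hamming v w"
proof -
  have "{i. i < length (a # v) \<and> (a # v) ! i \<noteq> (b # w) ! i}
    = (if a = b then {} else {0}) \<union> Suc ` {i. i < length v \<and> v ! i \<noteq> w ! i}" (is "?A = ?B")
  proof (intro set_eqI)
    fix i show "i \<in> ?A \<longleftrightarrow> i \<in> ?B" by (cases i) auto
  qed
  then show ?thesis
    unfolding hamming_def by (subst \<open>?A = ?B\<close>, subst card_Un_disjoint) (auto simp: card_image)
qed

text \<open>The generating function of the Hamming distance to \<open>w\<close> factorises over the letters.\<close>

lemma hamming_generating_sum:
  assumes P: "finite P" and a: "0 \<le> a"
  shows "w \<in> words P N \<Longrightarrow> (\<Sum>v\<in>words P N. a ^ hamming v w) \<le> (1 + real (card P) * a) ^ N"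
proof (induction N arbitrary: w)
  case 0
  have "words P 0 = {[]}" by (auto simp: words_def)
  then show ?case by (simp add: hamming_def)
next
  case (Suc N)
  obtain b w' where w: "w = b # w'" "b \<in> P" "w' \<in> words P N"
    using Suc.prems by (cases w) (auto simp: words_def)
  have eq: "words P (Suc N) = (\<lambda>(c, v). c # v) ` (P \<times> words P N)"
  proof (intro equalityI subsetI)
    fix x assume "x \<in> words P (Suc N)"
    then show "x \<in> (\<lambda>(c, v). c # v) ` (P \<times> words P N)" by (cases x) (auto simp: words_def)
  qed (auto simp: words_def)
  have "(\<Sum>v\<in>words P (Suc N). a ^ hamming v w) = (\<Sum>(c, v)\<in>P \<times> words P N. a ^ hamming (c # v) w)"
    unfolding eq by (subst sum.reindex) (auto simp: inj_on_def case_prod_unfold)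
  also have "\<dots> = (\<Sum>c\<in>P. \<Sum>v\<in>words P N. a ^ hamming (c # v) w)" by (simp add: sum.cartesian_product)
  also have "\<dots> = (\<Sum>c\<in>P. (if c = b then 1 else a) * (\<Sum>v\<in>words P N. a ^ hamming v w'))"
    unfolding sum_distrib_left by (intro sum.cong refl) (auto simp: w(1) hamming_Cons)
  also have "\<dots> = (\<Sum>c\<in>P. if c = b then 1 else a) * (\<Sum>v\<in>words P N. a ^ hamming v w')" by (rule sum_distrib_right[symmetric])
  also have "\<dots> \<le> (1 + real (card P) * a) * (1 + real (card P) * a) ^ N"
  proof (rule mult_mono)
    have "(\<Sum>c\<in>P. if c = b then 1 else a) \<le> (\<Sum>c\<in>P. (if c = b then 1 else 0) + a)" using a by (intro sum_mono) auto
    also have "\<dots> = 1 + real (card P) * a" using w(2) P by (simp add: sum.distrib)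
    finally show "(\<Sum>c\<in>P. if c = b then 1 else a) \<le> 1 + real (card P) * a" .
    show "(\<Sum>v\<in>words P N. a ^ hamming v w') \<le> (1 + real (card P) * a) ^ N" by (rule Suc.IH[OF w(3)])
  qed (use a in \<open>auto intro!: sum_nonneg\<close>)
  finally show ?case by simp
qed

text \<open>A Chernoff bound: with weight \<open>a\<close> per differing letter, every word of the
  ball contributes at least \<open>exp (- (\<kappa> / 2 * N))\<close> to the generating sum, whose
  total is at most \<open>exp (\<kappa> / 2 * N)\<close>.\<close>

lemma hamming_ball_bound:
  assumes P: "finite P" and kappa: "0 < \<kappa>"
  obtains \<delta> where "0 < \<delta>" "\<And>N w. w \<in> words P N \<Longrightarrow>
    real (card {v \<in> words P N. real (hamming v w) < \<delta> * real N}) \<le> exp (\<kappa> * real N)"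
proof -
  define r where "r = real (card P)"
  have r: "0 \<le> r" by (simp add: r_def)
  \<comment> \<open>The weight \<open>a\<close> makes the growth \<open>1 + r * a\<close> per letter
    at most \<open>exp (\<kappa> / 2)\<close>; \<open>\<delta>\<close> is then the proportion for
    which \<open>a\<close> to the power \<open>\<delta> * N\<close> equals
    \<open>exp (- (\<kappa> / 2 * N))\<close>.\<close>
  define a where "a = \<kappa> / (2 * (r + 1 + \<kappa>))"
  have a: "0 < a" "a < 1" "r * a \<le> \<kappa> / 2" using kappa r by (auto simp: a_def field_simps)
  define \<delta> where "\<delta> = \<kappa> / (2 * (- ln a))"
  have lna: "0 < - ln a" using a by simp
  have delta: "0 < \<delta>" using kappa lna unfolding \<delta>_def by (intro divide_pos_pos) auto
  have "real (card {v \<in> words P N. real (hamming v w) < \<delta> * real N}) \<le> exp (\<kappa> * real N)" if w: "w \<in> words P N" for N w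
  proof -
    define B where "B = {v \<in> words P N. real (hamming v w) < \<delta> * real N}"
    have fin: "finite B" using finite_words[OF P] by (simp add: B_def)
    have "real (card B) * exp (- (\<kappa> / 2 * real N)) = (\<Sum>v\<in>B. exp (- (\<kappa> / 2 * real N)))" by simp
    also have "\<dots> \<le> (\<Sum>v\<in>B. a ^ hamming v w)"
    proof (rule sum_mono)
      fix v assume "v \<in> B"
      then have "real (hamming v w) * (- ln a) \<le> \<delta> * real N * (- ln a)"
        using lna by (intro mult_right_mono) (auto simp: B_def)
      also have "\<dots> = \<kappa> / 2 * real N" using lna by (simp add: \<delta>_def)
      finally have "exp (- (\<kappa> / 2 * real N)) \<le> exp (real (hamming v w) * ln a)" by simp
      also have "\<dots> = a ^ hamming v w" using a by (simp add: exp_of_nat_mult)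
      finally show "exp (- (\<kappa> / 2 * real N)) \<le> a ^ hamming v w" .
    qed
    also have "\<dots> \<le> (\<Sum>v\<in>words P N. a ^ hamming v w)"
      using finite_words[OF P] a by (intro sum_mono2) (auto simp: B_def)
    also have "\<dots> \<le> (1 + r * a) ^ N" unfolding r_def using a by (intro hamming_generating_sum P w) auto
    also have "\<dots> \<le> exp (\<kappa> / 2) ^ N"
      using a r by (intro power_mono order.trans[OF exp_ge_add_one_self[of "r * a"]]) auto
    also have "\<dots> = exp (\<kappa> / 2 * real N)" by (rule exp_of_nat2_mult[symmetric])
    finally have "real (card B) \<le> exp (\<kappa> / 2 * real N) * exp (\<kappa> / 2 * real N)"
      by (simp add: exp_minus field_simps)
    then show ?thesis by (simp add: B_def exp_add[symmetric])
  qed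
  with delta that show ?thesis by blast
qed

text \<open>The Gilbert-Varshamov argument: the neighbourhoods of a largest separated set cover
  \<open>W\<close>, and each contains at most \<open>b\<close> elements.\<close>

lemma exists_separated_subset:
  assumes fin: "finite W" and refl: "\<And>v. v \<in> W \<Longrightarrow> R v v" and sym: "\<And>v w. R v w \<Longrightarrow> R w v"
    and ball: "\<And>w. w \<in> W \<Longrightarrow> real (card {v \<in> W. R v w}) \<le> b"
  obtains S where "S \<subseteq> W" "real (card W) \<le> real (card S) * b" "\<And>v w. v \<in> S \<Longrightarrow> w \<in> S \<Longrightarrow> v \<noteq> w \<Longrightarrow> \<not> R v w"
proof -
  define sep where "sep S \<longleftrightarrow> S \<subseteq> W \<and> (\<forall>v\<in>S. \<forall>w\<in>S. v \<noteq> w \<longrightarrow> \<not> R v w)" for S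
  have "\<exists>S. sep S \<and> (\<forall>S'. sep S' \<longrightarrow> card S' \<le> card S)"
  proof (rule ex_has_greatest_nat)
    show "sep {}" by (simp add: sep_def)
    show "\<forall>S. sep S \<longrightarrow> card S < Suc (card W)" using card_mono[OF fin] by (auto simp: sep_def less_Suc_eq_le)
  qed
  then obtain S where S: "sep S" "\<And>S'. sep S' \<Longrightarrow> card S' \<le> card S" by blast
  have finS: "finite S" using S(1) fin finite_subset by (auto simp: sep_def)
  have "W \<subseteq> (\<Union>w\<in>S. {v \<in> W. R v w})"
  proof
    fix v assume v: "v \<in> W"
    show "v \<in> (\<Union>w\<in>S. {v \<in> W. R v w})"
    proof (rule ccontr)
      assume "v \<notin> (\<Union>w\<in>S. {v \<in> W. R v w})"
      then have none: "\<not> R v w" if "w \<in> S" for w using that v by auto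
      then have "v \<notin> S" using refl[OF v] by blast
      have "sep (insert v S)" using S(1) v none sym unfolding sep_def by blast
      from S(2)[OF this] show False using \<open>v \<notin> S\<close> finS by simp
    qed
  qed
  then have "card W \<le> card (\<Union>w\<in>S. {v \<in> W. R v w})" using finS fin by (intro card_mono) auto
  also have "\<dots> \<le> (\<Sum>w\<in>S. card {v \<in> W. R v w})" by (rule card_UN_le[OF finS])
  finally have "real (card W) \<le> (\<Sum>w\<in>S. real (card {v \<in> W. R v w}))" by (simp flip: of_nat_sum)
  also have "\<dots> \<le> (\<Sum>w\<in>S. b)" using S(1) by (intro sum_mono ball) (auto simp: sep_def)
  finally show ?thesis using that[of S] S(1) by (auto simp: sep_def)
qed

section \<open>Shadowing prescribed orbit segments\<close>

text \<open>Inner regularity. The induction over the Borel sets carries approximation from outside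
  as well, since complements exchange the two sides.\<close>

lemma closed_inner_approx:
  fixes \<mu> :: "'a::metric_space measure"
  assumes mu: "finite_measure \<mu>" "sets \<mu> = sets borel" and A: "A \<in> sets borel" and e: "0 < e"
  obtains C where "closed C" "C \<subseteq> A" "measure \<mu> (A - C) < e"
proof -
  interpret finite_measure \<mu> by fact
  have sp: "space \<mu> = UNIV" using sets_eq_imp_space_eq[OF mu(2)] by simp
  define R where "R A \<longleftrightarrow> (\<forall>e>0. \<exists>C U. closed C \<and> open U \<and> C \<subseteq> A \<and> A \<subseteq> U \<and> measure \<mu> (U - C) < e)" for A
  have RI: "R A" if "\<And>e. 0 < e \<Longrightarrow> \<exists>C U. closed C \<and> open U \<and> C \<subseteq> A \<and> A \<subseteq> U \<and> measure \<mu> (U - C) < e" for A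
    using that unfolding R_def by simp
  have RD: "\<exists>C U. closed C \<and> open U \<and> C \<subseteq> A \<and> A \<subseteq> U \<and> measure \<mu> (U - C) < e" if "R A" "0 < e" for A e
    using that unfolding R_def by simp
  have "A \<in> sigma_sets UNIV (Collect closed)" using A by (simp add: borel_eq_closed)
  then have "R A"
  proof (induction rule: sigma_sets.induct)
    case (Basic F)
    then have F: "closed F" by simp
    show ?case
    proof (rule RI)
      fix e :: real assume e: "0 < e"
      obtain v :: "'a \<Rightarrow> real" where v: "continuous_on UNIV v" "\<And>x. 0 \<le> v x" "\<And>x. v x \<le> 1" "\<And>x. 0 < v x \<longleftrightarrow> x \<in> - F"
        using open_eq_support[of "- F"] F by auto
      define U where "U n = {x. v x < 1 / real (Suc n)}" for n
      have U_open: "open (U n)" for n unfolding U_def by (intro open_Collect_less v continuous_intros)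
      have U_sets: "range U \<subseteq> sets \<mu>" using U_open mu by auto
      have "decseq U"
        unfolding decseq_def U_def by (auto intro: less_le_trans simp: frac_le)
      then have "(\<lambda>n. measure \<mu> (U n)) \<longlonglongrightarrow> measure \<mu> (\<Inter>n. U n)"
        by (intro finite_Lim_measure_decseq U_sets)
      also have "(\<Inter>n. U n) = F"
      proof (intro equalityI subsetI)
        fix x assume x: "x \<in> (\<Inter>n. U n)"
        show "x \<in> F"
        proof (rule ccontr)
          assume "x \<notin> F"
          then have "0 < v x" using v(4) by simp
          then obtain n where "1 / real (Suc n) < v x" using nat_approx_posE by blast
          moreover have "v x < 1 / real (Suc n)" using x by (simp add: U_def)
          ultimately show False by simp
        qed
      next
        fix x assume "x \<in> F"
        then have "v x = 0" using v(4)[of x] v(2)[of x] by (auto simp: less_le)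
        then show "x \<in> (\<Inter>n. U n)" by (simp add: U_def)
      qed
      finally have "eventually (\<lambda>n. measure \<mu> (U n) < measure \<mu> F + e) sequentially"
        using e by (intro order_tendstoD(2)) auto
      then obtain n where n: "measure \<mu> (U n) < measure \<mu> F + e" by (auto simp: eventually_sequentially)
      have "F \<subseteq> U n" using \<open>(\<Inter>n. U n) = F\<close> by auto
      moreover have "measure \<mu> (U n - F) = measure \<mu> (U n) - measure \<mu> F"
        using F mu U_sets \<open>F \<subseteq> U n\<close> by (intro finite_measure_Diff) auto
      ultimately show "\<exists>C U. closed C \<and> open U \<and> C \<subseteq> F \<and> F \<subseteq> U \<and> measure \<mu> (U - C) < e"
        using F U_open[of n] n by (intro exI[of _ F] exI[of _ "U n"]) auto
    qed
  next
    case Empty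
    show ?case
    proof (rule RI)
      fix e :: real assume "0 < e"
      then show "\<exists>C U. closed C \<and> open U \<and> C \<subseteq> {} \<and> {} \<subseteq> U \<and> measure \<mu> (U - C) < e"
        by (intro exI[of _ "{}"] conjI) simp_all
    qed
  next
    case (Compl A)
    show ?case
    proof (rule RI)
      fix e :: real assume "0 < e"
      with Compl.IH obtain C U where CU: "closed C" "open U" "C \<subseteq> A" "A \<subseteq> U" "measure \<mu> (U - C) < e"
        using RD by meson
      have "- C - - U = U - C" by auto
      with CU have "closed (- U)" "open (- C)" "- U \<subseteq> UNIV - A" "UNIV - A \<subseteq> - C" "measure \<mu> (- C - - U) < e" by auto
      then show "\<exists>C U. closed C \<and> open U \<and> C \<subseteq> UNIV - A \<and> UNIV - A \<subseteq> U \<and> measure \<mu> (U - C) < e"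
        by blast
    qed
  next
    case (Union A)
    show ?case
    proof (rule RI)
      fix e :: real assume e: "0 < e"
      have "\<exists>C U. closed C \<and> open U \<and> C \<subseteq> A i \<and> A i \<subseteq> U \<and> measure \<mu> (U - C) < e / 2 * (1 / 2) ^ Suc i" for i
      proof -
        have "0 < e / 2 * (1 / 2) ^ Suc i" using e by simp
        with Union.IH[of i] show ?thesis by (rule RD)
      qed
      then obtain C U where CU: "\<And>i. closed (C i)" "\<And>i. open (U i)" "\<And>i. C i \<subseteq> A i" "\<And>i. A i \<subseteq> U i"
        "\<And>i. measure \<mu> (U i - C i) < e / 2 * (1 / 2) ^ Suc i" by metis
      \<comment> \<open>The union of all the \<open>C i\<close> need not be closed; finitely many of
        them carry all but \<open>e / 2\<close> of its mass.\<close>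
      define D where "D n = (\<Union>i<n. C i)" for n
      have D_closed: "closed (D n)" for n unfolding D_def using CU(1) by (intro closed_UN) auto
      have sums: "(\<lambda>i. e / 2 * (1 / 2) ^ Suc i) sums (e / 2)"
        using sums_mult[OF power_half_series, of "e / 2"] by simp
      have UC: "U i - C i \<in> sets \<mu>" for i using CU mu by auto
      have summ: "summable (\<lambda>i. measure \<mu> (U i - C i))"
        using CU(5) by (intro summable_comparison_test'[OF sums_summable[OF sums]]) (auto intro: less_imp_le)
      have "measure \<mu> (\<Union>i. U i - C i) \<le> (\<Sum>i. measure \<mu> (U i - C i))"
        using UC summ by (intro finite_measure_subadditive_countably) auto
      also have "\<dots> \<le> (\<Sum>i. e / 2 * (1 / 2) ^ Suc i)"
        using CU(5) by (intro suminf_le summ sums_summable[OF sums] less_imp_le)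
      also have "\<dots> = e / 2" using sums by (simp add: sums_iff)
      finally have le1: "measure \<mu> (\<Union>i. U i - C i) \<le> e / 2" .
      have "(\<lambda>n. measure \<mu> (D n)) \<longlonglongrightarrow> measure \<mu> (\<Union>n. D n)"
      proof (rule finite_Lim_measure_incseq)
        show "range D \<subseteq> sets \<mu>" using D_closed mu by auto
        show "incseq D" unfolding D_def by (intro monoI UN_mono) auto
      qed
      then have "eventually (\<lambda>n. measure \<mu> (\<Union>n. D n) - e / 2 < measure \<mu> (D n)) sequentially"
        using e by (intro order_tendstoD(1)) auto
      then obtain n where n: "measure \<mu> (\<Union>n. D n) - e / 2 < measure \<mu> (D n)" by (auto simp: eventually_sequentially)
      have Dn: "D n \<in> sets \<mu>" "(\<Union>n. D n) \<in> sets \<mu>" using D_closed mu by auto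
      have "measure \<mu> ((\<Union>n. D n) - D n) = measure \<mu> (\<Union>n. D n) - measure \<mu> (D n)"
        using Dn by (intro finite_measure_Diff) auto
      then have le2: "measure \<mu> ((\<Union>n. D n) - D n) < e / 2" using n by linarith
      have "(\<Union>i. U i) - D n \<subseteq> (\<Union>i. U i - C i) \<union> ((\<Union>n. D n) - D n)" by (auto simp: D_def)
      then have "measure \<mu> ((\<Union>i. U i) - D n) \<le> measure \<mu> ((\<Union>i. U i - C i) \<union> ((\<Union>n. D n) - D n))"
        using UC Dn by (intro finite_measure_mono) auto
      also have "\<dots> \<le> measure \<mu> (\<Union>i. U i - C i) + measure \<mu> ((\<Union>n. D n) - D n)"
        using UC Dn by (intro measure_Un_le) auto
      finally have "measure \<mu> ((\<Union>i. U i) - D n) < e" using le1 le2 by linarith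
      moreover have "D n \<subseteq> (\<Union>i. A i)" using CU(3) by (auto simp: D_def)
      moreover have "(\<Union>i. A i) \<subseteq> (\<Union>i. U i)" using CU(4) by auto
      moreover have "open (\<Union>i. U i)" using CU(2) by auto
      ultimately show "\<exists>C U. closed C \<and> open U \<and> C \<subseteq> \<Union> (range A) \<and> \<Union> (range A) \<subseteq> U \<and> measure \<mu> (U - C) < e"
        using D_closed[of n] by blast
    qed
  qed
  with e obtain C U where CU: "closed C" "open U" "C \<subseteq> A" "A \<subseteq> U" "measure \<mu> (U - C) < e"
    using RD by meson
  have "measure \<mu> (A - C) \<le> measure \<mu> (U - C)"
    using CU mu by (intro finite_measure_mono) auto
  then show ?thesis using that CU by force
qed

text \<open>A triple \<open>(x, n, \<epsilon>)\<close> asks to follow the orbit of \<open>x\<close> for time \<open>n\<close> with precision \<open>\<epsilon>\<close>, up to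
  \<open>g n\<close> errors; a list of triples is executed from left to right.\<close>

fun shadows :: "('a \<Rightarrow> 'a \<Rightarrow> real) \<Rightarrow> ('a \<Rightarrow> 'a) \<Rightarrow> (nat \<Rightarrow> nat) \<Rightarrow> ('a \<times> nat \<times> real) list \<Rightarrow> 'a \<Rightarrow> bool" where
  "shadows d T g [] y \<longleftrightarrow> True"
| "shadows d T g ((x, n, \<epsilon>) # bs) y \<longleftrightarrow> y \<in> blowup_ball d T g n x \<epsilon> \<and> shadows d T g bs ((T ^^ n) y)"

definition block_length :: "('a \<times> nat \<times> real) list \<Rightarrow> nat" where
  "block_length bs = (\<Sum>(x, n, \<epsilon>)\<leftarrow>bs. n)"

lemma block_length_simps [simp]:
  "block_length [] = 0" "block_length ((x, n, \<epsilon>) # bs) = n + block_length bs"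
  "block_length (bs @ cs) = block_length bs + block_length cs"
  by (auto simp: block_length_def)

lemma shadows_append:
  "shadows d T g (bs @ cs) y \<longleftrightarrow> shadows d T g bs y \<and> shadows d T g cs ((T ^^ block_length bs) y)"
proof (induction bs arbitrary: y)
  case (Cons b bs)
  obtain x n \<epsilon> where "b = (x, n, \<epsilon>)" by (cases b)
  then show ?case using Cons.IH by (simp add: funpow_add add.commute[of n])
qed simp

lemma shadows_iff_nth:
  "shadows d T g bs y \<longleftrightarrow> (\<forall>j<length bs. (T ^^ block_length (take j bs)) y
    \<in> blowup_ball d T g (fst (snd (bs ! j))) (fst (bs ! j)) (snd (snd (bs ! j))))"
proof (induction bs arbitrary: y)
  case (Cons b bs)
  obtain x n \<epsilon> where "b = (x, n, \<epsilon>)" by (cases b)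
  then show ?case using Cons.IH by (simp add: All_less_Suc2 funpow_add add.commute[of n])
qed simp

definition admissible :: "(real \<Rightarrow> nat) \<Rightarrow> ('a \<times> nat \<times> real) list \<Rightarrow> bool" where
  "admissible m bs \<longleftrightarrow> (\<forall>(x, n, \<epsilon>)\<in>set bs. 0 < \<epsilon> \<and> m \<epsilon> \<le> n \<and> 1 \<le> n)"

text \<open>The property counts segments from 1 and starts each at the sum of the earlier lengths;
  lists of triples hide this bookkeeping, and only the threshold \<open>m\<close> stays visible,
  through \<open>admissible\<close>.\<close>

lemma almost_product_shadows:
  assumes "almost_product d T g"
  obtains m where "\<And>bs. admissible m bs \<Longrightarrow> \<exists>y. shadows d T g bs y"
proof -
  obtain m where M: "\<forall>k\<ge>1. \<forall>x (\<epsilon> :: nat \<Rightarrow> real) n. (\<forall>j\<in>{1..k}. \<epsilon> j > 0 \<and> n j \<ge> m (\<epsilon> j) \<and> n j \<ge> 1) \<longrightarrow>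
    (\<Inter>j\<in>{1..k}. (T ^^ (\<Sum>i=1..j-1. n i)) -` blowup_ball d T g (n j) (x j) (\<epsilon> j)) \<noteq> {}"
    using assms unfolding almost_product_def by (elim exE conjE) (rule that)
  have m: "(\<Inter>j\<in>{1..k}. (T ^^ (\<Sum>i=1..j-1. n i)) -` blowup_ball d T g (n j) (x j) (\<epsilon> j)) \<noteq> {}"
    if "1 \<le> k" "\<forall>j\<in>{1..k}. \<epsilon> j > 0 \<and> n j \<ge> m (\<epsilon> j) \<and> n j \<ge> 1" for k x n and \<epsilon> :: "nat \<Rightarrow> real"
    by (rule M[THEN spec, THEN mp, OF that(1), THEN spec, THEN spec, THEN spec, THEN mp, OF that(2)])
  have "\<exists>y. shadows d T g bs y" if bs: "admissible m bs" for bs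
  proof (cases "bs = []")
    case False
    define x where "x j = fst (bs ! (j - 1))" for j
    define n where "n j = fst (snd (bs ! (j - 1)))" for j
    define \<epsilon> where "\<epsilon> j = snd (snd (bs ! (j - 1)))" for j
    have "\<forall>j\<in>{1..length bs}. \<epsilon> j > 0 \<and> n j \<ge> m (\<epsilon> j) \<and> n j \<ge> 1"
    proof
      fix j assume "j \<in> {1..length bs}"
      then have "bs ! (j - 1) \<in> set bs" by auto
      then show "\<epsilon> j > 0 \<and> n j \<ge> m (\<epsilon> j) \<and> n j \<ge> 1"
        using bs unfolding admissible_def x_def n_def \<epsilon>_def by (auto simp: case_prod_unfold)
    qed
    moreover have "1 \<le> length bs" using False by (cases bs) auto
    ultimately have "(\<Inter>j\<in>{1..length bs}. (T ^^ (\<Sum>i=1..j-1. n i)) -` blowup_ball d T g (n j) (x j) (\<epsilon> j)) \<noteq> {}"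
      by (intro m)
    then obtain y where "y \<in> (\<Inter>j\<in>{1..length bs}. (T ^^ (\<Sum>i=1..j-1. n i)) -` blowup_ball d T g (n j) (x j) (\<epsilon> j))"
      by blast
    then have y: "(T ^^ (\<Sum>i=1..j-1. n i)) y \<in> blowup_ball d T g (n j) (x j) (\<epsilon> j)" if "j \<in> {1..length bs}" for j
      using that by blast
    have sum: "(\<Sum>i=1..j. n i) = block_length (take j bs)" if "j \<le> length bs" for j
      using that
    proof (induction j)
      case (Suc j)
      then have "take (Suc j) bs = take j bs @ [bs ! j]" by (simp add: take_Suc_conv_app_nth)
      moreover obtain x' n' \<epsilon>' where "bs ! j = (x', n', \<epsilon>')" by (cases "bs ! j")
      ultimately show ?case using Suc by (simp add: n_def)
    qed simp
    have "shadows d T g bs y" unfolding shadows_iff_nth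
    proof (intro allI impI)
      fix j assume "j < length bs"
      then show "(T ^^ block_length (take j bs)) y \<in> blowup_ball d T g (fst (snd (bs ! j))) (fst (bs ! j)) (snd (snd (bs ! j)))"
        using y[of "Suc j"] sum[of j] by (simp add: n_def x_def \<epsilon>_def)
    qed
    then show ?thesis ..
  qed simp
  then show ?thesis using that by blast
qed

section \<open>Closedness of the shadowing sets\<close>

context equivalent_metric
begin

lemma abs_d_diff_le: "\<bar>d x y - d x z\<bar> \<le> d y z"
  using d_triangle[of x y z] d_triangle[of x z y] d_sym[of y z] d_sym[of z y] by linarith

lemma continuous_on_d: "continuous_on UNIV (d x)"
proof (rule continuous_onI)
  fix y e assume "0 < (e :: real)"
  then obtain r where r: "0 < r" "\<And>y z. dist y z < r \<Longrightarrow> d y z < e" using dist_imp_d by blast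
  have "dist (d x z) (d x y) \<le> e" if "dist z y < r" for z
    using r(2)[OF that] abs_d_diff_le[of x z y] by (simp add: dist_real_def)
  then show "\<exists>r>0. \<forall>z\<in>UNIV. dist z y < r \<longrightarrow> dist (d x z) (d x y) \<le> e" using r(1) by blast
qed

text \<open>Only finitely many index sets \<open>\<Lambda>\<close> are possible. Closedness is what
  gives access to compactness for the nested sets of the Moran construction.\<close>

lemma closed_blowup_ball:
  assumes T: "continuous_on UNIV T" shows "closed (blowup_ball d T g n x \<epsilon>)"
proof -
  have "blowup_ball d T g n x \<epsilon> = (\<Union>\<Lambda>\<in>{\<Lambda>. \<Lambda> \<subseteq> {..<n} \<and> card ({..<n} - \<Lambda>) \<le> g n}. \<Inter>j\<in>\<Lambda>. {y. d ((T ^^ j) x) ((T ^^ j) y) \<le> \<epsilon>})"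
    by (auto simp: blowup_ball_def)
  also have "closed \<dots>"
  proof (intro closed_UN closed_INT ballI)
    show "finite {\<Lambda>. \<Lambda> \<subseteq> {..<n} \<and> card ({..<n} - \<Lambda>) \<le> g n}"
      by (rule finite_subset[of _ "Pow {..<n}"]) auto
    fix j
    have "continuous_on UNIV (\<lambda>y. d ((T ^^ j) x) ((T ^^ j) y))"
      by (rule continuous_on_compose2[OF continuous_on_d continuous_on_funpow[OF T]]) auto
    then show "closed {y. d ((T ^^ j) x) ((T ^^ j) y) \<le> \<epsilon>}"
      by (intro closed_Collect_le continuous_intros)
  qed
  finally show ?thesis .
qed

lemma closed_shadows:
  assumes T: "continuous_on UNIV T" shows "closed {y. shadows d T g bs y}"
proof (induction bs)
  case (Cons b bs)
  obtain x n \<epsilon> where b: "b = (x, n, \<epsilon>)" by (cases b)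
  have "closed ((T ^^ n) -` {y. shadows d T g bs y})"
    using continuous_closed_vimage[OF Cons.IH, of "T ^^ n"] continuous_on_funpow[OF T, of n]
    by (simp add: continuous_on_eq_continuous_at)
  moreover have "{y. shadows d T g (b # bs) y} = blowup_ball d T g n x \<epsilon> \<inter> (T ^^ n) -` {y. shadows d T g bs y}"
    by (auto simp: b)
  ultimately show ?case using closed_blowup_ball[OF T] by (simp add: closed_Int)
qed simp

end

section \<open>Pseudo-orbits made of orbit segments of length \<open>n\<close>, and their
  shadows\<close>

definition pseudo_orbit :: "('a \<Rightarrow> 'a) \<Rightarrow> nat \<Rightarrow> (nat \<Rightarrow> 'a) \<Rightarrow> nat \<Rightarrow> 'a" where
  "pseudo_orbit T n s a = (T ^^ (a mod n)) (s (a div n))"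

definition repeat_blocks :: "nat \<Rightarrow> nat \<Rightarrow> real \<Rightarrow> (nat \<Rightarrow> 'a) \<Rightarrow> ('a \<times> nat \<times> real) list" where
  "repeat_blocks K n \<epsilon> s = map (\<lambda>j. (s j, n, \<epsilon>)) [0..<K]"

lemma sum_pseudo_orbit:
  fixes \<phi> :: "'a \<Rightarrow> real"
  assumes "1 \<le> n"
  shows "(\<Sum>a<K * n. \<phi> (pseudo_orbit T n s a)) = (\<Sum>j<K. birkhoff_sum T \<phi> n (s j))"
proof -
  have "(\<Sum>a<K * n. \<phi> (pseudo_orbit T n s a)) = (\<Sum>j<K. \<Sum>a\<in>{j * n..<j * n + n}. \<phi> (pseudo_orbit T n s a))"
    by (rule sum.nat_group[symmetric])
  also have "\<dots> = (\<Sum>j<K. birkhoff_sum T \<phi> n (s j))"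
  proof (rule sum.cong)
    fix j
    have "(\<Sum>a\<in>{j * n..<j * n + n}. \<phi> (pseudo_orbit T n s a)) = (\<Sum>i<n. \<phi> (pseudo_orbit T n s (i + j * n)))"
      using sum.shift_bounds_nat_ivl[of "\<lambda>a. \<phi> (pseudo_orbit T n s a)" 0 "j * n" n]
      by (simp add: lessThan_atLeast0 add.commute)
    also have "\<dots> = birkhoff_sum T \<phi> n (s j)"
      unfolding birkhoff_sum_def by (intro sum.cong refl) (auto simp: pseudo_orbit_def)
    finally show "(\<Sum>a\<in>{j * n..<j * n + n}. \<phi> (pseudo_orbit T n s a)) = birkhoff_sum T \<phi> n (s j)" .
  qed simp
  finally show ?thesis .
qed

lemma block_length_repeat [simp]: "block_length (repeat_blocks K n \<epsilon> s) = K * n"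
  by (induction K) (simp_all add: repeat_blocks_def add.commute)

lemma length_repeat_blocks [simp]: "length (repeat_blocks K n \<epsilon> s) = K"
  by (simp add: repeat_blocks_def)

lemma nth_repeat_blocks: "j < K \<Longrightarrow> repeat_blocks K n \<epsilon> s ! j = (s j, n, \<epsilon>)"
  by (simp add: repeat_blocks_def)

lemma take_repeat_blocks: "j \<le> K \<Longrightarrow> take j (repeat_blocks K n \<epsilon> s) = repeat_blocks j n \<epsilon> s"
  by (simp add: repeat_blocks_def take_map)

text \<open>Each of the \<open>K\<close> segments has its own allowance of \<open>g n\<close>
  errors; quotient and remainder modulo \<open>n\<close> locate an error time in its
  segment.\<close>

lemma shadows_repeat_errors:
  assumes n: "1 \<le> n" and sh: "shadows d T g (repeat_blocks K n \<epsilon> s) y"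
  shows "card {a. a < K * n \<and> \<not> d (pseudo_orbit T n s a) ((T ^^ a) y) \<le> \<epsilon>} \<le> K * g n"
proof -
  define E where "E j = {i. i < n \<and> \<not> d ((T ^^ i) (s j)) ((T ^^ i) ((T ^^ (j * n)) y)) \<le> \<epsilon>}" for j
  have E: "card (E j) \<le> g n" if j: "j < K" for j
  proof -
    have "(T ^^ (j * n)) y \<in> blowup_ball d T g n (s j) \<epsilon>"
      using sh[unfolded shadows_iff_nth, THEN spec, of j] j
      by (simp add: take_repeat_blocks nth_repeat_blocks)
    then obtain \<Lambda> where L: "card ({..<n} - \<Lambda>) \<le> g n"
      "\<forall>i\<in>\<Lambda>. d ((T ^^ i) (s j)) ((T ^^ i) ((T ^^ (j * n)) y)) \<le> \<epsilon>"
      by (auto simp: blowup_ball_def)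
    then have "E j \<subseteq> {..<n} - \<Lambda>" by (auto simp: E_def)
    then have "card (E j) \<le> card ({..<n} - \<Lambda>)" by (intro card_mono) auto
    with L(1) show ?thesis by simp
  qed
  have "{a. a < K * n \<and> \<not> d (pseudo_orbit T n s a) ((T ^^ a) y) \<le> \<epsilon>} \<subseteq> (\<Union>j<K. (\<lambda>i. i + j * n) ` E j)"
  proof
    fix a assume a: "a \<in> {a. a < K * n \<and> \<not> d (pseudo_orbit T n s a) ((T ^^ a) y) \<le> \<epsilon>}"
    have "(T ^^ a) y = (T ^^ (a mod n)) ((T ^^ (a div n * n)) y)"
      by (metis comp_apply funpow_add mod_div_mult_eq)
    then have "a mod n \<in> E (a div n)" using a n by (simp add: E_def pseudo_orbit_def)
    moreover have "a div n < K" using a n by (simp add: div_less_iff_less_mult)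
    moreover have "a = a mod n + a div n * n" by simp
    ultimately show "a \<in> (\<Union>j<K. (\<lambda>i. i + j * n) ` E j)" by blast
  qed
  then have "card {a. a < K * n \<and> \<not> d (pseudo_orbit T n s a) ((T ^^ a) y) \<le> \<epsilon>} \<le> card (\<Union>j<K. (\<lambda>i. i + j * n) ` E j)"
    by (intro card_mono) (auto simp: E_def)
  also have "\<dots> \<le> (\<Sum>j<K. card ((\<lambda>i. i + j * n) ` E j))" by (rule card_UN_le) simp
  also have "\<dots> \<le> (\<Sum>j<K. g n)"
    using E by (intro sum_mono order.trans[OF card_image_le]) (auto simp: E_def)
  finally show ?thesis by simp
qed

text \<open>Times without error cost at most \<open>\<zeta>\<close> each, the others at most
  \<open>2 * B\<close>.\<close>

lemma birkhoff_sum_close: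
  fixes \<phi> :: "'a \<Rightarrow> real"
  assumes B: "\<And>x. \<bar>\<phi> x\<bar> \<le> B" and close: "\<And>x y. d x y \<le> \<epsilon> \<Longrightarrow> \<bar>\<phi> x - \<phi> y\<bar> \<le> \<zeta>" and z: "0 \<le> \<zeta>"
    and err: "real (card {a. a < N \<and> \<not> d (p a) ((T ^^ a) y) \<le> \<epsilon>}) \<le> e"
  shows "\<bar>birkhoff_sum T \<phi> N y - (\<Sum>a<N. \<phi> (p a))\<bar> \<le> real N * \<zeta> + 2 * B * e"
proof -
  define E where "E = {a. a < N \<and> \<not> d (p a) ((T ^^ a) y) \<le> \<epsilon>}"
  have B0: "0 \<le> B" using B[of undefined] by linarith
  have "\<bar>birkhoff_sum T \<phi> N y - (\<Sum>a<N. \<phi> (p a))\<bar> = \<bar>\<Sum>a<N. \<phi> ((T ^^ a) y) - \<phi> (p a)\<bar>"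
    by (simp add: birkhoff_sum_def sum_subtractf)
  also have "\<dots> \<le> (\<Sum>a<N. \<zeta> + (if a \<in> E then 2 * B else 0))"
  proof (intro order.trans[OF sum_abs] sum_mono)
    fix a assume a: "a \<in> {..<N}"
    show "\<bar>\<phi> ((T ^^ a) y) - \<phi> (p a)\<bar> \<le> \<zeta> + (if a \<in> E then 2 * B else 0)"
    proof (cases "a \<in> E")
      case True
      then show ?thesis using B[of "(T ^^ a) y"] B[of "p a"] z by simp
    next
      case False
      then have "d (p a) ((T ^^ a) y) \<le> \<epsilon>" using a by (simp add: E_def)
      from close[OF this] show ?thesis using False by (simp add: abs_minus_commute)
    qed
  qed
  also have "\<dots> = real N * \<zeta> + (\<Sum>a<N. if a \<in> E then 2 * B else 0)" by (simp add: sum.distrib)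
  also have "(\<Sum>a<N. if a \<in> E then 2 * B else 0) = real (card E) * (2 * B)"
  proof -
    have "{..<N} \<inter> {a. a \<in> E} = E" by (auto simp: E_def)
    then show ?thesis by (simp add: sum.If_cases)
  qed
  also have "\<dots> \<le> e * (2 * B)" using err B0 by (intro mult_right_mono) (auto simp: E_def)
  finally show ?thesis by (simp add: mult_ac)
qed

context equivalent_metric
begin

text \<open>Points on both sides of a common boundary of two atoms can be arbitrarily close.
  Shrinking every atom to a closed core of almost full measure puts the cores a positive distance
  apart, by compactness, at the price of the exceptional set \<open>B\<close>.\<close>

lemma separated_cores:
  fixes \<mu> :: "'a measure"
  assumes compact: "compact (UNIV :: 'a set)" and mu: "prob_space \<mu>" "sets \<mu> = sets borel"
    and P: "measurable_partition P" and e: "0 < e"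
  obtains B \<rho> where "B \<in> sets borel" "measure \<mu> B < e" "0 < \<rho>"
    "\<And>x y. x \<notin> B \<Longrightarrow> y \<notin> B \<Longrightarrow> cell P x \<noteq> cell P y \<Longrightarrow> \<rho> \<le> d x y"
proof -
  interpret prob_space \<mu> by fact
  have part: "partition_on UNIV P" "finite P" "P \<subseteq> sets borel" using P by (auto simp: measurable_partition_def)
  have "P \<noteq> {}" using part by (auto simp: partition_on_def)
  then have cP: "0 < real (card P)" using part by (simp add: card_gt_0_iff)
  define e' where "e' = e / real (card P)"
  have e': "0 < e'" using e cP by (simp add: e'_def)
  have "\<exists>C. closed C \<and> C \<subseteq> A \<and> measure \<mu> (A - C) < e'" if "A \<in> P" for A
  proof -
    have "A \<in> sets borel" using that part(3) by (rule rev_subsetD)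
    then obtain C where "closed C" "C \<subseteq> A" "measure \<mu> (A - C) < e'"
      by (rule closed_inner_approx[OF finite_measure_axioms mu(2) _ e'])
    then show ?thesis by (intro exI[of _ C] conjI)
  qed
  then obtain C where C: "\<And>A. A \<in> P \<Longrightarrow> closed (C A)" "\<And>A. A \<in> P \<Longrightarrow> C A \<subseteq> A"
    "\<And>A. A \<in> P \<Longrightarrow> measure \<mu> (A - C A) < e'" by metis
  define B where "B = (\<Union>A\<in>P. A - C A)"
  have meas: "A - C A \<in> sets borel" if "A \<in> P" for A
    using rev_subsetD[OF that part(3)] borel_closed[OF C(1)[OF that]] by (rule sets.Diff)
  then have B_sets: "B \<in> sets borel" unfolding B_def using part(2) by (intro sets.finite_UN) auto
  have "measure \<mu> B \<le> (\<Sum>A\<in>P. measure \<mu> (A - C A))"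
    unfolding B_def using part(2) meas mu(2) by (intro finite_measure_subadditive_finite) auto
  also have "\<dots> < (\<Sum>A\<in>P. e')" using \<open>P \<noteq> {}\<close> part(2) C(3) by (intro sum_strict_mono) auto
  also have "\<dots> = e" using cP by (simp add: e'_def)
  finally have B_small: "measure \<mu> B < e" .
  have "\<exists>r>0. \<forall>x\<in>C A. \<forall>y\<in>C A'. r \<le> dist x y" if "A \<in> P" "A' \<in> P" "A \<noteq> A'" for A A'
  proof -
    have "A \<inter> A' = {}" using that part(1) by (auto simp: partition_on_def disjoint_def)
    then have disj: "C A \<inter> C A' = {}" using C(2) that by blast
    have cC: "compact (C A)" using compact C(1)[OF that(1)] closed_Int_compact[of "C A" UNIV] by simp
    show ?thesis
    proof (cases "C A = {} \<or> C A' = {}")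
      case True
      then show ?thesis by (intro exI[of _ 1]) auto
    next
      case False
      have "continuous_on (C A) (\<lambda>x. infdist x (C A'))" by (intro continuous_on_infdist continuous_on_id)
      then obtain x0 where x0: "x0 \<in> C A" "\<And>x. x \<in> C A \<Longrightarrow> infdist x0 (C A') \<le> infdist x (C A')"
        using continuous_attains_inf[OF cC] False by metis
      have "infdist x0 (C A') \<noteq> 0"
        using x0(1) disj False in_closed_iff_infdist_zero[OF C(1)[OF that(2)], of x0] by blast
      then have "0 < infdist x0 (C A')" using infdist_nonneg[of x0 "C A'"] by simp
      moreover have "infdist x0 (C A') \<le> dist x y" if "x \<in> C A" "y \<in> C A'" for x y
        using x0(2)[OF that(1)] infdist_le[OF that(2), of x] by linarith
      ultimately show ?thesis by blast
    qed
  qed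
  then obtain r where r: "\<And>A A'. A \<in> P \<Longrightarrow> A' \<in> P \<Longrightarrow> A \<noteq> A' \<Longrightarrow> 0 < r A A'"
    "\<And>A A' x y. A \<in> P \<Longrightarrow> A' \<in> P \<Longrightarrow> A \<noteq> A' \<Longrightarrow> x \<in> C A \<Longrightarrow> y \<in> C A' \<Longrightarrow> r A A' \<le> dist x y" by metis
  define Q where "Q = {q \<in> P \<times> P. fst q \<noteq> snd q}"
  \<comment> \<open>Inserting 1 covers a partition with a single atom, for which \<open>Q\<close> is
    empty.\<close>
  define R where "R = Min (insert 1 ((\<lambda>q. r (fst q) (snd q)) ` Q))"
  have finQ: "finite Q" using part(2) by (auto simp: Q_def)
  have R0: "0 < R" unfolding R_def using finQ r(1) by (subst Min_gr_iff) (auto simp: Q_def)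
  have R: "R \<le> dist x y" if "x \<notin> B" "y \<notin> B" "cell P x \<noteq> cell P y" for x y
  proof -
    have xy: "x \<in> C (cell P x)" "y \<in> C (cell P y)"
      using that cell_in[OF part(1)] mem_cell[OF part(1)] unfolding B_def by blast+
    have "(cell P x, cell P y) \<in> Q" using that(3) cell_in[OF part(1)] by (simp add: Q_def)
    then have "R \<le> r (cell P x) (cell P y)" unfolding R_def using finQ by (intro Min_le) force+
    also have "\<dots> \<le> dist x y" using xy that(3) cell_in[OF part(1)] by (intro r(2)) auto
    finally show ?thesis .
  qed
  obtain \<rho> where rho: "0 < \<rho>" "\<And>x y. d x y < \<rho> \<Longrightarrow> dist x y < R" using d_imp_dist[OF R0] by blast
  have "\<rho> \<le> d x y" if "x \<notin> B" "y \<notin> B" "cell P x \<noteq> cell P y" for x y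
    using R[OF that] rho(2)[of x y] by (meson not_le)
  with that B_sets B_small rho(1) show ?thesis by blast
qed

lemma d_modulus:
  fixes \<phi> :: "'a \<Rightarrow> real"
  assumes "compact (UNIV :: 'a set)" "continuous_on UNIV \<phi>" "0 < e"
  obtains r where "0 < r" "\<And>x y. d x y \<le> r \<Longrightarrow> \<bar>\<phi> x - \<phi> y\<bar> \<le> e"
proof -
  have "uniformly_continuous_on UNIV \<phi>" by (rule compact_uniformly_continuous[OF assms(2,1)])
  then obtain r1 where r1: "0 < r1" "\<And>x y. dist y x < r1 \<Longrightarrow> dist (\<phi> y) (\<phi> x) < e"
    using assms(3) unfolding uniformly_continuous_on_def by (metis UNIV_I)
  obtain r where r: "0 < r" "\<And>x y. d x y < r \<Longrightarrow> dist x y < r1" using d_imp_dist[OF r1(1)] by blast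
  have "\<bar>\<phi> x - \<phi> y\<bar> \<le> e" if "d x y \<le> r / 2" for x y
    using r1(2)[OF r(2), of x y] r(1) that by (simp add: dist_real_def)
  with r(1) show ?thesis by (intro that[of "r / 2"]) auto
qed

end

lemma integral_birkhoff_sum:
  fixes T :: "'a::metric_space \<Rightarrow> 'a" and \<phi> :: "'a \<Rightarrow> real"
  assumes mu: "\<mu> \<in> invariant_measures T" and T: "continuous_on UNIV T"
    and phi: "\<phi> \<in> borel_measurable borel" "\<And>x. \<bar>\<phi> x\<bar> \<le> B"
  shows "(\<integral>x. birkhoff_sum T \<phi> n x \<partial>\<mu>) = real n * integral\<^sup>L \<mu> \<phi>"
proof -
  note props = invariant_measure_props[OF mu]
  interpret prob_space \<mu> by (rule props)
  have Tk: "T ^^ k \<in> measurable \<mu> borel" for k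
    using measurable_funpow_borel[OF T, of k] props(2) by (simp cong: measurable_cong_sets)
  have m: "(\<lambda>x. \<phi> ((T ^^ k) x)) \<in> borel_measurable \<mu>" for k
    using measurable_compose[OF Tk phi(1)] .
  have "(\<integral>x. birkhoff_sum T \<phi> n x \<partial>\<mu>) = (\<Sum>k<n. \<integral>x. \<phi> ((T ^^ k) x) \<partial>\<mu>)"
    unfolding birkhoff_sum_def
    by (intro Bochner_Integration.integral_sum integrable_const_bound[where B = B]) (use m phi(2) in auto)
  also have "\<dots> = (\<Sum>k<n. integral\<^sup>L \<mu> \<phi>)"
    using integral_distr[OF Tk phi(1)] distr_funpow_invariant[OF mu T] by simp
  finally show ?thesis by simp
qed

text \<open>A supply of building blocks of common length \<open>L\<close>. The requirements concern
  every point that shadows a block, because the points obtained later shadow whole sequences of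
  blocks and nothing else is known about them. The rate \<open>h\<close> and the scale
  \<open>e0\<close> stay fixed in all stages of the construction; \<open>\<zeta>\<close> and
  \<open>L\<close> vary.\<close>

definition superblock_family ::
  "('a \<Rightarrow> 'a \<Rightarrow> real) \<Rightarrow> ('a \<Rightarrow> 'a) \<Rightarrow> (nat \<Rightarrow> nat) \<Rightarrow> (real \<Rightarrow> nat) \<Rightarrow> ('b \<Rightarrow> 'a \<Rightarrow> real) \<Rightarrow> ('b \<Rightarrow> real) \<Rightarrow>
    real \<Rightarrow> real \<Rightarrow> real \<Rightarrow> nat \<Rightarrow> ('a \<times> nat \<times> real) list set \<Rightarrow> bool" where
  "superblock_family d T g m \<Phi> c h e0 \<zeta> L S \<longleftrightarrow> 1 \<le> L \<and> finite S \<and> exp (h * real L) \<le> real (card S) \<and>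
    (\<forall>s\<in>S. admissible m s \<and> block_length s = L) \<and>
    (\<forall>s\<in>S. \<forall>y j. shadows d T g s y \<longrightarrow> \<bar>birkhoff_sum T (\<Phi> j) L y - real L * c j\<bar> \<le> \<zeta> * real L) \<and>
    (\<forall>s\<in>S. \<forall>t\<in>S. \<forall>y z. s \<noteq> t \<longrightarrow> shadows d T g s y \<longrightarrow> shadows d T g t z \<longrightarrow>
      (\<exists>a<L. e0 < d ((T ^^ a) y) ((T ^^ a) z)))"

context equivalent_metric
begin

text \<open>The order of quantifiers is essential: \<open>e0\<close> comes from the measure, the
  partition and the entropy gap, and only for a given precision \<open>\<zeta>\<close> are the
  segment length \<open>n\<close> and the number \<open>K\<close> of segments chosen.\<close>

lemma superblocks:
  fixes T :: "'a \<Rightarrow> 'a" and \<Phi> :: "'b::finite \<Rightarrow> 'a \<Rightarrow> real" and m :: "real \<Rightarrow> nat"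
  assumes compact: "compact (UNIV :: 'a set)" and T: "continuous_on UNIV T" and mu: "\<mu> \<in> invariant_measures T"
    and g: "(\<lambda>n. real (g n) / real n) \<longlonglongrightarrow> 0" and h: "ereal h < metric_entropy T \<mu>"
    and Phi: "\<And>j. continuous_on UNIV (\<Phi> j)"
  shows "\<exists>e0>0. \<forall>\<zeta>>0. \<exists>L S. superblock_family d T g m \<Phi> (\<lambda>j. integral\<^sup>L \<mu> (\<Phi> j)) h e0 \<zeta> L S"
proof -
  note props = invariant_measure_props[OF mu]
  interpret prob_space \<mu> by (rule props)
  obtain P where P: "measurable_partition P" and "ereal h < ereal (entropy_wrt T \<mu> P)"
    using h unfolding metric_entropy_def less_SUP_iff by auto
  then have hP: "h < entropy_wrt T \<mu> P" by simp
  have part: "partition_on UNIV P" "finite P" using P by (auto simp: measurable_partition_def)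
  \<comment> \<open>The gap is split in four: the passage from the limit to blocks of length
    \<open>n\<close>, the deviation \<open>\<tau>\<close>, the factor 2 in the count of names, and
    the size of the Hamming balls.\<close>
  define \<gamma> where "\<gamma> = (entropy_wrt T \<mu> P - h) / 4"
  have gamma: "0 < \<gamma>" "entropy_wrt T \<mu> P = h + 4 * \<gamma>" using hP by (simp_all add: \<gamma>_def field_simps)
  have "\<exists>\<delta>>0. \<forall>N w. w \<in> words P N \<longrightarrow>
    real (card {v \<in> words P N. real (hamming v w) < \<delta> * real N}) \<le> exp (\<gamma> * real N)"
    by (rule hamming_ball_bound[OF part(2) gamma(1)]) blast
  then obtain \<delta> where delta1: "0 < \<delta>" and delta2: "\<forall>N w. w \<in> words P N \<longrightarrow>
    real (card {v \<in> words P N. real (hamming v w) < \<delta> * real N}) \<le> exp (\<gamma> * real N)"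
    by (elim exE conjE) (rule that)
  note delta = delta1 delta2[rule_format]
  have d8: "0 < \<delta> / 8" using delta by simp
  have "\<exists>B \<rho>. B \<in> sets borel \<and> measure \<mu> B < \<delta> / 8 \<and> 0 < \<rho> \<and>
    (\<forall>x y. x \<notin> B \<longrightarrow> y \<notin> B \<longrightarrow> cell P x \<noteq> cell P y \<longrightarrow> \<rho> \<le> d x y)"
    by (rule separated_cores[OF compact props(1,2) P d8]) blast
  then obtain B \<rho> where B: "B \<in> sets borel" "measure \<mu> B < \<delta> / 8" and rho1: "0 < \<rho>"
    and rho2: "\<forall>x y. x \<notin> B \<longrightarrow> y \<notin> B \<longrightarrow> cell P x \<noteq> cell P y \<longrightarrow> \<rho> \<le> d x y"
    by (elim exE conjE) (rule that)
  note rho = rho1 rho2[rule_format]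
  have "\<exists>L S. superblock_family d T g m \<Phi> (\<lambda>j. integral\<^sup>L \<mu> (\<Phi> j)) h (\<rho> / 2) \<zeta> L S" if zeta: "0 < \<zeta>" for \<zeta>
  proof -
    have "\<exists>r>0. \<forall>x y. d x y \<le> r \<longrightarrow> \<bar>\<Phi> j x - \<Phi> j y\<bar> \<le> \<zeta> / 4" for j
    proof -
      have z4: "0 < \<zeta> / 4" using zeta by simp
      show ?thesis by (rule d_modulus[OF compact Phi[of j] z4]) blast
    qed
    then obtain r where r: "\<And>j. 0 < r j" "\<And>j x y. d x y \<le> r j \<Longrightarrow> \<bar>\<Phi> j x - \<Phi> j y\<bar> \<le> \<zeta> / 4" by metis
    have "\<exists>C. \<forall>x. \<bar>\<Phi> j x\<bar> \<le> C" for j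
    using continuous_bounded_compact[OF compact Phi[of j]] by blast
    then obtain C where C: "\<And>j x. \<bar>\<Phi> j x\<bar> \<le> C j" by metis
    have C0: "0 \<le> C j" for j using order.trans[OF abs_ge_zero C[of j undefined]] .
    define M where "M = 1 + (\<Sum>j\<in>UNIV. C j)"
    have M: "0 < M" "\<bar>\<Phi> j x\<bar> \<le> M" for j x
    proof -
      have "C j \<le> (\<Sum>j\<in>UNIV. C j)" using C0 by (intro member_le_sum) auto
      then show "0 < M" "\<bar>\<Phi> j x\<bar> \<le> M" using C[of j x] C0[of j] by (auto simp: M_def)
    qed
    \<comment> \<open>Two shadowing errors of at most \<open>\<rho> / 8\<close> each leave more than
      half of the distance \<open>\<rho>\<close>; the other bounds keep the observables within
      \<open>\<zeta> / 4\<close>.\<close>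
    define \<epsilon> where "\<epsilon> = min (\<rho> / 8) (Min (range r))"
    have eps: "0 < \<epsilon>" "\<epsilon> \<le> \<rho> / 8" "\<epsilon> \<le> r j" for j
      using r(1) rho(1) by (auto simp: \<epsilon>_def Min_gr_iff min.coboundedI2)
    have close: "\<bar>\<Phi> j x - \<Phi> j y\<bar> \<le> \<zeta> / 4" if "d x y \<le> \<epsilon>" for j x y
      using r(2) order.trans[OF that eps(3)] by blast
    \<comment> \<open>\<open>c\<close> bounds the proportion of shadowing errors:
      \<open>\<delta> / 16\<close> serves the separation, and \<open>\<zeta> / (8 * M)\<close> the
      averages, where an error costs up to \<open>2 * M\<close>.\<close>
    define c where "c = min (\<delta> / 16) (\<zeta> / (8 * M))"
    have c: "0 < c" "c \<le> \<delta> / 16" "c \<le> \<zeta> / (8 * M)" using delta zeta M(1) by (auto simp: c_def)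
    have "eventually (\<lambda>n. real (g n) / real n < c) sequentially"
      using g c(1) by (intro order_tendstoD(2)) auto
    moreover have "eventually (\<lambda>n. h + 3 * \<gamma> < ent \<mu> (itinerary T P n) / real n) sequentially"
      using entropy_wrt_limit[OF mu T P] gamma by (intro order_tendstoD(1)) auto
    ultimately have "eventually (\<lambda>n. real (g n) / real n < c \<and> h + 3 * \<gamma> < ent \<mu> (itinerary T P n) / real n \<and> max 1 (m \<epsilon>) \<le> n) sequentially"
      using eventually_ge_at_top[of "max 1 (m \<epsilon>)"] by eventually_elim auto
    then obtain n where n: "real (g n) / real n < c" "h + 3 * \<gamma> < ent \<mu> (itinerary T P n) / real n" "1 \<le> n" "m \<epsilon> \<le> n"
      by (auto simp: eventually_sequentially)
    have npos: "0 < real n" using n(3) by simp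
    have gn: "real (g n) \<le> c * real n" using n(1) npos by (simp add: divide_less_eq)
    have H: "real n * (h + 3 * \<gamma>) \<le> ent \<mu> (itinerary T P n)" using n(2) npos by (simp add: less_divide_eq mult.commute)
    define \<tau> where "\<tau> = min (\<gamma> * real n) (min (\<zeta> / 4 * real n) (\<delta> / 8 * real n))"
    have tau: "0 < \<tau>" "\<tau> \<le> \<gamma> * real n" "\<tau> \<le> \<zeta> / 4 * real n" "\<tau> \<le> \<delta> / 8 * real n"
      using gamma zeta delta npos by (auto simp: \<tau>_def)
    \<comment> \<open>\<open>None\<close> counts the visits to the exceptional set \<open>B\<close>,
      so that typical samples also spend little time there.\<close>
    define u where "u i = (case i of None \<Rightarrow> birkhoff_sum T (indicator B) n | Some j \<Rightarrow> birkhoff_sum T (\<Phi> j) n)" for i :: "'b option"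
    define w where "w i = (case i of None \<Rightarrow> indicator B | Some j \<Rightarrow> \<Phi> j)" for i :: "'b option"
    have u_w: "u i = birkhoff_sum T (w i) n" for i by (cases i) (auto simp: u_def w_def)
    have w_meas: "w i \<in> borel_measurable borel" for i
      using B(1) borel_measurable_continuous_onI[OF Phi] by (cases i) (auto simp: w_def)
    have w_bdd: "\<bar>w i x\<bar> \<le> M + 1" for i x
      using M(2) M(1) by (cases i) (auto simp: w_def indicator_def add_increasing2)
    have u_meas: "u i \<in> borel_measurable \<mu>" for i
    proof -
      have "(\<lambda>x. w i ((T ^^ k) x)) \<in> borel_measurable \<mu>" for k
        using measurable_compose[OF measurable_funpow_borel[OF T, of k] w_meas[of i]] props(2) by (simp cong: measurable_cong_sets)
      then show ?thesis unfolding u_w birkhoff_sum_def[abs_def] by (intro borel_measurable_sum)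
    qed
    have u_bdd: "\<exists>C. \<forall>x. \<bar>u i x\<bar> \<le> C" for i
    proof (intro exI allI)
      fix x
      have "\<bar>u i x\<bar> \<le> (\<Sum>k<n. M + 1)"
        unfolding u_w birkhoff_sum_def by (intro order.trans[OF sum_abs] sum_mono w_bdd)
      then show "\<bar>u i x\<bar> \<le> real n * (M + 1)" by simp
    qed
    have u_int: "integral\<^sup>L \<mu> (u i) = real n * integral\<^sup>L \<mu> (w i)" for i
      unfolding u_w by (rule integral_birkhoff_sum[OF mu T w_meas w_bdd])
    have sf: "simple_function \<mu> (itinerary T P n)"
      using simple_function_itinerary[OF P T props(2), of n 0] by simp
    have ev: "eventually (\<lambda>K. \<exists>G. (\<forall>s\<in>G. \<forall>i\<in>UNIV. \<bar>(\<Sum>j<K. u i (s j)) / real K - integral\<^sup>L \<mu> (u i)\<bar> < \<tau>) \<and>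
      exp (real K * (ent \<mu> (itinerary T P n) - \<tau>)) / 2 \<le> real (card ((\<lambda>s. map (\<lambda>j. itinerary T P n (s j)) [0..<K]) ` G))) sequentially"
      by (rule many_typical_names[OF props(1,3) finite[of UNIV] u_meas u_bdd tau(1) sf])
    \<comment> \<open>For such \<open>K\<close> the factor 2 in the count of names is absorbed by
      \<open>exp (real K * real n * \<gamma>)\<close>.\<close>
    have "eventually (\<lambda>K. ln 2 / (\<gamma> * real n) \<le> real K) sequentially"
      by (rule eventually_compose_filterlim[OF eventually_ge_at_top filterlim_real_sequentially])
    with ev have "eventually (\<lambda>K. (\<exists>G. (\<forall>s\<in>G. \<forall>i\<in>UNIV. \<bar>(\<Sum>j<K. u i (s j)) / real K - integral\<^sup>L \<mu> (u i)\<bar> < \<tau>) \<and>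
      exp (real K * (ent \<mu> (itinerary T P n) - \<tau>)) / 2 \<le> real (card ((\<lambda>s. map (\<lambda>j. itinerary T P n (s j)) [0..<K]) ` G)))
      \<and> ln 2 / (\<gamma> * real n) \<le> real K \<and> 1 \<le> K) sequentially"
      using eventually_ge_at_top[of 1] by eventually_elim blast
    from eventually_happens'[OF sequentially_bot this]
    obtain K G where K: "ln 2 / (\<gamma> * real n) \<le> real K" "1 \<le> K"
      and all: "\<forall>s\<in>G. \<forall>i\<in>UNIV. \<bar>(\<Sum>j<K. u i (s j)) / real K - integral\<^sup>L \<mu> (u i)\<bar> < \<tau>"
      and cnt: "exp (real K * (ent \<mu> (itinerary T P n) - \<tau>)) / 2 \<le> real (card ((\<lambda>s. map (\<lambda>j. itinerary T P n (s j)) [0..<K]) ` G))"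
      by (elim exE conjE) (rule that)
    have dev: "\<bar>(\<Sum>j<K. u i (s j)) / real K - integral\<^sup>L \<mu> (u i)\<bar> < \<tau>" if "s \<in> G" for s i
      using all that by simp
    define N where "N = K * n"
    have N1: "1 \<le> N" using K(2) n(3) by (simp add: N_def)
    have NK: "real N = real K * real n" by (simp add: N_def)
    \<comment> \<open>The word of a sample determines its name, so there are at least as many words
      as names. It lists the \<open>N\<close> letters singly, so that the Hamming distance between
      words counts times.\<close>
    define word where "word s = map (\<lambda>a. cell P (pseudo_orbit T n s a)) [0..<N]" for s
    define W where "W = word ` G"
    have W_words: "W \<subseteq> words P N" using cell_in[OF part(1)] by (auto simp: W_def word_def words_def)
    have finW: "finite W" using W_words finite_words[OF part(2)] by (rule finite_subset)
    define name where "name s = map (\<lambda>j. itinerary T P n (s j)) [0..<K]" for s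
    have name_word: "name s = name t" if "word s = word t" for s t
    proof -
      have eq: "cell P (pseudo_orbit T n s a) = cell P (pseudo_orbit T n t a)" if "a < N" for a
        using \<open>word s = word t\<close> that by (auto simp: word_def)
      have "itinerary T P n (s j) = itinerary T P n (t j)" if j: "j < K" for j
        unfolding itinerary_eq_iff
      proof (intro allI impI)
        fix i assume i: "i < n"
        have "i + j * n < Suc j * n" using i by simp
        also have "\<dots> \<le> N" unfolding N_def using j by (intro mult_right_mono) auto
        finally show "cell P ((T ^^ i) (s j)) = cell P ((T ^^ i) (t j))"
          using eq[of "i + j * n"] i by (simp add: pseudo_orbit_def)
      qed
      then show ?thesis by (simp add: name_def)
    qed
    have "name ` G \<subseteq> (\<lambda>v. name (SOME s. s \<in> G \<and> word s = v)) ` W"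
    proof
      fix v assume "v \<in> name ` G"
      then obtain s where s: "s \<in> G" "v = name s" by auto
      have "word (SOME t. t \<in> G \<and> word t = word s) = word s"
        using someI[of "\<lambda>t. t \<in> G \<and> word t = word s" s] s(1) by blast
      from name_word[OF this] show "v \<in> (\<lambda>v. name (SOME s. s \<in> G \<and> word s = v)) ` W"
        using s by (intro image_eqI[of _ _ "word s"]) (auto simp: W_def)
    qed
    then have "card (name ` G) \<le> card W" using finW by (rule surj_card_le[rotated])
    moreover have "exp (real N * (h + \<gamma>)) \<le> exp (real K * (ent \<mu> (itinerary T P n) - \<tau>)) / 2"
    proof -
      have "2 \<le> exp (real N * \<gamma>)"
      proof -
        have "ln 2 \<le> real N * \<gamma>" using K(1) gamma(1) npos by (simp add: NK divide_le_eq mult_ac)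
        then have "exp (ln 2) \<le> exp (real N * \<gamma>)" unfolding exp_le_cancel_iff .
        then show ?thesis by simp
      qed
      then have "exp (real N * (h + \<gamma>)) * 2 \<le> exp (real N * (h + \<gamma>)) * exp (real N * \<gamma>)" by (intro mult_left_mono) auto
      also have "\<dots> = exp (real K * (real n * (h + 3 * \<gamma>) - \<gamma> * real n))" by (simp add: exp_add[symmetric] NK algebra_simps)
      also have "\<dots> \<le> exp (real K * (ent \<mu> (itinerary T P n) - \<tau>))"
        unfolding exp_le_cancel_iff using H tau(2) by (intro mult_left_mono) auto
      finally show ?thesis by simp
    qed
    ultimately have cardW: "exp (real N * (h + \<gamma>)) \<le> real (card W)" using cnt by (simp add: name_def)
    \<comment> \<open>\<open>hamming\<close> looks only at positions of its first argument, so equal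
      length is demanded to make the relation symmetric.\<close>
    define R where "R v w \<longleftrightarrow> length v = length w \<and> real (hamming v w) < \<delta> * real N" for v w :: "'a set list"
    obtain S' where S': "S' \<subseteq> W" "real (card W) \<le> real (card S') * exp (\<gamma> * real N)"
      "\<And>v w. v \<in> S' \<Longrightarrow> w \<in> S' \<Longrightarrow> v \<noteq> w \<Longrightarrow> \<not> R v w"
    proof (rule exists_separated_subset[OF finW, of R "exp (\<gamma> * real N)"])
      show "R v v" for v using delta(1) N1 by (simp add: R_def hamming_def)
      show "R w v" if "R v w" for v w
      proof -
        have "{i. i < length w \<and> w ! i \<noteq> v ! i} = {i. i < length v \<and> v ! i \<noteq> w ! i}" using that by (auto simp: R_def)
        then have "hamming w v = hamming v w" by (simp only: hamming_def)
        then show ?thesis using that by (simp add: R_def)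
      qed
      show "real (card {v \<in> W. R v w}) \<le> exp (\<gamma> * real N)" if "w \<in> W" for w
      proof -
        have "card {v \<in> W. R v w} \<le> card {v \<in> words P N. real (hamming v w) < \<delta> * real N}"
          using W_words finite_words[OF part(2)] by (intro card_mono) (auto simp: R_def)
        then show ?thesis using delta(2)[of w N] that W_words by force
      qed
    next
      fix S' assume S': "S' \<subseteq> W" "real (card W) \<le> real (card S') * exp (\<gamma> * real N)"
        "\<And>v w. v \<in> S' \<Longrightarrow> w \<in> S' \<Longrightarrow> v \<noteq> w \<Longrightarrow> \<not> R v w"
      show thesis by (rule that[OF S'])
    qed
    have cardS': "exp (h * real N) \<le> real (card S')"
    proof -
      have "exp (h * real N) * exp (\<gamma> * real N) = exp (real N * (h + \<gamma>))" by (simp add: exp_add[symmetric] algebra_simps)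
      also have "\<dots> \<le> real (card S') * exp (\<gamma> * real N)" using cardW S'(2) by linarith
      finally show ?thesis by simp
    qed
    have "\<forall>v\<in>S'. \<exists>s. s \<in> G \<and> word s = v" using S'(1) by (auto simp: W_def)
    then obtain pick where pick: "\<And>v. v \<in> S' \<Longrightarrow> pick v \<in> G \<and> word (pick v) = v" by metis
    define S where "S = (\<lambda>v. repeat_blocks K n \<epsilon> (pick v)) ` S'"
    have inj: "inj_on (\<lambda>v. repeat_blocks K n \<epsilon> (pick v)) S'"
    proof (rule inj_onI)
      fix v v' assume v: "v \<in> S'" "v' \<in> S'" and eq: "repeat_blocks K n \<epsilon> (pick v) = repeat_blocks K n \<epsilon> (pick v')"
      have "pick v j = pick v' j" if "j < K" for j
        using arg_cong[OF eq, of "\<lambda>bs. fst (bs ! j)"] that by (simp add: nth_repeat_blocks)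
      then have "word (pick v) = word (pick v')"
        using n(3) by (auto simp: word_def pseudo_orbit_def N_def div_less_iff_less_mult)
      then show "v = v'" using pick v by metis
    qed
    have finS: "finite S" using S'(1) finW finite_subset by (auto simp: S_def)
    have cardS: "exp (h * real N) \<le> real (card S)" using cardS' card_image[OF inj] by (simp add: S_def)
    have err: "real (card {a. a < N \<and> \<not> d (pseudo_orbit T n s a) ((T ^^ a) y) \<le> \<epsilon>}) \<le> c * real N"
      if "shadows d T g (repeat_blocks K n \<epsilon> s) y" for s y
    proof -
      have "real (card {a. a < N \<and> \<not> d (pseudo_orbit T n s a) ((T ^^ a) y) \<le> \<epsilon>}) \<le> real (K * g n)"
        unfolding N_def using shadows_repeat_errors[OF n(3) that] by (rule of_nat_mono)
      also have "\<dots> \<le> real K * (c * real n)" unfolding of_nat_mult by (intro mult_left_mono gn) simp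
      finally show ?thesis by (simp add: NK mult.left_commute)
    qed
    have sum_typ: "\<bar>(\<Sum>a<N. w i (pseudo_orbit T n s a)) - real N * integral\<^sup>L \<mu> (w i)\<bar> \<le> real K * \<tau>" if s: "s \<in> G" for s i
    proof -
      have eq: "(\<Sum>a<N. w i (pseudo_orbit T n s a)) = (\<Sum>j<K. u i (s j))"
        unfolding N_def u_w by (rule sum_pseudo_orbit[OF n(3)])
      have "(\<Sum>j<K. u i (s j)) - real N * integral\<^sup>L \<mu> (w i) = real K * ((\<Sum>j<K. u i (s j)) / real K - integral\<^sup>L \<mu> (u i))"
        using K(2) by (simp add: u_int NK right_diff_distrib)
      then have "\<bar>(\<Sum>j<K. u i (s j)) - real N * integral\<^sup>L \<mu> (w i)\<bar> = real K * \<bar>(\<Sum>j<K. u i (s j)) / real K - integral\<^sup>L \<mu> (u i)\<bar>"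
        by (simp add: abs_mult)
      also have "\<dots> \<le> real K * \<tau>" using dev[OF s, of i] by (intro mult_left_mono) auto
      finally show ?thesis unfolding eq .
    qed
    have avg: "\<bar>birkhoff_sum T (\<Phi> j) N y - real N * integral\<^sup>L \<mu> (\<Phi> j)\<bar> \<le> \<zeta> * real N"
      if s: "s \<in> G" and sh: "shadows d T g (repeat_blocks K n \<epsilon> s) y" for s y j
    proof -
      have "\<bar>birkhoff_sum T (\<Phi> j) N y - (\<Sum>a<N. \<Phi> j (pseudo_orbit T n s a))\<bar> \<le> real N * (\<zeta> / 4) + 2 * M * (c * real N)"
        by (rule birkhoff_sum_close[where d = d and \<epsilon> = \<epsilon>, OF M(2) close _ err[OF sh]]) (use zeta in auto)
      moreover have "\<bar>(\<Sum>a<N. \<Phi> j (pseudo_orbit T n s a)) - real N * integral\<^sup>L \<mu> (\<Phi> j)\<bar> \<le> real K * \<tau>"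
        using sum_typ[OF s, of "Some j"] by (simp add: w_def)
      moreover have "real K * \<tau> \<le> real N * (\<zeta> / 4)"
        using mult_left_mono[OF tau(3), of "real K"] by (simp add: NK mult_ac)
      moreover have "2 * M * (c * real N) \<le> real N * (\<zeta> / 4)"
      proof -
        have "2 * M * c \<le> \<zeta> / 4" using c(3) M(1) by (simp add: le_divide_eq field_simps)
        from mult_right_mono[OF this, of "real N"] show ?thesis by (simp add: mult_ac)
      qed
      moreover have "real N * (\<zeta> / 4) + real N * (\<zeta> / 4) + real N * (\<zeta> / 4) \<le> \<zeta> * real N" using zeta by simp
      ultimately show ?thesis by linarith
    qed
    have sep: "\<exists>a<N. \<rho> / 2 < d ((T ^^ a) y) ((T ^^ a) z)"
      if v: "v \<in> S'" "v' \<in> S'" "v \<noteq> v'" and sh: "shadows d T g (repeat_blocks K n \<epsilon> (pick v)) y"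
        "shadows d T g (repeat_blocks K n \<epsilon> (pick v')) z" for v v' y z
    proof -
      define p q where "p = pseudo_orbit T n (pick v)" and "q = pseudo_orbit T n (pick v')"
      have bad: "real (card {a. a < N \<and> pseudo_orbit T n (pick x) a \<in> B}) \<le> \<delta> / 4 * real N" if "x \<in> S'" for x
      proof -
        have "real (card {a. a < N \<and> pseudo_orbit T n (pick x) a \<in> B}) = (\<Sum>a<N. w None (pseudo_orbit T n (pick x) a))"
          by (simp add: w_def indicator_def of_bool_def sum.If_cases Int_def)
        also have "\<dots> \<le> real N * integral\<^sup>L \<mu> (w None) + real K * \<tau>"
          using sum_typ[of "pick x" None] pick[OF that] by linarith
        also have "integral\<^sup>L \<mu> (w None) = measure \<mu> B" using B(1) props by (simp add: w_def)
        also have "real N * measure \<mu> B \<le> real N * (\<delta> / 8)" using B(2) by (intro mult_left_mono) auto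
        also have "real K * \<tau> \<le> real N * (\<delta> / 8)"
          using mult_left_mono[OF tau(4), of "real K"] by (simp add: NK mult_ac)
        finally show ?thesis by simp
      qed
      \<comment> \<open>The two words differ at a proportion of at least \<open>\<delta>\<close> of
        the times. Visits to \<open>B\<close> and shadowing errors of both points use up at most
        \<open>5 / 8\<close> of this, so at some time the names differ, both pseudo-orbits are
        outside \<open>B\<close>, and both are followed closely.\<close>
      define D where "D = {a. a < N \<and> cell P (p a) \<noteq> cell P (q a)}"
      define Ba Bb Ea Eb where "Ba = {a. a < N \<and> p a \<in> B}" and "Bb = {a. a < N \<and> q a \<in> B}"
        and "Ea = {a. a < N \<and> \<not> d (p a) ((T ^^ a) y) \<le> \<epsilon>}" and "Eb = {a. a < N \<and> \<not> d (q a) ((T ^^ a) z) \<le> \<epsilon>}"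
      have le: "real (card Ba) \<le> \<delta> / 4 * real N" "real (card Bb) \<le> \<delta> / 4 * real N"
        "real (card Ea) \<le> \<delta> / 16 * real N" "real (card Eb) \<le> \<delta> / 16 * real N"
        using bad[OF v(1)] bad[OF v(2)] order.trans[OF err[OF sh(1)] mult_right_mono[OF c(2)]]
          order.trans[OF err[OF sh(2)] mult_right_mono[OF c(2)]]
        by (simp_all add: Ba_def Bb_def Ea_def Eb_def p_def q_def)
      have len: "length v = N" "length v' = N" using v S'(1) W_words by (auto simp: words_def)
      have nth: "v ! a = cell P (p a)" "v' ! a = cell P (q a)" if "a < N" for a
      proof -
        have "word (pick x) ! a = cell P (pseudo_orbit T n (pick x) a)" for x using that by (simp add: word_def)
        then show "v ! a = cell P (p a)" "v' ! a = cell P (q a)"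
          using pick[OF v(1)] pick[OF v(2)] by (metis p_def, metis q_def)
      qed
      have "D = {i. i < length v \<and> v ! i \<noteq> v' ! i}" using nth len by (auto simp: D_def)
      then have "\<delta> * real N \<le> real (card D)"
        using S'(3)[OF v] len by (simp add: R_def hamming_def)
      moreover have "real (card (Ba \<union> Bb \<union> Ea \<union> Eb)) \<le> real (card Ba) + real (card Bb) + real (card Ea) + real (card Eb)"
        using card_Un_le[of "Ba \<union> Bb \<union> Ea" Eb] card_Un_le[of "Ba \<union> Bb" Ea] card_Un_le[of Ba Bb] by linarith
      moreover have "\<delta> / 4 * real N + \<delta> / 4 * real N + \<delta> / 16 * real N + \<delta> / 16 * real N < \<delta> * real N"
        using delta(1) N1 by simp
      ultimately have "real (card (Ba \<union> Bb \<union> Ea \<union> Eb)) < real (card D)" using le by linarith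
      then have "\<not> D \<subseteq> Ba \<union> Bb \<union> Ea \<union> Eb"
        using card_mono[of "Ba \<union> Bb \<union> Ea \<union> Eb" D] by (auto simp: Ba_def Bb_def Ea_def Eb_def)
      then obtain a where "a \<in> D" "a \<notin> Ba" "a \<notin> Bb" "a \<notin> Ea" "a \<notin> Eb" by blast
      then have a: "a < N" "cell P (p a) \<noteq> cell P (q a)" "p a \<notin> B" "q a \<notin> B"
        "d (p a) ((T ^^ a) y) \<le> \<epsilon>" "d (q a) ((T ^^ a) z) \<le> \<epsilon>"
        by (auto simp: D_def Ba_def Bb_def Ea_def Eb_def)
      have "\<rho> \<le> d (p a) (q a)" using rho(2) a by blast
      also have "\<dots> \<le> d (p a) ((T ^^ a) y) + d ((T ^^ a) y) ((T ^^ a) z) + d (q a) ((T ^^ a) z)"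
        using d_triangle[of "p a" "q a" "(T ^^ a) y"] d_triangle[of "(T ^^ a) y" "q a" "(T ^^ a) z"] d_sym[of "(T ^^ a) z" "q a"] by linarith
      finally have "\<rho> / 2 < d ((T ^^ a) y) ((T ^^ a) z)" using a(5,6) eps(2) rho(1) by linarith
      with a(1) show ?thesis by blast
    qed
    show ?thesis
      unfolding superblock_family_def
    proof (rule exI[of _ N], rule exI[of _ S], intro conjI ballI allI impI)
      fix s assume "s \<in> S"
      then obtain v where v: "v \<in> S'" "s = repeat_blocks K n \<epsilon> (pick v)" by (auto simp: S_def)
      show "admissible m s" using v(2) eps(1) n(3,4) by (auto simp: admissible_def repeat_blocks_def)
      show "block_length s = N" using v(2) by (simp add: N_def)
      fix y j assume "shadows d T g s y"
      then show "\<bar>birkhoff_sum T (\<Phi> j) N y - real N * integral\<^sup>L \<mu> (\<Phi> j)\<bar> \<le> \<zeta> * real N"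
        using avg pick[OF v(1)] v(2) by blast
    next
      fix s t y z assume "s \<in> S" "t \<in> S" "s \<noteq> t" "shadows d T g s y" "shadows d T g t z"
      then show "\<exists>a<N. \<rho> / 2 < d ((T ^^ a) y) ((T ^^ a) z)" using sep unfolding S_def by blast
    qed (use N1 finS cardS in auto)
  qed
  with rho(1) show ?thesis by (intro exI[of _ "\<rho> / 2"]) auto
qed

end

section \<open>The Moran construction\<close>

lemma birkhoff_sum_add:
  "birkhoff_sum T \<phi> (a + b) y = birkhoff_sum T \<phi> a y + birkhoff_sum T \<phi> b ((T ^^ a) y)"
  by (induction b) (auto simp: birkhoff_sum_def funpow_add[of _ a, THEN fun_cong] add.commute[of a] funpow_add)

lemma abs_birkhoff_sum_le:
  assumes "\<And>x. \<bar>\<phi> x\<bar> \<le> B" shows "\<bar>birkhoff_sum T \<phi> n y\<bar> \<le> real n * B"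
proof -
  have "\<bar>birkhoff_sum T \<phi> n y\<bar> \<le> (\<Sum>k<n. B)"
    unfolding birkhoff_sum_def by (intro order.trans[OF sum_abs] sum_mono assms)
  then show ?thesis by simp
qed

lemma pressure_sum_ge:
  assumes "\<And>\<C>. \<C> \<in> bowen_covers d T Z n \<epsilon> \<Longrightarrow> \<exists>F. finite F \<and> F \<subseteq> \<C> \<and>
      r \<le> (\<Sum>(l, x)\<in>F. exp (- t * real l + (SUP y\<in>bowen_ball d T l x \<epsilon>. birkhoff_sum T \<psi> l y)))"
  shows "ennreal r \<le> pressure_sum d T Z t \<psi> n \<epsilon>"
  unfolding pressure_sum_def
proof (rule INF_greatest)
  fix \<C> assume "\<C> \<in> bowen_covers d T Z n \<epsilon>"
  define f where "f = (\<lambda>(l, x). exp (- t * real l + (SUP y\<in>bowen_ball d T l x \<epsilon>. birkhoff_sum T \<psi> l y)))"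
  obtain F where F: "finite F" "F \<subseteq> \<C>" "r \<le> (\<Sum>p\<in>F. f p)"
    using assms[OF \<open>\<C> \<in> _\<close>] unfolding f_def by blast
  have "ennreal r \<le> ennreal (\<Sum>p\<in>F. f p)" using F(3) by (rule ennreal_leI)
  also have "\<dots> = (\<Sum>p\<in>F. ennreal (f p))" by (rule sum_ennreal[symmetric]) (auto simp: f_def case_prod_unfold)
  also have "\<dots> \<le> (SUP F\<in>{F. finite F \<and> F \<subseteq> \<C>}. \<Sum>p\<in>F. ennreal (f p))" using F by (intro SUP_upper) auto
  also have "\<dots> = (\<Sum>\<^sub>\<infinity>p\<in>\<C>. ennreal (f p))" by (rule nonneg_infsum_complete[symmetric]) simp
  finally show "ennreal r \<le> (\<Sum>\<^sub>\<infinity>(l, x)\<in>\<C>. ennreal (exp (- t * real l + (SUP y\<in>bowen_ball d T l x \<epsilon>. birkhoff_sum T \<psi> l y))))"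
    by (simp add: f_def case_prod_unfold)
qed

text \<open>Raising \<open>n\<close> leaves fewer covers, so the infima increase and the
  \<open>lim\<close> in the definition is a supremum.\<close>

lemma pressure_sum_le_pressure_limit: "pressure_sum d T Z t \<psi> n \<epsilon> \<le> pressure_limit d T Z t \<psi> \<epsilon>"
proof -
  have mono: "incseq (\<lambda>n. pressure_sum d T Z t \<psi> n \<epsilon>)"
    unfolding pressure_sum_def bowen_covers_def
    by (intro monoI INF_superset_mono) (auto intro: order.trans)
  have eq: "pressure_limit d T Z t \<psi> \<epsilon> = (SUP n. pressure_sum d T Z t \<psi> n \<epsilon>)"
    unfolding pressure_limit_def by (rule limI[OF LIMSEQ_SUP[OF mono]])
  show ?thesis unfolding eq by (rule SUP_upper) simp
qed

text \<open>A weighted Cesaro argument. Indices below \<open>i0\<close> contribute at most a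
  constant, the others at most \<open>\<tau> / 4\<close> of the total length; the extra term
  \<open>C * real (L i)\<close> accounts for the incomplete block in which an arbitrary time
  falls.\<close>

lemma weighted_average_small:
  fixes \<zeta> :: "nat \<Rightarrow> real" and L :: "nat \<Rightarrow> nat"
  defines "O' \<equiv> \<lambda>i. \<Sum>k<i. L k"
  assumes L: "\<And>i. 1 \<le> L i" and small: "\<And>\<tau>. 0 < \<tau> \<Longrightarrow> eventually (\<lambda>i. real (L i) \<le> \<tau> * real (O' i)) sequentially"
    and zeta: "\<zeta> \<longlonglongrightarrow> 0" and tau: "0 < \<tau>"
  shows "eventually (\<lambda>i. (\<Sum>k<i. \<zeta> k * real (L k)) + C * real (L i) \<le> \<tau> * real (O' i)) sequentially"
proof -
  have O_ge: "i \<le> O' i" for i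
    unfolding O'_def using sum_mono[of "{..<i}" "\<lambda>_. 1" L] L by simp
  define C' where "C' = max 1 C"
  have "eventually (\<lambda>k. \<zeta> k < \<tau> / 4) sequentially" using zeta tau by (intro order_tendstoD(2)) auto
  then obtain i0 where i0: "\<And>k. i0 \<le> k \<Longrightarrow> \<zeta> k < \<tau> / 4" by (auto simp: eventually_sequentially)
  define A where "A = (\<Sum>k<i0. \<bar>\<zeta> k\<bar> * real (L k))"
  have le: "(\<Sum>k<i. \<zeta> k * real (L k)) \<le> A + \<tau> / 4 * real (O' i)" for i
  proof -
    have "(\<Sum>k<i. \<zeta> k * real (L k)) \<le> (\<Sum>k<i. (if k < i0 then \<bar>\<zeta> k\<bar> * real (L k) else 0) + \<tau> / 4 * real (L k))"
    proof (rule sum_mono)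
      fix k
      show "\<zeta> k * real (L k) \<le> (if k < i0 then \<bar>\<zeta> k\<bar> * real (L k) else 0) + \<tau> / 4 * real (L k)"
      proof (cases "k < i0")
        case True
        have "\<zeta> k * real (L k) \<le> \<bar>\<zeta> k\<bar> * real (L k)" by (intro mult_right_mono) auto
        then show ?thesis using True tau by (simp add: add_increasing2)
      next
        case False
        then have "\<zeta> k \<le> \<tau> / 4" using i0[of k] by simp
        from mult_right_mono[OF this, of "real (L k)"] show ?thesis using False by simp
      qed
    qed
    also have "\<dots> = (\<Sum>k<i. if k < i0 then \<bar>\<zeta> k\<bar> * real (L k) else 0) + \<tau> / 4 * real (O' i)"
      by (simp add: sum.distrib O'_def sum_distrib_left)
    also have "(\<Sum>k<i. if k < i0 then \<bar>\<zeta> k\<bar> * real (L k) else 0) \<le> A"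
    proof -
      have "(\<Sum>k<i. if k < i0 then \<bar>\<zeta> k\<bar> * real (L k) else 0) = (\<Sum>k\<in>{..<i} \<inter> {..<i0}. \<bar>\<zeta> k\<bar> * real (L k))"
        by (simp add: sum.If_cases lessThan_def Int_def)
      also have "\<dots> \<le> A" unfolding A_def by (intro sum_mono2) auto
      finally show ?thesis .
    qed
    finally show ?thesis by simp
  qed
  have C': "0 < C'" "C \<le> C'" by (auto simp: C'_def)
  have t: "0 < \<tau> / (2 * C')" using tau C' by simp
  have "eventually (\<lambda>i. 4 * A / \<tau> \<le> real i) sequentially"
    by (rule eventually_compose_filterlim[OF eventually_ge_at_top filterlim_real_sequentially])
  with small[OF t] show ?thesis
  proof eventually_elim
    case (elim i)
    have "C * real (L i) \<le> C' * (\<tau> / (2 * C') * real (O' i))"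
      using elim(1) C' by (intro order.trans[OF mult_right_mono mult_left_mono]) auto
    also have "\<dots> = \<tau> / 2 * real (O' i)" using C' by simp
    finally have "C * real (L i) \<le> \<tau> / 2 * real (O' i)" .
    moreover have "A \<le> \<tau> / 4 * real (O' i)"
    proof -
      have "4 * A / \<tau> \<le> real (O' i)" using elim(2) O_ge[of i] by linarith
      then show ?thesis using tau by (simp add: field_simps)
    qed
    ultimately show ?case using le[of i] by linarith
  qed
qed

context equivalent_metric
begin

text \<open>Together with the complements of the \<open>G m\<close> the open sets cover the whole
  space, and a finite subcover uses finitely many of these complements. The conclusion holds for the
  sets \<open>G m\<close> themselves, where codes of finite length can be counted, and not only for
  their intersection.\<close>

lemma finite_subcover_decreasing:
  fixes U :: "'p \<Rightarrow> 'a set" and G :: "nat \<Rightarrow> 'a set"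
  assumes compact: "compact (UNIV :: 'a set)" and U: "\<And>p. p \<in> \<C> \<Longrightarrow> open (U p)"
    and G: "\<And>m. closed (G m)" "\<And>m n. m \<le> n \<Longrightarrow> G n \<subseteq> G m" and cov: "(\<Inter>m. G m) \<subseteq> (\<Union>p\<in>\<C>. U p)"
  shows "\<exists>F m0. finite F \<and> F \<subseteq> \<C> \<and> (\<forall>m\<ge>m0. G m \<subseteq> (\<Union>p\<in>F. U p))"
proof -
  define f where "f = case_sum U (\<lambda>m. - G m)"
  have c: "UNIV \<subseteq> (\<Union>q\<in>Inl ` \<C> \<union> range Inr. f q)"
  proof
    fix y
    show "y \<in> (\<Union>q\<in>Inl ` \<C> \<union> range Inr. f q)"
    proof (cases "y \<in> (\<Inter>m. G m)")
      case True
      with cov obtain p where "p \<in> \<C>" "y \<in> U p" by blast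
      then show ?thesis by (intro UN_I[of "Inl p"]) (auto simp: f_def)
    next
      case False
      then obtain m where "y \<notin> G m" by blast
      then show ?thesis by (intro UN_I[of "Inr m"]) (auto simp: f_def)
    qed
  qed
  have o: "open (f q)" if "q \<in> Inl ` \<C> \<union> range Inr" for q
    using that U open_Compl[OF G(1)] by (auto simp: f_def)
  obtain Q where Q: "Q \<subseteq> Inl ` \<C> \<union> range Inr" "finite Q" "UNIV \<subseteq> (\<Union>q\<in>Q. f q)"
    by (rule compactE_image[OF compact o c])
  define F where "F = Inl -` Q"
  \<comment> \<open>The sum is a common upper bound of the indices, also when there are
    none.\<close>
  define m0 where "m0 = (\<Sum>m\<in>Inr -` Q. m)"
  have fin: "finite F" "finite (Inr -` Q)" unfolding F_def using Q(2) by (auto intro: finite_vimageI)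
  have "F \<subseteq> \<C>" using Q(1) by (auto simp: F_def)
  moreover have "G m \<subseteq> (\<Union>p\<in>F. U p)" if m: "m0 \<le> m" for m
  proof
    fix y assume y: "y \<in> G m"
    obtain q where q: "q \<in> Q" "y \<in> f q" using Q(3) by blast
    show "y \<in> (\<Union>p\<in>F. U p)"
    proof (cases q)
      case (Inl p)
      then show ?thesis using q by (auto simp: F_def f_def)
    next
      case (Inr k)
      then have "k \<le> m0" unfolding m0_def using q(1) fin(2) by (intro member_le_sum) auto
      then have "y \<in> G k" using y G(2)[of k m] m by auto
      then show ?thesis using q(2) Inr by (simp add: f_def)
    qed
  qed
  ultimately show ?thesis using fin(1) by blast
qed

end

text \<open>Stage \<open>i\<close> starts at time \<open>offset i\<close> and uses the superblocks
  \<open>S i\<close>. \<open>L_small\<close> makes a single superblock negligible against the time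
  already elapsed, so that times inside a block disturb neither averages nor counts.\<close>

locale moran_scheme = equivalent_metric d for d :: "'a::metric_space \<Rightarrow> 'a \<Rightarrow> real" +
  fixes T :: "'a \<Rightarrow> 'a" and g :: "nat \<Rightarrow> nat" and m :: "real \<Rightarrow> nat"
    and \<Phi> :: "'b::finite \<Rightarrow> 'a \<Rightarrow> real" and c :: "'b \<Rightarrow> real" and h e0 B :: real
    and L :: "nat \<Rightarrow> nat" and S :: "nat \<Rightarrow> ('a \<times> nat \<times> real) list set" and \<zeta> :: "nat \<Rightarrow> real"
    and offset :: "nat \<Rightarrow> nat"
  defines "offset \<equiv> \<lambda>i. \<Sum>k<i. L k"
  assumes compact: "compact (UNIV :: 'a set)" and T: "continuous_on UNIV T"
    and shadowing: "admissible m bs \<Longrightarrow> \<exists>y. shadows d T g bs y"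
    and B: "\<bar>\<Phi> j x\<bar> \<le> B" "\<bar>c j\<bar> \<le> B"
    and family: "superblock_family d T g m \<Phi> c h e0 (\<zeta> i) (L i) (S i)"
    and zeta: "\<zeta> \<longlonglongrightarrow> 0"
    and L_small: "0 < \<tau> \<Longrightarrow> eventually (\<lambda>i. real (L i) \<le> \<tau> * real (offset i)) sequentially"
begin

lemma L1: "1 \<le> L i" and S_fin: "finite (S i)" and S_card: "exp (h * real (L i)) \<le> real (card (S i))"
  using family[of i, unfolded superblock_family_def]
  by (rule conjunct1, rule conjunct2[THEN conjunct1], rule conjunct2[THEN conjunct2[THEN conjunct1]])

lemma S_adm: "admissible m s" and S_len: "block_length s = L i" if "s \<in> S i"
  using family[of i] that unfolding superblock_family_def by auto

lemma S_avg:
  assumes "s \<in> S i" "shadows d T g s y"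
  shows "\<bar>birkhoff_sum T (\<Phi> j) (L i) y - real (L i) * c j\<bar> \<le> \<zeta> i * real (L i)"
proof -
  have "\<forall>s\<in>S i. \<forall>y j. shadows d T g s y \<longrightarrow> \<bar>birkhoff_sum T (\<Phi> j) (L i) y - real (L i) * c j\<bar> \<le> \<zeta> i * real (L i)"
    using family[of i] unfolding superblock_family_def by (elim conjE)
  from this[rule_format, OF assms] show ?thesis .
qed

lemma S_sep:
  assumes "s \<in> S i" "t \<in> S i" "s \<noteq> t" "shadows d T g s y" "shadows d T g t z"
  shows "\<exists>a<L i. e0 < d ((T ^^ a) y) ((T ^^ a) z)"
proof -
  have "\<forall>s\<in>S i. \<forall>t\<in>S i. \<forall>y z. s \<noteq> t \<longrightarrow> shadows d T g s y \<longrightarrow> shadows d T g t z \<longrightarrow>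
      (\<exists>a<L i. e0 < d ((T ^^ a) y) ((T ^^ a) z))"
    using family[of i] unfolding superblock_family_def by (elim conjE)
  from this[rule_format, OF assms] show ?thesis .
qed

lemma offset_0 [simp]: "offset 0 = 0" and offset_Suc: "offset (Suc i) = offset i + L i"
  by (simp_all add: offset_def)

lemma offset_mono: "i \<le> j \<Longrightarrow> offset i \<le> offset j"
  unfolding offset_def by (intro sum_mono2) auto

lemma offset_ge: "i \<le> offset i"
  unfolding offset_def using sum_mono[of "{..<i}" "\<lambda>_. 1" L] L1 by simp

lemma offset_bracket: "\<exists>i. offset i \<le> l \<and> l < offset (Suc i)"
proof -
  have "\<exists>i. l < offset i" using offset_ge[of "Suc l"] by (intro exI[of _ "Suc l"]) auto
  then obtain i where i: "l < offset i" "\<And>k. k < i \<Longrightarrow> \<not> l < offset k"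
    using LeastI_ex[of "\<lambda>i. l < offset i"] not_less_Least[of _ "\<lambda>i. l < offset i"] by metis
  then obtain k where "i = Suc k" by (cases i) auto
  with i show ?thesis by (intro exI[of _ k]) (auto simp: not_less)
qed

text \<open>Each point may choose its own superblock at every stage. The intersection of the levels
  is the Moran set; finiteness of the \<open>S i\<close> makes the levels closed.\<close>

definition level :: "nat \<Rightarrow> 'a set" where
  "level n = {y. \<forall>i<n. \<exists>s\<in>S i. shadows d T g s ((T ^^ offset i) y)}"

lemma closed_level: "closed (level n)"
proof -
  have "level n = (\<Inter>i\<in>{..<n}. \<Union>s\<in>S i. (T ^^ offset i) -` {y. shadows d T g s y})"
    by (auto simp: level_def)
  also have "closed \<dots>"
  proof (intro closed_INT closed_UN ballI S_fin)
    fix i s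
    show "closed ((T ^^ offset i) -` {y. shadows d T g s y})"
      using continuous_closed_vimage[OF closed_shadows[OF T], of "T ^^ offset i"] continuous_on_funpow[OF T, of "offset i"]
      by (simp add: continuous_on_eq_continuous_at)
  qed
  finally show ?thesis .
qed

lemma level_antimono: "n \<le> k \<Longrightarrow> level k \<subseteq> level n"
  by (auto simp: level_def)

text \<open>Admissibility concerns single triples and is inherited by concatenations; shadowing a
  concatenation splits into shadowing its parts at the offsets.\<close>

lemma exists_shadowing_point:
  assumes "\<And>i. i < n \<Longrightarrow> \<sigma> i \<in> S i"
  shows "\<exists>y. \<forall>i<n. shadows d T g (\<sigma> i) ((T ^^ offset i) y)"
proof -
  define bs where "bs k = concat (map \<sigma> [0..<k])" for k
  have Suc: "bs (Suc k) = bs k @ \<sigma> k" for k by (simp add: bs_def)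
  have len: "block_length (bs k) = offset k" if "k \<le> n" for k
    using that
  proof (induction k)
    case 0
    then show ?case by (simp add: bs_def)
  next
    case (Suc k)
    then show ?case using assms S_len by (simp add: \<open>\<And>k. bs (Suc k) = bs k @ \<sigma> k\<close> offset_Suc)
  qed
  have adm: "admissible m (bs n)" using assms S_adm by (fastforce simp: admissible_def bs_def)
  then obtain y where y: "shadows d T g (bs n) y" using shadowing by blast
  have "shadows d T g (bs k) y \<longleftrightarrow> (\<forall>i<k. shadows d T g (\<sigma> i) ((T ^^ offset i) y))" if "k \<le> n" for k
    using that
  proof (induction k)
    case 0
    then show ?case by (simp add: bs_def)
  next
    case (Suc k)
    then show ?case by (simp add: \<open>\<And>k. bs (Suc k) = bs k @ \<sigma> k\<close> shadows_append len less_Suc_eq conj_commute all_conj_distrib imp_conjR disj_imp)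
        (auto simp: less_Suc_eq)
  qed
  with y show ?thesis by blast
qed

lemma level_birkhoff_offset:
  assumes y: "y \<in> level n" and i: "i \<le> n"
  shows "\<bar>birkhoff_sum T (\<Phi> j) (offset i) y - real (offset i) * c j\<bar> \<le> (\<Sum>k<i. \<zeta> k * real (L k))"
  using i
proof (induction i)
  case 0
  then show ?case by (simp add: birkhoff_sum_def)
next
  case (Suc i)
  from y Suc.prems have "\<exists>s\<in>S i. shadows d T g s ((T ^^ offset i) y)" by (simp add: level_def)
  then obtain s where "s \<in> S i" "shadows d T g s ((T ^^ offset i) y)" ..
  from S_avg[OF this, of j] Suc birkhoff_sum_add[of T "\<Phi> j" "offset i" "L i" y] show ?case
    by (simp add: offset_Suc algebra_simps)
qed

text \<open>A time is split at the last completed offset; the superblock begun there costs at most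
  \<open>2 * B * real (L i)\<close>. The threshold depends neither on the point nor on the level, so
  it can be fixed before a cover is given.\<close>

lemma level_birkhoff:
  assumes tau: "0 < \<tau>"
  obtains i0 where "\<And>n y l j. y \<in> level n \<Longrightarrow> offset i0 \<le> l \<Longrightarrow> l < offset n \<Longrightarrow>
    \<bar>birkhoff_sum T (\<Phi> j) l y - real l * c j\<bar> \<le> \<tau> * real l"
proof -
  have "eventually (\<lambda>i. (\<Sum>k<i. \<zeta> k * real (L k)) + 2 * B * real (L i) \<le> \<tau> * real (offset i)) sequentially"
    unfolding offset_def using L1 zeta tau L_small unfolding offset_def by (intro weighted_average_small)
  then obtain i0 where i0: "\<And>i. i0 \<le> i \<Longrightarrow> (\<Sum>k<i. \<zeta> k * real (L k)) + 2 * B * real (L i) \<le> \<tau> * real (offset i)"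
    by (auto simp: eventually_sequentially)
  have "\<bar>birkhoff_sum T (\<Phi> j) l y - real l * c j\<bar> \<le> \<tau> * real l"
    if y: "y \<in> level n" and l: "offset i0 \<le> l" "l < offset n" for n y l j
  proof -
    obtain i where i: "offset i \<le> l" "l < offset (Suc i)" using offset_bracket by blast
    have "i0 \<le> i"
    proof (rule ccontr)
      assume "\<not> i0 \<le> i"
      then have "offset (Suc i) \<le> offset i0" by (intro offset_mono) auto
      with i l show False by simp
    qed
    have "i < n"
    proof (rule ccontr)
      assume "\<not> i < n"
      then have "offset n \<le> offset i" by (intro offset_mono) auto
      with i l show False by simp
    qed
    define b where "b = l - offset i"
    have lb: "l = offset i + b" "b \<le> L i" using i by (auto simp: b_def offset_Suc)
    have B0: "0 \<le> B" using B(2)[of j] by linarith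
    have "\<bar>birkhoff_sum T (\<Phi> j) b ((T ^^ offset i) y)\<bar> \<le> real b * B" by (rule abs_birkhoff_sum_le[OF B(1)])
    moreover have "\<bar>real b * c j\<bar> \<le> real b * B" unfolding abs_mult using B(2) by (intro mult_mono) auto
    moreover have "real b * B \<le> real (L i) * B" using lb B0 by (intro mult_right_mono) auto
    moreover have "birkhoff_sum T (\<Phi> j) l y = birkhoff_sum T (\<Phi> j) (offset i) y + birkhoff_sum T (\<Phi> j) b ((T ^^ offset i) y)"
      unfolding lb(1) by (rule birkhoff_sum_add)
    moreover have "real l * c j = real (offset i) * c j + real b * c j" by (simp add: lb(1) distrib_right)
    moreover have "\<tau> * real (offset i) \<le> \<tau> * real l" using i tau by (intro mult_left_mono) auto
    ultimately show ?thesis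
      using level_birkhoff_offset[OF y, of i j] \<open>i < n\<close> i0[OF \<open>i0 \<le> i\<close>] by (simp add: mult.commute mult.left_commute)
  qed
  then show ?thesis using that by blast
qed

lemma limit_birkhoff:
  assumes y: "y \<in> (\<Inter>n. level n)"
  shows "(\<lambda>n. birkhoff_sum T (\<Phi> j) n y / real n) \<longlonglongrightarrow> c j"
proof (rule tendstoI)
  fix e :: real assume e: "0 < e"
  have e2: "0 < e / 2" using e by simp
  have "\<exists>i0. \<forall>n y l j. y \<in> level n \<longrightarrow> offset i0 \<le> l \<longrightarrow> l < offset n \<longrightarrow>
    \<bar>birkhoff_sum T (\<Phi> j) l y - real l * c j\<bar> \<le> e / 2 * real l"
    by (rule level_birkhoff[OF e2]) blast
  then obtain i0 where i0: "\<forall>n y l j. y \<in> level n \<longrightarrow> offset i0 \<le> l \<longrightarrow> l < offset n \<longrightarrow>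
    \<bar>birkhoff_sum T (\<Phi> j) l y - real l * c j\<bar> \<le> e / 2 * real l" ..
  have "eventually (\<lambda>l. max 1 (offset i0) \<le> l) sequentially" by (rule eventually_ge_at_top)
  then show "eventually (\<lambda>n. dist (birkhoff_sum T (\<Phi> j) n y / real n) (c j) < e) sequentially"
  proof eventually_elim
    case (elim l)
    have "l < offset (Suc l)" using offset_ge[of "Suc l"] by simp
    then have "\<bar>birkhoff_sum T (\<Phi> j) l y - real l * c j\<bar> \<le> e / 2 * real l" using i0 y elim by auto
    moreover have "birkhoff_sum T (\<Phi> j) l y / real l - c j = (birkhoff_sum T (\<Phi> j) l y - real l * c j) / real l"
      using elim by (simp add: field_simps)
    ultimately have "\<bar>birkhoff_sum T (\<Phi> j) l y / real l - c j\<bar> \<le> e / 2"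
      using elim by (simp add: divide_le_eq abs_divide)
    then show ?case using e by (simp add: dist_real_def)
  qed
qed

text \<open>Codes whose points stay within \<open>e0\<close> of each other before time
  \<open>l\<close> agree in the first \<open>i\<close> superblocks, which are completed by then, and
  are therefore determined by the remaining stages; these first stages alone admit at least
  \<open>exp (h * real (offset i))\<close> choices.\<close>

lemma card_coded_le:
  fixes l :: nat and p :: "(nat \<Rightarrow> ('a \<times> nat \<times> real) list) \<Rightarrow> 'a"
  assumes p: "\<And>\<sigma> i. \<sigma> \<in> PiE {..<n} S \<Longrightarrow> i < n \<Longrightarrow> shadows d T g (\<sigma> i) ((T ^^ offset i) (p \<sigma>))"
    and l: "offset i \<le> l" "i \<le> n"
    and H: "H \<subseteq> PiE {..<n} S" "\<And>\<sigma> \<sigma>' a. \<sigma> \<in> H \<Longrightarrow> \<sigma>' \<in> H \<Longrightarrow> a < l \<Longrightarrow> d ((T ^^ a) (p \<sigma>)) ((T ^^ a) (p \<sigma>')) \<le> e0"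
  shows "real (card H) * exp (h * real (offset i)) \<le> real (card (PiE {..<n} S))"
proof -
  have "inj_on (\<lambda>\<sigma>. restrict \<sigma> {i..<n}) H"
  proof (rule inj_onI, rule ccontr)
    fix \<sigma> \<sigma>' assume h: "\<sigma> \<in> H" "\<sigma>' \<in> H" and eq: "restrict \<sigma> {i..<n} = restrict \<sigma>' {i..<n}" and ne: "\<sigma> \<noteq> \<sigma>'"
    have sigma: "\<sigma> \<in> PiE {..<n} S" "\<sigma>' \<in> PiE {..<n} S" using h H(1) by auto
    obtain k where k: "k < n" "\<sigma> k \<noteq> \<sigma>' k"
      using PiE_ext[OF sigma] ne by blast
    have "k < i"
    proof (rule ccontr)
      assume "\<not> k < i"
      then show False using fun_cong[OF eq, of k] k by simp
    qed
    have "\<sigma> k \<in> S k" "\<sigma>' k \<in> S k" using sigma k(1) by auto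
    from S_sep[OF this k(2) p[OF sigma(1) k(1)] p[OF sigma(2) k(1)]]
    obtain a where a: "a < L k" "e0 < d ((T ^^ a) ((T ^^ offset k) (p \<sigma>))) ((T ^^ a) ((T ^^ offset k) (p \<sigma>')))" by blast
    have "a + offset k < offset (Suc k)" using a(1) by (simp add: offset_Suc)
    also have "\<dots> \<le> l" using offset_mono[of "Suc k" i] \<open>k < i\<close> l(1) by simp
    finally have "d ((T ^^ (a + offset k)) (p \<sigma>)) ((T ^^ (a + offset k)) (p \<sigma>')) \<le> e0" by (rule H(2)[OF h])
    with a(2) show False by (simp add: funpow_add)
  qed
  then have "card H = card ((\<lambda>\<sigma>. restrict \<sigma> {i..<n}) ` H)" by (simp add: card_image)
  also have "\<dots> \<le> card (PiE {i..<n} S)"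
  proof (rule card_mono)
    show "finite (PiE {i..<n} S)" by (intro finite_PiE S_fin) auto
    show "(\<lambda>\<sigma>. restrict \<sigma> {i..<n}) ` H \<subseteq> PiE {i..<n} S" using H(1) by (fastforce simp: PiE_iff)
  qed
  also have "\<dots> = (\<Prod>k\<in>{i..<n}. card (S k))" by (rule card_PiE) simp
  finally have H_le: "real (card H) \<le> (\<Prod>k\<in>{i..<n}. real (card (S k)))" by (simp flip: of_nat_prod)
  have "exp (h * real (offset i)) = (\<Prod>k<i. exp (h * real (L k)))"
    by (simp add: exp_sum[symmetric] offset_def sum_distrib_left)
  also have "\<dots> \<le> (\<Prod>k<i. real (card (S k)))" by (intro prod_mono conjI S_card) auto
  finally have "real (card H) * exp (h * real (offset i)) \<le> (\<Prod>k\<in>{i..<n}. real (card (S k))) * (\<Prod>k<i. real (card (S k)))"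
    using H_le by (intro mult_mono) (auto intro: prod_nonneg)
  also have "\<dots> = (\<Prod>k<n. real (card (S k)))"
  proof -
    have "{..<n} = {i..<n} \<union> {..<i}" using l(2) by auto
    moreover have "{i..<n} \<inter> {..<i} = {}" by auto
    ultimately show ?thesis using prod.union_disjoint[of "{i..<n}" "{..<i}" "\<lambda>k. real (card (S k))"] by simp
  qed
  also have "\<dots> = real (card (PiE {..<n} S))" by (simp add: card_PiE)
  finally show ?thesis .
qed

text \<open>A finite cover of a level by Bowen balls is compared with the uniform count of the coded
  points: a ball of length \<open>l\<close> contains at most the fraction \<open>exp (- (h - \<tau>) l)\<close> of them.\<close>

lemma cover_sum_ge:
  assumes eps: "0 < \<epsilon>" "4 * \<epsilon> \<le> e0" and omega: "\<And>x y. d x y \<le> 2 * \<epsilon> \<Longrightarrow> \<bar>\<Phi> j0 x - \<Phi> j0 y\<bar> \<le> \<omega>"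
    and tau: "0 < \<tau>" and t: "t \<le> h + c j0 - \<omega> - 2 * \<tau>" and Z: "(\<Inter>n. level n) \<subseteq> Z"
  shows "\<exists>N. \<forall>\<C>\<in>bowen_covers d T Z N \<epsilon>. \<exists>F. finite F \<and> F \<subseteq> \<C> \<and>
    1 \<le> (\<Sum>(l, x)\<in>F. exp (- t * real l + (SUP y\<in>bowen_ball d T l x \<epsilon>. birkhoff_sum T (\<Phi> j0) l y)))"
proof -
  have "\<exists>i1. \<forall>n y l j. y \<in> level n \<longrightarrow> offset i1 \<le> l \<longrightarrow> l < offset n \<longrightarrow>
    \<bar>birkhoff_sum T (\<Phi> j) l y - real l * c j\<bar> \<le> \<tau> * real l"
    by (rule level_birkhoff[OF tau]) blast
  then obtain i1 where i1: "\<forall>n y l j. y \<in> level n \<longrightarrow> offset i1 \<le> l \<longrightarrow> l < offset n \<longrightarrow>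
    \<bar>birkhoff_sum T (\<Phi> j) l y - real l * c j\<bar> \<le> \<tau> * real l" ..
  \<comment> \<open>With this ratio \<open>h * l\<close> exceeds \<open>h * offset i\<close> by at
    most \<open>\<tau> * l\<close>. The absolute value allows negative \<open>h\<close>, and the
    summand 1 keeps the denominator positive.\<close>
  have th: "0 < \<tau> / (\<bar>h\<bar> + 1)" using tau by simp
  obtain i2 where i2: "\<And>i. i2 \<le> i \<Longrightarrow> real (L i) \<le> \<tau> / (\<bar>h\<bar> + 1) * real (offset i)"
    using L_small[OF th] by (auto simp: eventually_sequentially)
  define N where "N = offset (max i1 i2)"
  show ?thesis
  proof (rule exI[of _ N], rule ballI)
    fix \<C> assume cover: "\<C> \<in> bowen_covers d T Z N \<epsilon>"
    \<comment> \<open>Compactness needs open sets, so the closed balls are enlarged to open ones of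
      radius \<open>2 * \<epsilon>\<close>. Two points of one of them are closer than
      \<open>4 * \<epsilon>\<close> at all its times, whence the condition
      \<open>4 * \<epsilon> \<le> e0\<close>.\<close>
    define U where "U = (\<lambda>(l, x). {y. \<forall>i\<in>{..<l}. d ((T ^^ i) x) ((T ^^ i) y) < 2 * \<epsilon>})"
    have U_open: "open (U q)" for q
    proof -
      obtain l x where q: "q = (l, x)" by (cases q)
      have eq: "U q = (\<Inter>i\<in>{..<l}. {y. d ((T ^^ i) x) ((T ^^ i) y) < 2 * \<epsilon>})"
        unfolding U_def q by blast
      have "open {y. d ((T ^^ i) x) ((T ^^ i) y) < 2 * \<epsilon>}" for i
        by (intro open_Collect_less continuous_on_const
            continuous_on_compose2[OF continuous_on_d continuous_on_funpow[OF T]]) auto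
      then show ?thesis unfolding eq by (intro open_INT) auto
    qed
    have "(\<Inter>n. level n) \<subseteq> (\<Union>q\<in>\<C>. U q)"
    proof -
      have "bowen_ball d T l x \<epsilon> \<subseteq> U (l, x)" for l x
        using eps(1) unfolding bowen_ball_def U_def by force
      then have "(\<Union>(l, x)\<in>\<C>. bowen_ball d T l x \<epsilon>) \<subseteq> (\<Union>q\<in>\<C>. U q)" by (intro UN_mono) auto
      moreover have "Z \<subseteq> (\<Union>(l, x)\<in>\<C>. bowen_ball d T l x \<epsilon>)" using cover by (simp add: bowen_covers_def)
      ultimately show ?thesis using Z by (meson order.trans)
    qed
    then have "\<exists>F n0. finite F \<and> F \<subseteq> \<C> \<and> (\<forall>n\<ge>n0. level n \<subseteq> (\<Union>q\<in>F. U q))"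
      using U_open closed_level level_antimono by (intro finite_subcover_decreasing compact)
    then obtain F n0 where F: "finite F" "F \<subseteq> \<C>" and F_cov: "\<forall>n\<ge>n0. level n \<subseteq> (\<Union>q\<in>F. U q)" by blast
    \<comment> \<open>Deep enough for the finite subcover to work on \<open>level n\<close>, and for
      each of its balls to be shorter than the coded part of the orbits.\<close>
    define n where "n = max n0 (Suc (\<Sum>q\<in>F. fst q))"
    have l_less: "fst q < offset n" if "q \<in> F" for q
    proof -
      have "fst q \<le> (\<Sum>q\<in>F. fst q)" using that F(1) by (intro member_le_sum) auto
      then show ?thesis using offset_ge[of n] by (simp add: n_def)
    qed
    define C where "C = PiE {..<n} S"
    have C_fin: "finite C" unfolding C_def by (intro finite_PiE S_fin) auto
    have "S i \<noteq> {}" for i using S_card[of i] exp_gt_zero[of "h * real (L i)"] by force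
    then have "C \<noteq> {}" unfolding C_def PiE_eq_empty_iff by blast
    then have C_pos: "0 < real (card C)" using C_fin by (simp add: card_gt_0_iff)
    have "\<forall>\<sigma>\<in>C. \<exists>y. \<forall>i<n. shadows d T g (\<sigma> i) ((T ^^ offset i) y)"
      unfolding C_def by (intro ballI exists_shadowing_point) auto
    then obtain p where p: "\<And>\<sigma> i. \<sigma> \<in> C \<Longrightarrow> i < n \<Longrightarrow> shadows d T g (\<sigma> i) ((T ^^ offset i) (p \<sigma>))" by metis
    have p_level: "p \<sigma> \<in> level n" if "\<sigma> \<in> C" for \<sigma>
    proof -
      have "\<sigma> i \<in> S i" if "i < n" for i using \<open>\<sigma> \<in> C\<close> that by (auto simp: C_def)
      then show ?thesis using p[OF that] by (auto simp: level_def)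
    qed
    define H where "H q = {\<sigma> \<in> C. p \<sigma> \<in> U q}" for q
    define f where "f = (\<lambda>(l, x). exp (- t * real l + (SUP y\<in>bowen_ball d T l x \<epsilon>. birkhoff_sum T (\<Phi> j0) l y)))"
    have H_le: "real (card (H q)) \<le> real (card C) * f q" if q: "q \<in> F" for q
    proof (cases "H q = {}")
      case True
      then show ?thesis by (simp add: f_def case_prod_unfold)
    next
      case False
      then obtain \<sigma> where sigma: "\<sigma> \<in> C" "p \<sigma> \<in> U q" by (auto simp: H_def)
      obtain l x where lx: "q = (l, x)" by (cases q)
      have "N \<le> l" using cover q F(2) lx by (auto simp: bowen_covers_def)
      have "l < offset n" using l_less[OF q] lx by simp
      obtain i where i: "offset i \<le> l" "l < offset (Suc i)" using offset_bracket by blast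
      have "i < n"
      proof (rule ccontr)
        assume "\<not> i < n"
        then have "offset n \<le> offset i" by (intro offset_mono) auto
        with i \<open>l < offset n\<close> show False by simp
      qed
      have imax: "max i1 i2 \<le> i"
      proof (rule ccontr)
        assume "\<not> max i1 i2 \<le> i"
        then have "offset (Suc i) \<le> N" unfolding N_def by (intro offset_mono) auto
        with i \<open>N \<le> l\<close> show False by simp
      qed
      have "real (card (H q)) * exp (h * real (offset i)) \<le> real (card C)"
        unfolding C_def
      proof (rule card_coded_le[where p = p and l = l])
        show "shadows d T g (\<sigma> k) ((T ^^ offset k) (p \<sigma>))" if "\<sigma> \<in> PiE {..<n} S" "k < n" for \<sigma> k
          using p that by (simp add: C_def)
        show "H q \<subseteq> PiE {..<n} S" by (auto simp: H_def C_def)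
        show "d ((T ^^ a) (p \<sigma>)) ((T ^^ a) (p \<sigma>')) \<le> e0" if "\<sigma> \<in> H q" "\<sigma>' \<in> H q" "a < l" for \<sigma> \<sigma>' a
        proof -
          have "d ((T ^^ a) x) ((T ^^ a) (p \<sigma>)) < 2 * \<epsilon>" "d ((T ^^ a) x) ((T ^^ a) (p \<sigma>')) < 2 * \<epsilon>"
            using that by (auto simp: H_def U_def lx)
          then show ?thesis
            using d_triangle[of "(T ^^ a) (p \<sigma>)" "(T ^^ a) (p \<sigma>')" "(T ^^ a) x"] d_sym[of "(T ^^ a) x" "(T ^^ a) (p \<sigma>)"] eps(2) by linarith
        qed
      qed (use i \<open>i < n\<close> in auto)
      also have "real (card (H q)) * exp ((h - \<tau>) * real l) \<le> real (card (H q)) * exp (h * real (offset i))"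
      proof (intro mult_left_mono)
        have "\<bar>h\<bar> * real (L i) \<le> (\<bar>h\<bar> + 1) * (\<tau> / (\<bar>h\<bar> + 1) * real (offset i))"
          using i2[of i] imax by (intro mult_mono) auto
        also have "\<dots> = \<tau> * real (offset i)" by (simp add: field_simps)
        also have "\<dots> \<le> \<tau> * real l" using i tau by (intro mult_left_mono) auto
        finally have "\<bar>h\<bar> * real (L i) \<le> \<tau> * real l" .
        moreover have "h * (real l - real (offset i)) \<le> \<bar>h\<bar> * real (L i)"
          using i by (intro mult_mono) (auto simp: offset_Suc)
        ultimately show "exp ((h - \<tau>) * real l) \<le> exp (h * real (offset i))" by (simp add: algebra_simps)
      qed simp
      finally have card_H: "real (card (H q)) * exp ((h - \<tau>) * real l) \<le> real (card C)" .
      \<comment> \<open>One \<open>\<tau>\<close> has been spent on the count and the other covers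
        the deviation of the average along \<open>p \<sigma>\<close>; \<open>\<omega>\<close> pays
        for moving from \<open>p \<sigma>\<close> to the centre \<open>x\<close>.\<close>
      have "(h - \<tau>) * (- real l) \<le> - t * real l + (SUP y\<in>bowen_ball d T l x \<epsilon>. birkhoff_sum T (\<Phi> j0) l y)"
      proof -
        have "\<bar>birkhoff_sum T (\<Phi> j0) l (p \<sigma>) - real l * c j0\<bar> \<le> \<tau> * real l"
        proof -
          have "offset i1 \<le> l" using offset_mono[of i1 i] imax i(1) by simp
          then show ?thesis using i1 p_level[OF sigma(1)] \<open>l < offset n\<close> by blast
        qed
        moreover have "birkhoff_sum T (\<Phi> j0) l (p \<sigma>) \<le> birkhoff_sum T (\<Phi> j0) l x + real l * \<omega>"
        proof -
          have "birkhoff_sum T (\<Phi> j0) l (p \<sigma>) \<le> (\<Sum>k<l. \<Phi> j0 ((T ^^ k) x) + \<omega>)"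
            unfolding birkhoff_sum_def
          proof (rule sum_mono)
            fix k assume "k \<in> {..<l}"
            then have "d ((T ^^ k) x) ((T ^^ k) (p \<sigma>)) \<le> 2 * \<epsilon>" using sigma(2) by (auto simp: U_def lx intro: less_imp_le)
            from omega[OF this] show "\<Phi> j0 ((T ^^ k) (p \<sigma>)) \<le> \<Phi> j0 ((T ^^ k) x) + \<omega>" by linarith
          qed
          then show ?thesis by (simp add: birkhoff_sum_def sum.distrib)
        qed
        moreover have "birkhoff_sum T (\<Phi> j0) l x \<le> (SUP y\<in>bowen_ball d T l x \<epsilon>. birkhoff_sum T (\<Phi> j0) l y)"
        proof (rule cSUP_upper)
          show "x \<in> bowen_ball d T l x \<epsilon>" using eps(1) by (simp add: bowen_ball_def)
          have "birkhoff_sum T (\<Phi> j0) l y \<le> real l * B" for y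
            using abs_birkhoff_sum_le[of "\<Phi> j0" B T l y] B(1) by (simp add: abs_le_iff)
          then show "bdd_above (birkhoff_sum T (\<Phi> j0) l ` bowen_ball d T l x \<epsilon>)" by (intro bdd_aboveI2)
        qed
        moreover have "t * real l \<le> (h + c j0 - \<omega> - 2 * \<tau>) * real l" using t by (intro mult_right_mono) auto
        ultimately show ?thesis by (simp add: algebra_simps abs_le_iff)
      qed
      then have "exp (- ((h - \<tau>) * real l)) \<le> f q" by (simp add: f_def lx)
      have "real (card (H q)) = real (card (H q)) * exp ((h - \<tau>) * real l) * exp (- ((h - \<tau>) * real l))"
        by (simp only: mult.assoc mult_exp_exp add.right_inverse exp_zero mult_1_right)
      also have "\<dots> \<le> real (card C) * f q"
        using card_H \<open>exp (- ((h - \<tau>) * real l)) \<le> f q\<close> by (intro mult_mono) auto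
      finally show ?thesis .
    qed
    have "C \<subseteq> (\<Union>q\<in>F. H q)"
    proof
      fix \<sigma> assume s: "\<sigma> \<in> C"
      have "level n \<subseteq> (\<Union>q\<in>F. U q)" using F_cov by (simp add: n_def)
      then show "\<sigma> \<in> (\<Union>q\<in>F. H q)" using p_level[OF s] s by (auto simp: H_def)
    qed
    then have "card C \<le> card (\<Union>q\<in>F. H q)" using F(1) C_fin by (intro card_mono) (auto simp: H_def)
    also have "\<dots> \<le> (\<Sum>q\<in>F. card (H q))" by (rule card_UN_le[OF F(1)])
    finally have "real (card C) \<le> (\<Sum>q\<in>F. real (card (H q)))" by (simp flip: of_nat_sum)
    also have "\<dots> \<le> (\<Sum>q\<in>F. real (card C) * f q)" by (intro sum_mono H_le)
    also have "\<dots> = real (card C) * (\<Sum>q\<in>F. f q)" by (rule sum_distrib_left[symmetric])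
    finally have "1 \<le> (\<Sum>q\<in>F. f q)" using C_pos by simp
    then show "\<exists>F. finite F \<and> F \<subseteq> \<C> \<and>
      1 \<le> (\<Sum>(l, x)\<in>F. exp (- t * real l + (SUP y\<in>bowen_ball d T l x \<epsilon>. birkhoff_sum T (\<Phi> j0) l y)))"
      using F by (intro exI[of _ F]) (simp add: f_def)
  qed
qed

lemma pressure_at_ge:
  assumes eps: "0 < \<epsilon>" "4 * \<epsilon> \<le> e0" and omega: "\<And>x y. d x y \<le> 2 * \<epsilon> \<Longrightarrow> \<bar>\<Phi> j0 x - \<Phi> j0 y\<bar> \<le> \<omega>"
    and Z: "\<And>x. (\<And>j. (\<lambda>n. birkhoff_sum T (\<Phi> j) n x / real n) \<longlonglongrightarrow> c j) \<Longrightarrow> x \<in> Z"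
  shows "ereal (h + c j0 - \<omega>) \<le> pressure_at d T Z (\<Phi> j0) \<epsilon>"
  unfolding pressure_at_def
proof (rule INF_greatest, rule ccontr)
  fix t assume t: "t \<in> {t. pressure_limit d T Z t (\<Phi> j0) \<epsilon> = 0}" "\<not> ereal (h + c j0 - \<omega>) \<le> ereal t"
  define \<tau> where "\<tau> = (h + c j0 - \<omega> - t) / 2"
  have tau: "0 < \<tau>" "t \<le> h + c j0 - \<omega> - 2 * \<tau>" using t(2) by (simp_all add: \<tau>_def field_simps)
  have "(\<Inter>n. level n) \<subseteq> Z" using Z limit_birkhoff by blast
  from cover_sum_ge[OF eps omega tau this] obtain N where N: "\<forall>\<C>\<in>bowen_covers d T Z N \<epsilon>. \<exists>F. finite F \<and> F \<subseteq> \<C> \<and>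
    1 \<le> (\<Sum>(l, x)\<in>F. exp (- t * real l + (SUP y\<in>bowen_ball d T l x \<epsilon>. birkhoff_sum T (\<Phi> j0) l y)))" ..
  have "ennreal 1 \<le> pressure_sum d T Z t (\<Phi> j0) N \<epsilon>"
    by (rule pressure_sum_ge) (rule N[rule_format])
  also have "\<dots> \<le> pressure_limit d T Z t (\<Phi> j0) \<epsilon>" by (rule pressure_sum_le_pressure_limit)
  finally show False using t(1) by simp
qed

end

section \<open>The pressure formula\<close>

text \<open>The time elapsed before superblock \<open>i\<close> is at least \<open>i\<close>, so the
  condition makes this superblock at most as long as that time divided by \<open>\<kappa> i\<close>.
  However fast \<open>L\<close> grows, waiting long enough before raising the index achieves
  this.\<close>

lemma slow_index_sequence:
  fixes L :: "nat \<Rightarrow> nat"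
  obtains \<kappa> where "filterlim \<kappa> at_top sequentially" "\<And>i. \<kappa> i * L (\<kappa> i) \<le> i"
proof -
  define \<kappa> where "\<kappa> i = Max {k. k \<le> i \<and> k * L k \<le> i}" for i
  have fin: "finite {k. k \<le> i \<and> k * L k \<le> i}" for i by simp
  have "\<kappa> i \<in> {k. k \<le> i \<and> k * L k \<le> i}" for i
    unfolding \<kappa>_def by (intro Max_in fin) (auto intro!: exI[of _ 0])
  moreover have "filterlim \<kappa> at_top sequentially"
    unfolding filterlim_at_top
  proof
    fix K
    show "eventually (\<lambda>i. K \<le> \<kappa> i) sequentially"
      using eventually_ge_at_top[of "max K (K * L K)"]
    proof eventually_elim
      case (elim i)
      then show ?case unfolding \<kappa>_def by (intro Max_ge fin) auto
    qed
  qed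
  ultimately show ?thesis using that by blast
qed

context equivalent_metric
begin

text \<open>Since \<open>e0\<close> is fixed before \<open>\<epsilon>\<close> and
  \<open>\<omega>\<close>, the estimate serves all small \<open>\<epsilon>\<close> at once, as the
  limit in the definition of pressure demands.\<close>

theorem pressure_at_lower_bound:
  fixes T :: "'a \<Rightarrow> 'a" and \<Phi> :: "'b::finite \<Rightarrow> 'a \<Rightarrow> real"
  assumes compact: "compact (UNIV :: 'a set)" and T: "continuous_on UNIV T" and mu: "\<mu> \<in> invariant_measures T"
    and g: "(\<lambda>n. real (g n) / real n) \<longlonglongrightarrow> 0" and product: "almost_product d T g"
    and h: "ereal h < metric_entropy T \<mu>" and Phi: "\<And>j. continuous_on UNIV (\<Phi> j)"
    and Z: "\<And>x. (\<And>j. (\<lambda>n. birkhoff_sum T (\<Phi> j) n x / real n) \<longlonglongrightarrow> integral\<^sup>L \<mu> (\<Phi> j)) \<Longrightarrow> x \<in> Z"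
  shows "\<exists>e0>0. \<forall>\<epsilon> \<omega>. 0 < \<epsilon> \<longrightarrow> 4 * \<epsilon> \<le> e0 \<longrightarrow> (\<forall>x y. d x y \<le> 2 * \<epsilon> \<longrightarrow> \<bar>\<Phi> j0 x - \<Phi> j0 y\<bar> \<le> \<omega>) \<longrightarrow>
    ereal (h + integral\<^sup>L \<mu> (\<Phi> j0) - \<omega>) \<le> pressure_at d T Z (\<Phi> j0) \<epsilon>"
proof -
  have "\<exists>m. \<forall>bs. admissible m bs \<longrightarrow> (\<exists>y. shadows d T g bs y)"
    by (rule almost_product_shadows[OF product]) blast
  then obtain m where m: "\<forall>bs. admissible m bs \<longrightarrow> (\<exists>y. shadows d T g bs y)" ..
  obtain e0 where e0: "0 < e0"
    "\<forall>\<zeta>>0. \<exists>L S. superblock_family d T g m \<Phi> (\<lambda>j. integral\<^sup>L \<mu> (\<Phi> j)) h e0 \<zeta> L S"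
    using superblocks[where m = m and \<Phi> = \<Phi>, OF compact T mu g h Phi] by blast
  have "\<exists>L S. superblock_family d T g m \<Phi> (\<lambda>j. integral\<^sup>L \<mu> (\<Phi> j)) h e0 (1 / real (Suc k)) L S" for k
    using e0(2) by simp
  then obtain L' S' where LS':
    "\<And>k. superblock_family d T g m \<Phi> (\<lambda>j. integral\<^sup>L \<mu> (\<Phi> j)) h e0 (1 / real (Suc k)) (L' k) (S' k)" by metis
  obtain \<kappa> where kappa: "filterlim \<kappa> at_top sequentially" "\<And>i. \<kappa> i * L' (\<kappa> i) \<le> i"
    by (rule slow_index_sequence[of L']) blast
  \<comment> \<open>Nothing is known about the growth of the lengths \<open>L'\<close>; reindexing
    by \<open>\<kappa>\<close> repeats the families often enough, while the precision still tends to
    0.\<close>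
  define L S \<zeta> where "L i = L' (\<kappa> i)" and "S i = S' (\<kappa> i)" and "\<zeta> i = 1 / real (Suc (\<kappa> i))" for i
  have family: "superblock_family d T g m \<Phi> (\<lambda>j. integral\<^sup>L \<mu> (\<Phi> j)) h e0 (\<zeta> i) (L i) (S i)" for i
    using LS' by (simp add: L_def S_def \<zeta>_def)
  have L1: "1 \<le> L i" for i using family[of i] by (simp add: superblock_family_def)
  have "\<exists>B. \<forall>x. \<bar>\<Phi> j x\<bar> \<le> B" for j
    using continuous_bounded_compact[OF compact Phi[of j]] by blast
  then obtain b where b: "\<And>j x. \<bar>\<Phi> j x\<bar> \<le> b j" by metis
  define B where "B = (\<Sum>j\<in>UNIV. b j + \<bar>integral\<^sup>L \<mu> (\<Phi> j)\<bar>)"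
  have b0: "0 \<le> b j" for j using order.trans[OF abs_ge_zero b[of j undefined]] .
  have le_B: "b j + \<bar>integral\<^sup>L \<mu> (\<Phi> j)\<bar> \<le> B" for j
    unfolding B_def using b0 by (intro member_le_sum) auto
  interpret moran_scheme d T g m \<Phi> "\<lambda>j. integral\<^sup>L \<mu> (\<Phi> j)" h e0 B L S \<zeta> "\<lambda>i. \<Sum>k<i. L k"
  proof unfold_locales
    show "\<exists>y. shadows d T g bs y" if "admissible m bs" for bs using m that by blast
    show "\<bar>\<Phi> j x\<bar> \<le> B" for j x using b[of j x] le_B[of j] by linarith
    show "\<bar>integral\<^sup>L \<mu> (\<Phi> j)\<bar> \<le> B" for j using b0[of j] le_B[of j] by linarith
    have "(\<lambda>k. 1 / real (Suc k)) \<longlonglongrightarrow> 0" by real_asymp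
    from filterlim_compose[OF this kappa(1)] show "\<zeta> \<longlonglongrightarrow> 0" by (simp add: \<zeta>_def[abs_def])
    show "eventually (\<lambda>i. real (L i) \<le> \<tau> * real (\<Sum>k<i. L k)) sequentially" if tau: "0 < \<tau>" for \<tau>
    proof -
      have "eventually (\<lambda>k. 1 / \<tau> \<le> real k) sequentially"
        by (rule eventually_compose_filterlim[OF eventually_ge_at_top filterlim_real_sequentially])
      from eventually_compose_filterlim[OF this kappa(1)]
      show ?thesis
      proof eventually_elim
        case (elim i)
        have "real (L i) = \<tau> * (1 / \<tau> * real (L i))" using tau by simp
        also have "\<dots> \<le> \<tau> * (real (\<kappa> i) * real (L i))" using elim tau by (intro mult_left_mono mult_right_mono) auto
        also have "real (\<kappa> i) * real (L i) \<le> real (\<Sum>k<i. L k)"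
        proof -
          have "\<kappa> i * L i \<le> i" using kappa(2)[of i] by (simp add: L_def)
          also have "\<dots> \<le> (\<Sum>k<i. L k)" using sum_mono[of "{..<i}" "\<lambda>_. 1" L] L1 by simp
          finally show ?thesis unfolding of_nat_mult[symmetric] by (rule of_nat_mono)
        qed
        finally show ?case using tau by simp
      qed
    qed
  qed (use compact T family in auto)
  show ?thesis
  proof (rule exI[of _ e0], intro conjI allI impI)
    fix \<epsilon> \<omega> :: real assume e: "0 < \<epsilon>" "4 * \<epsilon> \<le> e0" and om: "\<forall>x y. d x y \<le> 2 * \<epsilon> \<longrightarrow> \<bar>\<Phi> j0 x - \<Phi> j0 y\<bar> \<le> \<omega>"
    show "ereal (h + integral\<^sup>L \<mu> (\<Phi> j0) - \<omega>) \<le> pressure_at d T Z (\<Phi> j0) \<epsilon>"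
      by (rule pressure_at_ge[OF e]) (use om Z in blast)+
  qed (rule e0(1))
qed

end

section \<open>Accumulation points of averages and of ratios\<close>

lemma birkhoff_ratio_tendsto:
  fixes f g :: "'m::finite \<Rightarrow> 'a \<Rightarrow> real"
  assumes f: "\<And>j. (\<lambda>k. birkhoff_sum T (f j) (r k) x / real (r k)) \<longlonglongrightarrow> a j"
    and g: "\<And>j. (\<lambda>k. birkhoff_sum T (g j) (r k) x / real (r k)) \<longlonglongrightarrow> b j" and b: "\<And>j. b j \<noteq> 0"
    and r: "filterlim r at_top sequentially"
  shows "(\<lambda>k. birkhoff_ratio T f g x (r k)) \<longlonglongrightarrow> (\<chi> j. a j / b j)"
proof (rule vec_tendstoI)
  fix j
  have "(\<lambda>k. (birkhoff_sum T (f j) (r k) x / real (r k)) / (birkhoff_sum T (g j) (r k) x / real (r k))) \<longlonglongrightarrow> a j / b j"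
    by (intro tendsto_divide f g b)
  moreover have "eventually (\<lambda>k. 1 \<le> r k) sequentially" using r by (simp add: filterlim_at_top)
  then have "eventually (\<lambda>k. (birkhoff_sum T (f j) (r k) x / real (r k)) / (birkhoff_sum T (g j) (r k) x / real (r k))
    = birkhoff_ratio T f g x (r k) $ j) sequentially"
    by eventually_elim (simp add: birkhoff_ratio_def)
  ultimately have "(\<lambda>k. birkhoff_ratio T f g x (r k) $ j) \<longlonglongrightarrow> a j / b j" by (rule Lim_transform_eventually)
  then show "(\<lambda>k. birkhoff_ratio T f g x (r k) $ j) \<longlonglongrightarrow> (\<chi> j. a j / b j) $ j" by simp
qed

text \<open>This is \<open>misiurewicz\<close> for the singletons \<open>{x}\<close> with
  \<open>c = 0\<close>: separation is void, and what is kept is an invariant measure whose integrals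
  are the limit of the averages.\<close>

lemma invariant_limit_of_averages:
  fixes T :: "'a::metric_space \<Rightarrow> 'a" and \<theta> :: "nat \<Rightarrow> 'a \<Rightarrow> real" and \<Phi> :: "'b::finite \<Rightarrow> 'a \<Rightarrow> real"
  assumes compact: "compact (UNIV :: 'a set)" and T: "continuous_on UNIV T" and dense: "dense_sequence \<theta>"
    and Phi: "\<And>j. continuous_on UNIV (\<Phi> j)"
  obtains r \<sigma> where "strict_mono r" "\<sigma> \<in> invariant_measures T"
    "(\<lambda>k. birkhoff_average T \<Phi> (r k) x) \<longlonglongrightarrow> (\<chi> j. integral\<^sup>L \<sigma> (\<Phi> j))"
proof -
  have "\<exists>B. \<forall>x. \<bar>\<Phi> j x\<bar> \<le> B" for j
    using continuous_bounded_compact[OF compact Phi[of j]] by blast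
  then obtain B where B: "\<And>j x. \<bar>\<Phi> j x\<bar> \<le> B j" by metis
  have "bounded (range (\<lambda>n. birkhoff_average T \<Phi> n x))"
  proof (rule boundedI)
    fix v assume "v \<in> range (\<lambda>n. birkhoff_average T \<Phi> n x)"
    then obtain n where v: "v = birkhoff_average T \<Phi> n x" by auto
    have "\<bar>v $ j\<bar> \<le> B j" for j
    proof (cases "n = 0")
      case True
      then show ?thesis using order.trans[OF abs_ge_zero B[of j x]] by (simp add: v birkhoff_average_def)
    next
      case False
      then show ?thesis using abs_birkhoff_sum_le[OF B[of j], where T = T and n = n and y = x]
        by (simp add: v birkhoff_average_def abs_divide divide_le_eq mult.commute)
    qed
    then show "norm v \<le> (\<Sum>j\<in>UNIV. B j)" by (intro order.trans[OF norm_le_l1_cart] sum_mono)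
  qed
  then obtain v r where r: "strict_mono r" and lim: "((\<lambda>n. birkhoff_average T \<Phi> n x) \<circ> r) \<longlonglongrightarrow> v"
    using bounded_imp_convergent_subsequence by blast
  have lim': "(\<lambda>k. birkhoff_average T \<Phi> (r k) x) \<longlonglongrightarrow> v" using lim by (simp add: o_def)
  \<comment> \<open>The shift excludes the length 0, where an average is a division by zero.\<close>
  define n where "n k = r (Suc k)" for k
  define \<delta> where "\<delta> k = norm (birkhoff_average T \<Phi> (n k) x - v)" for k
  have n1: "1 \<le> n k" for k
    using seq_suble[OF r, of "Suc k"] by (simp add: n_def)
  have "(\<lambda>k. birkhoff_average T \<Phi> (n k) x) \<longlonglongrightarrow> v"
    unfolding n_def using lim' by (rule LIMSEQ_Suc)
  then have delta: "\<delta> \<longlonglongrightarrow> 0" unfolding \<delta>_def[abs_def] by (intro tendsto_norm_zero) (simp add: LIM_zero_iff)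
  have n_lim: "filterlim n at_top sequentially"
    unfolding n_def[abs_def] by (rule filterlim_compose[OF filterlim_subseq[OF r] filterlim_Suc])
  have avg: "\<bar>birkhoff_sum T (\<Phi> j) (n k) y / real (n k) - v $ j\<bar> \<le> \<delta> k" if "y \<in> {x}" for k y j
    using component_le_norm_cart[of "birkhoff_average T \<Phi> (n k) x - v" j] that
    by (simp add: \<delta>_def birkhoff_average_def)
  have "\<exists>\<sigma>. \<sigma> \<in> invariant_measures T \<and> (\<forall>j. integral\<^sup>L \<sigma> (\<Phi> j) = v $ j)"
    by (rule misiurewicz[OF compact T dense n_lim n1, where E = "\<lambda>_. {x}" and e = 1 and c = 0
        and \<Phi> = \<Phi> and v = "($) v" and \<delta> = \<delta>]) (use Phi avg delta in auto)
  then obtain \<sigma> where sigma: "\<sigma> \<in> invariant_measures T" "\<forall>j. integral\<^sup>L \<sigma> (\<Phi> j) = v $ j" by blast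
  then have "(\<chi> j. integral\<^sup>L \<sigma> (\<Phi> j)) = v" by (simp add: vec_eq_iff)
  then show ?thesis using that[OF r sigma(1)] lim' by simp
qed

theorem corollary5p9:
  fixes T :: "'a::metric_space \<Rightarrow> 'a"
    and \<theta> :: "nat \<Rightarrow> 'a \<Rightarrow> real"
    and b :: "nat \<Rightarrow> nat"
    and f g :: "'m::finite \<Rightarrow> 'a \<Rightarrow> real"
    and C :: "(real ^ 'm) set"
    and \<psi> :: "'a \<Rightarrow> real"
  assumes "compact (UNIV :: 'a set)"
    and "continuous_on UNIV T"
    and "dense_sequence \<theta>"
    and "blowup b"
    and "almost_product (rho_dist \<theta>) T b"
    and "uniform_separation \<theta> T"
    and "\<And>i. continuous_on UNIV (f i)"
    and "\<And>i. continuous_on UNIV (g i)"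
    and "\<And>i x. g i x \<noteq> 0"
    and "\<And>i \<mu>. \<mu> \<in> invariant_measures T \<Longrightarrow> integral\<^sup>L \<mu> (g i) \<noteq> 0"
    and "closed C"
    and "convex C"
    and "continuous_on UNIV \<psi>"
  shows "pressure (rho_dist \<theta>) T {x. ratio_accumulation T f g x \<subseteq> C} \<psi> =
    (SUP \<mu> \<in> {\<mu> \<in> invariant_measures T.
                (\<chi> i. integral\<^sup>L \<mu> (f i) / integral\<^sup>L \<mu> (g i)) \<in> C}.
      metric_entropy T \<mu> + ereal (integral\<^sup>L \<mu> \<psi>))"
proof -
  note compact = assms(1) and T = assms(2) and dense = assms(3) and g_nonzero = assms(10)
  define d where "d = rho_dist \<theta>"
  interpret equivalent_metric d unfolding d_def by (rule equivalent_metric_rho_dist[OF compact dense])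
  define Z where "Z = {x. ratio_accumulation T f g x \<subseteq> C}"
  \<comment> \<open>\<open>None\<close> carries the weight, the other components the numerators and
    denominators; a limit of the whole vector determines ratios and weight together.\<close>
  define \<Phi> :: "('m + 'm) option \<Rightarrow> 'a \<Rightarrow> real" where
    "\<Phi> j = (case j of None \<Rightarrow> \<psi> | Some (Inl i) \<Rightarrow> f i | Some (Inr i) \<Rightarrow> g i)" for j
  have Phi: "continuous_on UNIV (\<Phi> j)" for j
    using assms(7,8,13) by (auto simp: \<Phi>_def split: option.split sum.split)
  have Phi_simps: "\<Phi> None = \<psi>" "\<Phi> (Some (Inl i)) = f i" "\<Phi> (Some (Inr i)) = g i" for i
    by (simp_all add: \<Phi>_def)
  define M where "M = {\<mu> \<in> invariant_measures T. (\<chi> i. integral\<^sup>L \<mu> (f i) / integral\<^sup>L \<mu> (g i)) \<in> C}"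
  define s where "s = (SUP \<mu>\<in>M. metric_entropy T \<mu> + ereal (integral\<^sup>L \<mu> \<psi>))"
  have modulus: "\<exists>r>0. \<forall>x y. d x y \<le> r \<longrightarrow> \<bar>\<psi> x - \<psi> y\<bar> \<le> \<omega>" if "0 < \<omega>" for \<omega>
    by (rule d_modulus[OF compact assms(13) that]) blast
  \<comment> \<open>The order characterisation of convergence also covers infinite \<open>s\<close>:
    for \<open>s = - \<infinity>\<close>, in particular for empty \<open>M\<close>, the lower half
    is void, and for \<open>s = \<infinity>\<close> the upper half is.\<close>
  have "((\<lambda>\<epsilon>. pressure_at d T Z \<psi> \<epsilon>) \<longlongrightarrow> s) (at_right 0)"
  proof (rule order_tendstoI)
    fix a assume "a < s"
    then obtain \<mu> where mu: "\<mu> \<in> M" "a < metric_entropy T \<mu> + ereal (integral\<^sup>L \<mu> \<psi>)"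
      unfolding s_def less_SUP_iff by blast
    have mu_inv: "\<mu> \<in> invariant_measures T" using mu(1) by (simp add: M_def)
    define p where "p = integral\<^sup>L \<mu> \<psi>"
    \<comment> \<open>The entropy may be infinite and \<open>a\<close> may be
      \<open>- \<infinity>\<close>, so real numbers are inserted: \<open>h\<close> below the entropy
      and \<open>z\<close> above \<open>a\<close>. The remaining gap is
      \<open>\<omega>\<close>.\<close>
    have "a - ereal p < metric_entropy T \<mu>" using mu(2) by (simp add: p_def ereal_minus_less)
    then obtain h where h: "a - ereal p < ereal h" "ereal h < metric_entropy T \<mu>" using ereal_dense2 by blast
    then have "a < ereal (h + p)" by (simp add: ereal_minus_less)
    then obtain z where z: "a < ereal z" "ereal z < ereal (h + p)" using ereal_dense2 by blast
    define \<omega> where "\<omega> = h + p - z"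
    have omega: "0 < \<omega>" "h + p - \<omega> = z" using z(2) by (auto simp: \<omega>_def)
    obtain r where r: "0 < r" "\<forall>x y. d x y \<le> r \<longrightarrow> \<bar>\<psi> x - \<psi> y\<bar> \<le> \<omega>" using modulus[OF omega(1)] by blast
    have Z_sat: "x \<in> Z" if lim: "\<And>j. (\<lambda>n. birkhoff_sum T (\<Phi> j) n x / real n) \<longlonglongrightarrow> integral\<^sup>L \<mu> (\<Phi> j)" for x
    proof -
      have "c \<in> C" if c: "c \<in> ratio_accumulation T f g x" for c
      proof -
        obtain q where q: "strict_mono q" "(birkhoff_ratio T f g x \<circ> q) \<longlonglongrightarrow> c"
          using c unfolding ratio_accumulation_def accumulation_points_def by blast
        have "(\<lambda>k. birkhoff_ratio T f g x (q k)) \<longlonglongrightarrow> (\<chi> i. integral\<^sup>L \<mu> (f i) / integral\<^sup>L \<mu> (g i))"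
        proof (rule birkhoff_ratio_tendsto)
          show "filterlim q at_top sequentially" by (rule filterlim_subseq[OF q(1)])
          show "(\<lambda>k. birkhoff_sum T (f i) (q k) x / real (q k)) \<longlonglongrightarrow> integral\<^sup>L \<mu> (f i)" for i
            using LIMSEQ_subseq_LIMSEQ[OF lim[of "Some (Inl i)"] q(1)] by (simp add: Phi_simps o_def)
          show "(\<lambda>k. birkhoff_sum T (g i) (q k) x / real (q k)) \<longlonglongrightarrow> integral\<^sup>L \<mu> (g i)" for i
            using LIMSEQ_subseq_LIMSEQ[OF lim[of "Some (Inr i)"] q(1)] by (simp add: Phi_simps o_def)
        qed (rule g_nonzero[OF mu_inv])
        then have "c = (\<chi> i. integral\<^sup>L \<mu> (f i) / integral\<^sup>L \<mu> (g i))"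
          using q(2) by (auto simp: o_def intro: LIMSEQ_unique)
        then show ?thesis using mu(1) by (simp add: M_def)
      qed
      then show ?thesis by (auto simp: Z_def)
    qed
    have b_lim: "(\<lambda>n. real (b n) / real n) \<longlonglongrightarrow> 0" using assms(4) by (simp add: blowup_def)
    have prod: "almost_product d T b" using assms(5) by (simp add: d_def)
    have "\<exists>e0>0. \<forall>\<epsilon> \<omega>. 0 < \<epsilon> \<longrightarrow> 4 * \<epsilon> \<le> e0 \<longrightarrow> (\<forall>x y. d x y \<le> 2 * \<epsilon> \<longrightarrow> \<bar>\<Phi> None x - \<Phi> None y\<bar> \<le> \<omega>) \<longrightarrow>
      ereal (h + integral\<^sup>L \<mu> (\<Phi> None) - \<omega>) \<le> pressure_at d T Z (\<Phi> None) \<epsilon>"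
      by (rule pressure_at_lower_bound[OF compact T mu_inv b_lim prod h(2) Phi Z_sat])
    then obtain e0 where e0: "0 < e0" "\<forall>\<epsilon> \<omega>. 0 < \<epsilon> \<longrightarrow> 4 * \<epsilon> \<le> e0 \<longrightarrow> (\<forall>x y. d x y \<le> 2 * \<epsilon> \<longrightarrow> \<bar>\<psi> x - \<psi> y\<bar> \<le> \<omega>) \<longrightarrow>
      ereal (h + p - \<omega>) \<le> pressure_at d T Z \<psi> \<epsilon>" unfolding Phi_simps p_def by blast
    show "eventually (\<lambda>\<epsilon>. a < pressure_at d T Z \<psi> \<epsilon>) (at_right 0)"
    proof (rule eventually_at_rightI[of 0 "min (e0 / 4) (r / 2)"])
      fix \<epsilon> assume e: "\<epsilon> \<in> {0<..<min (e0 / 4) (r / 2)}"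
      have "\<forall>x y. d x y \<le> 2 * \<epsilon> \<longrightarrow> \<bar>\<psi> x - \<psi> y\<bar> \<le> \<omega>" using r(2) e by auto
      then have "ereal (h + p - \<omega>) \<le> pressure_at d T Z \<psi> \<epsilon>" using e0(2) e by auto
      then show "a < pressure_at d T Z \<psi> \<epsilon>" using z(1) omega(2) by (simp add: less_le_trans)
    qed (use e0 r in auto)
  next
    fix a assume "s < a"
    then obtain s' where s': "s < ereal s'" "ereal s' < a" using ereal_dense2 by blast
    obtain t where t: "ereal s' < ereal t" "ereal t < a" using ereal_dense2[OF s'(2)] by blast
    define \<omega> where "\<omega> = (t - s') / 2"
    have omega: "0 < \<omega>" "s' + \<omega> < t" using t(1) by (simp_all add: \<omega>_def field_simps)
    obtain r where r: "0 < r" "\<forall>x y. d x y \<le> r \<longrightarrow> \<bar>\<psi> x - \<psi> y\<bar> \<le> \<omega>" using modulus[OF omega(1)] by blast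
    \<comment> \<open>Through division by zero \<open>D\<close> may contain vectors with vanishing
      denominators, but the integrals of an invariant measure never form such a vector.\<close>
    define D where "D = {v :: real ^ ('m + 'm) option. (\<chi> i. v $ Some (Inl i) / v $ Some (Inr i)) \<in> C}"
    have D: "metric_entropy T \<sigma> + ereal (integral\<^sup>L \<sigma> (\<Phi> None)) \<le> ereal s'"
      if "\<sigma> \<in> invariant_measures T" "(\<chi> j. integral\<^sup>L \<sigma> (\<Phi> j)) \<in> D" for \<sigma>
    proof -
      have "\<sigma> \<in> M" using that by (simp add: D_def M_def Phi_simps)
      then have "metric_entropy T \<sigma> + ereal (integral\<^sup>L \<sigma> \<psi>) \<le> s" unfolding s_def by (rule SUP_upper)
      then show ?thesis using s'(1) unfolding Phi_simps by (meson less_imp_le order.trans)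
    qed
    have Z_acc: "\<exists>v\<in>D. \<exists>q. strict_mono q \<and> (\<lambda>k. birkhoff_average T \<Phi> (q k) x) \<longlonglongrightarrow> v" if x: "x \<in> Z" for x
    proof -
      obtain q \<sigma> where q: "strict_mono q" and sigma: "\<sigma> \<in> invariant_measures T"
        and lim: "(\<lambda>k. birkhoff_average T \<Phi> (q k) x) \<longlonglongrightarrow> (\<chi> j. integral\<^sup>L \<sigma> (\<Phi> j))"
        by (rule invariant_limit_of_averages[OF compact T dense Phi])
      have comp: "(\<lambda>k. birkhoff_sum T (\<Phi> j) (q k) x / real (q k)) \<longlonglongrightarrow> integral\<^sup>L \<sigma> (\<Phi> j)" for j
        using tendsto_vec_nth[OF lim, of j] by (simp add: birkhoff_average_def)
      have ratio: "(\<lambda>k. birkhoff_ratio T f g x (q k)) \<longlonglongrightarrow> (\<chi> i. integral\<^sup>L \<sigma> (f i) / integral\<^sup>L \<sigma> (g i))"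
      proof (rule birkhoff_ratio_tendsto)
        show "filterlim q at_top sequentially" by (rule filterlim_subseq[OF q])
        show "(\<lambda>k. birkhoff_sum T (f i) (q k) x / real (q k)) \<longlonglongrightarrow> integral\<^sup>L \<sigma> (f i)" for i
          using comp[of "Some (Inl i)"] by (simp add: Phi_simps)
        show "(\<lambda>k. birkhoff_sum T (g i) (q k) x / real (q k)) \<longlonglongrightarrow> integral\<^sup>L \<sigma> (g i)" for i
          using comp[of "Some (Inr i)"] by (simp add: Phi_simps)
      qed (rule g_nonzero[OF sigma])
      \<comment> \<open>Accumulation points of the ratios are taken along indices with nonzero
        denominators, so an initial part of the subsequence has to be dropped.\<close>
      have "eventually (\<lambda>k. \<forall>i. birkhoff_sum T (g i) (q k) x \<noteq> 0) sequentially"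
      proof (rule eventually_all_finite)
        fix i
        have "eventually (\<lambda>k. birkhoff_sum T (g i) (q k) x / real (q k) \<noteq> 0) sequentially"
          using comp[of "Some (Inr i)"] g_nonzero[OF sigma, of i] by (intro tendsto_imp_eventually_ne) (simp_all add: Phi_simps)
        then show "eventually (\<lambda>k. birkhoff_sum T (g i) (q k) x \<noteq> 0) sequentially" by eventually_elim auto
      qed
      then obtain k0 where k0: "\<And>k i. k0 \<le> k \<Longrightarrow> birkhoff_sum T (g i) (q k) x \<noteq> 0" by (auto simp: eventually_sequentially)
      define q' where "q' k = q (k + k0)" for k
      have "strict_mono q'" using q by (simp add: strict_mono_def q'_def)
      moreover have "range q' \<subseteq> {n. \<forall>i. birkhoff_sum T (g i) n x \<noteq> 0}" using k0 by (auto simp: q'_def)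
      moreover have "(birkhoff_ratio T f g x \<circ> q') \<longlonglongrightarrow> (\<chi> i. integral\<^sup>L \<sigma> (f i) / integral\<^sup>L \<sigma> (g i))"
        using LIMSEQ_ignore_initial_segment[OF ratio, of k0] by (simp add: q'_def o_def)
      ultimately have "(\<chi> i. integral\<^sup>L \<sigma> (f i) / integral\<^sup>L \<sigma> (g i)) \<in> ratio_accumulation T f g x"
        unfolding ratio_accumulation_def accumulation_points_def by blast
      then have "(\<chi> j. integral\<^sup>L \<sigma> (\<Phi> j)) \<in> D" using x by (auto simp: Z_def D_def Phi_simps)
      then show ?thesis using q lim by blast
    qed
    show "eventually (\<lambda>\<epsilon>. pressure_at d T Z \<psi> \<epsilon> < a) (at_right 0)"
    proof (rule eventually_at_rightI[of 0 r])
      fix \<epsilon> assume e: "\<epsilon> \<in> {0<..<r}"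
      then have eps: "0 < \<epsilon>" by simp
      have om: "\<bar>\<Phi> None x - \<Phi> None y\<bar> \<le> \<omega>" if "d x y \<le> \<epsilon>" for x y
        using r(2) e that by (auto simp: Phi_simps)
      have "pressure_limit d T Z t (\<Phi> None) \<epsilon> = 0"
        by (rule pressure_limit_eq_0[OF compact T dense Phi eps om D Z_acc omega(2)])
      then have "pressure_at d T Z \<psi> \<epsilon> \<le> ereal t"
        unfolding pressure_at_def Phi_simps by (intro INF_lower) simp
      then show "pressure_at d T Z \<psi> \<epsilon> < a" using t(2) by (rule le_less_trans)
    qed (rule r(1))
  qed
  then have "pressure d T Z \<psi> = s"
    unfolding pressure_def by (intro tendsto_Lim) auto
  then show ?thesis by (simp add: d_def Z_def s_def M_def)
qed

end
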